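(* Let $V\in C^\infty(\mathbb R^d;\mathbb R)$ satisfy Assumptions (I) and (II), let $\boldsymbol\sigma\in\mathbb R^{d\times d}$ be constant and nonsingular, and let $\mathbf M\in C_c^\infty(\mathbb R^d;\mathbb R^d)$. Let $\rho^\varepsilon(\mathbf q,t)$ be the solution of $$\partial_t\rho^\varepsilon=\nabla\cdot\big(\boldsymbol\sigma\boldsymbol\sigma^T((\nabla V-\varepsilon\mathbf M)\rho^\varepsilon+\nabla\rho^\varepsilon)\big),\qquad\rho^\varepsilon(\mathbf q,0)=\rho_0(\mathbf q):=\tfrac1Ze^{-V(\mathbf q)},\quad Z:=\int_{\mathbb R^d}e^{-V}\,d\mathbf q,$$ and let $\rho^\varepsilon_\infty$ be the corresponding invariant probability density. Then there exist constants $\varepsilon_0>0$, $C>0$ and $r>0$, depending only on $V$, $\mathbf M$ and $\boldsymbol\sigma$, such that for all $\varepsilon\in[0,\varepsilon_0)$ (and all $t\ge 0$), $$\|\rho^\varepsilon(\cdot,t)-\rho^\varepsilon_\infty\|_{L^1(\mathbb R^d)}\le Ce^{-rt}.$$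
   Context: Assumption (I): there exist $\alpha>0$ and constants $C_1,C_2$ such that $|\nabla V(\mathbf x)|\le C_1|\mathbf x|^\alpha+C_2$ for all $\mathbf x$, and $\limsup_{|\mathbf x|\to\infty}\frac{-\mathbf x\cdot\nabla V(\mathbf x)}{|\mathbf x|^{\alpha+1}}=:\gamma_1<0$. Assumption (II): $\lambda:=\liminf_{|\mathbf x|\to\infty}\big(|\boldsymbol\sigma^T\nabla V(\mathbf x)|^2-2\,\mathrm{tr}(\boldsymbol\sigma\boldsymbol\sigma^T\nabla^2V(\mathbf x))\big)>0$. The equation is the Fokker–Planck equation of $d\mathbf q^\varepsilon_t=\boldsymbol\sigma\boldsymbol\sigma^T(-\nabla V(\mathbf q^\varepsilon)+\varepsilon\mathbf M(\mathbf q^\varepsilon))dt+\sqrt2\,\boldsymbol\sigma\,d\mathbf B$, $\mathbf q^\varepsilon_0\sim\rho_0$. Under Assumption (I) this SDE has a unique invariant probability measure, with density $\rho^\varepsilon_\infty$ (the unique probability density that is a stationary solution of the equation). *)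

theory Defs
  imports "HOL-Analysis.Analysis"
begin

(* Continuity of all iterated directional derivatives; on finite-dimensional spaces, the only
   ones used here, this is membership in C^k. *)
fun times_cont_differentiable ::
    "nat \<Rightarrow> ('a::real_normed_vector \<Rightarrow> 'b::real_normed_vector) \<Rightarrow> bool" where
  "times_cont_differentiable 0 f \<longleftrightarrow> continuous_on UNIV f"
| "times_cont_differentiable (Suc k) f \<longleftrightarrow>
     (\<forall>x. f differentiable at x) \<and>
     (\<forall>v. times_cont_differentiable k (\<lambda>x. frechet_derivative f (at x) v))"

definition smooth :: "('a::real_normed_vector \<Rightarrow> 'b::real_normed_vector) \<Rightarrow> bool" where
  "smooth f \<longleftrightarrow> (\<forall>k. times_cont_differentiable k f)"

definition smooth_compactly_supported ::
    "('a::real_normed_vector \<Rightarrow> 'b::real_normed_vector) \<Rightarrow> bool" where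
  "smooth_compactly_supported f \<longleftrightarrow> smooth f \<and> compact (closure {x. f x \<noteq> 0})"

(* The differential operators below return unspecified values at points where the function
   is not differentiable; they are only meaningful together with the regularity
   conditions that accompany them. *)

definition grad :: "(real^'d \<Rightarrow> real) \<Rightarrow> real^'d \<Rightarrow> real^'d" where
  "grad f x = (\<chi> i. frechet_derivative f (at x) (axis i 1))"

definition hessian :: "(real^'d \<Rightarrow> real) \<Rightarrow> real^'d \<Rightarrow> real^'d^'d" where
  "hessian f x = jacobian (grad f) (at x)"

definition divergence :: "(real^'d \<Rightarrow> real^'d) \<Rightarrow> real^'d \<Rightarrow> real" where
  "divergence F x = trace (jacobian F (at x))"

definition assumption_I :: "(real^'d \<Rightarrow> real) \<Rightarrow> bool" where
  "assumption_I V \<longleftrightarrow>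
     (\<exists>\<alpha>>0.
        (\<exists>C1 C2. \<forall>x. norm (grad V x) \<le> C1 * norm x powr \<alpha> + C2) \<and>
        Limsup at_infinity (\<lambda>x. ereal (- (x \<bullet> grad V x) / norm x powr (\<alpha> + 1))) < 0)"

(* The lower limit is taken in the extended reals: the value \<infinity> is allowed, and is in
   fact the typical one. *)
definition assumption_II :: "(real^'d^'d) \<Rightarrow> (real^'d \<Rightarrow> real) \<Rightarrow> bool" where
  "assumption_II \<sigma> V \<longleftrightarrow>
     Liminf at_infinity
       (\<lambda>x. ereal ((norm (transpose \<sigma> *v grad V x))\<^sup>2
                    - 2 * trace (\<sigma> ** transpose \<sigma> ** hessian V x))) > 0"

definition prob_density :: "(real^'d \<Rightarrow> real) \<Rightarrow> bool" where
  "prob_density f \<longleftrightarrow>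
     (\<forall>x. 0 \<le> f x) \<and> integrable lborel f \<and> (\<integral>x. f x \<partial>lborel) = 1"

definition gibbs_density :: "(real^'d \<Rightarrow> real) \<Rightarrow> real^'d \<Rightarrow> real" where
  "gibbs_density V q = exp (- V q) / (\<integral>x. exp (- V x) \<partial>lborel)"

(* Classical regularity on the open half space t > 0 (once in time, twice in space, with
   jointly continuous derivatives), continuity up to t = 0. Time is the first argument. *)
definition C12_regular :: "(real \<Rightarrow> real^'d \<Rightarrow> real) \<Rightarrow> bool" where
  "C12_regular u \<longleftrightarrow>
     continuous_on ({0..} \<times> UNIV) (\<lambda>(t, q). u t q) \<and>
     (\<forall>t>0. \<forall>q. (\<lambda>s. u s q) differentiable at t) \<and>
     (\<forall>t>0. times_cont_differentiable 2 (u t)) \<and>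
     continuous_on ({0<..} \<times> UNIV) (\<lambda>(t, q). deriv (\<lambda>s. u s q) t) \<and>
     continuous_on ({0<..} \<times> UNIV) (\<lambda>(t, q). grad (u t) q) \<and>
     continuous_on ({0<..} \<times> UNIV) (\<lambda>(t, q). hessian (u t) q)"

definition fokker_planck_equation ::
    "(real^'d \<Rightarrow> real) \<Rightarrow> (real^'d \<Rightarrow> real^'d) \<Rightarrow> (real^'d^'d) \<Rightarrow> real \<Rightarrow>
     (real \<Rightarrow> real^'d \<Rightarrow> real) \<Rightarrow> bool" where
  "fokker_planck_equation V M \<sigma> \<epsilon> u \<longleftrightarrow>
     C12_regular u \<and>
     (\<forall>t>0. \<forall>q.
        deriv (\<lambda>s. u s q) t =
        divergence
          (\<lambda>x. (\<sigma> ** transpose \<sigma>) *v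
                 (u t x *\<^sub>R (grad V x - \<epsilon> *\<^sub>R M x) + grad (u t) x)) q)"

(* The equation describes the law of a diffusion with initial density \<rho>0, so solutions are
   understood in the class of probability densities. Some such restriction is needed to speak
   of "the" solution, because parabolic equations on the whole space admit spurious classical
   solutions that are unbounded or change sign. *)
definition fokker_planck_solution ::
    "(real^'d \<Rightarrow> real) \<Rightarrow> (real^'d \<Rightarrow> real^'d) \<Rightarrow> (real^'d^'d) \<Rightarrow> real \<Rightarrow>
     (real^'d \<Rightarrow> real) \<Rightarrow> (real \<Rightarrow> real^'d \<Rightarrow> real) \<Rightarrow> bool" where
  "fokker_planck_solution V M \<sigma> \<epsilon> \<rho>0 u \<longleftrightarrow>
     fokker_planck_equation V M \<sigma> \<epsilon> u \<and>
     u 0 = \<rho>0 \<and>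
     (\<forall>t\<ge>0. prob_density (u t))"

definition invariant_density ::
    "(real^'d \<Rightarrow> real) \<Rightarrow> (real^'d \<Rightarrow> real^'d) \<Rightarrow> (real^'d^'d) \<Rightarrow> real \<Rightarrow>
     (real^'d \<Rightarrow> real) \<Rightarrow> bool" where
  "invariant_density V M \<sigma> \<epsilon> \<rho> \<longleftrightarrow>
     prob_density \<rho> \<and> fokker_planck_equation V M \<sigma> \<epsilon> (\<lambda>t. \<rho>)"

end

theory Submission
  imports Defs
begin

text \<open>
  Let \<open>p\<close> be the Gibbs density, \<open>T = \<sigma>\<^sup>T\<close>, and write \<open>\<rho> = w p\<close>, \<open>\<rho>\<^sub>\<infinity> = h p\<close>. If \<open>w\<close> and \<open>h\<close> are known to be
  in \<open>L\<^sup>2(p)\<close>, then \<open>g = w - h\<close> has mean zero and testing the equation with \<open>g\<close> gives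
  \<open>d/dt \<integral>g\<^sup>2p \<le> - \<integral>\<bar>T\<nabla>g\<bar>\<^sup>2p + O(\<epsilon>\<^sup>2) \<integral>g\<^sup>2p\<close>, so a Poincare inequality for \<open>p\<close> yields exponential decay for
  small \<open>\<epsilon>\<close>. The Poincare inequality follows from Assumption (II), which says that \<open>e\<^sup>V\<^sup>/\<^sup>2\<close> is a
  Lyapunov function, and from the Poincare inequality on a ball.

  The solutions are only known to be classical probability densities, so integrability in \<open>L\<^sup>2(p)\<close>
  has to be derived. For this the equation is tested with \<open>\<phi>\<^sup>2S'(w)\<close>, where \<open>\<phi>\<close> is a cutoff and \<open>S\<close>
  is convex and bounded on the half line. Adding to \<open>S(w)\<close> the linear function \<open>kw/3\<close>, whose
  integral is constant by conservation of mass, turns \<open>S\<close> into a truncation of \<open>w\<^sup>2/2\<close>, and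
  no decay of \<open>w\<close> at infinity is needed to remove the cutoff.
\<close>

section \<open>Gradients and integration by parts\<close>

text \<open>Testing with \<open>\<phi>\<^sup>2S'(w)\<close> leaves, from the gradient of the cutoff,
  a cross term in \<open>S'(w)\<close> and a drift term in \<open>w S'(w)\<close>. Absorbing the
  former into the dissipation, whose density is \<open>S''(w)\<close>, costs
  \<open>S'(w)\<^sup>2 / S''(w)\<close>. For \<open>S(h) = h\<^sup>2 / 2\<close> both costs are
  \<open>w\<^sup>2\<close>, whose integrability is just what is missing. In terms of
  \<open>r = k / (k + h)\<close> the chosen function has \<open>S' = - (k / 3) r^3\<close> and
  \<open>S'' = r^4\<close>; both costs are then at most a multiple of \<open>k\<^sup>2\<close>,
  integrable because \<open>p\<close> is, and vanish as the radius grows with \<open>k\<close>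
  fixed. Moreover \<open>S''\<close> is the square of the derivative of \<open>truncation k\<close>,
  so the dissipation is that of the truncated function, to which the Poincare inequality applies.
  For the evolution this gives a bound that may grow in time, but the decay estimate needs only
  finiteness on bounded time intervals. For a stationary state the energy is constant in time, so
  the Poincare inequality and the smallness of \<open>\<epsilon>\<close> bound the norm
  outright.\<close>

definition has_gradient :: "('a::euclidean_space \<Rightarrow> real) \<Rightarrow> ('a \<Rightarrow> 'a) \<Rightarrow> bool" where
  "has_gradient f G \<longleftrightarrow>
     (\<forall>x. (f has_derivative (\<lambda>v. G x \<bullet> v)) (at x)) \<and> continuous_on UNIV G"

lemma continuous_on_UNIV_if_has_derivative:
  "(\<And>x. (f has_derivative D x) (at x)) \<Longrightarrow> continuous_on UNIV f"
  by (rule has_derivative_continuous_on[of _ _ D]) simp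

lemma
  fixes f :: "'a::euclidean_space \<Rightarrow> real"
  assumes cont: "continuous_on UNIV f" and supp: "\<And>x. R < norm x \<Longrightarrow> f x = 0"
  shows integrable_bounded_support: "integrable lborel f"
    and integral_bounded_support:
      "cball 0 R \<subseteq> cbox a b \<Longrightarrow> integral\<^sup>L lborel f = integral (cbox a b) f"
proof -
  have eq: "(\<lambda>x. indicator (cball 0 R) x *\<^sub>R f x) = f"
    using supp by (auto simp: fun_eq_iff indicator_def)
  have "integrable lborel (\<lambda>x. indicator (cball 0 R) x *\<^sub>R f x)"
    by (rule borel_integrable_compact) (auto intro: continuous_on_subset[OF cont])
  then show int: "integrable lborel f"
    by (simp only: eq)
  assume sub: "cball 0 R \<subseteq> cbox a b"
  have "integral\<^sup>L lborel f = integral UNIV f"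
    using int by (rule integral_lborel[symmetric])
  also have "\<dots> = integral UNIV (\<lambda>x. if x \<in> cbox a b then f x else 0)"
    by (rule arg_cong[where f="integral UNIV"]) (use sub supp in \<open>force simp: fun_eq_iff\<close>)
  also have "\<dots> = integral (cbox a b) f"
    by (rule Henstock_Kurzweil_Integration.integral_restrict_UNIV)
  finally show "integral\<^sup>L lborel f = integral (cbox a b) f" .
qed

text \<open>By translation invariance the integral of \<open>f (x + s *\<^sub>R v)\<close> does not
  depend on \<open>s\<close>; differentiating it under the integral sign at \<open>s = 0\<close>
  gives the integral of \<open>D x v\<close>.\<close>

lemma integral_directional_derivative_eq_0:
  fixes f :: "'a::euclidean_space \<Rightarrow> real"
  assumes der: "\<And>x. (f has_derivative D x) (at x)"
    and cont: "continuous_on UNIV (\<lambda>x. D x v)"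
    and supp: "\<And>x. R < norm x \<Longrightarrow> f x = 0"
  shows "(\<integral>x. D x v \<partial>lborel) = 0"
proof -
  have contf: "continuous_on UNIV f"
    by (rule continuous_on_UNIV_if_has_derivative) (rule der)
  have suppD: "D x v = 0" if "R < norm x" for x
  proof -
    have "open {x::'a. R < norm x}"
      by (intro open_Collect_less continuous_intros)
    then have "(f has_derivative (\<lambda>_. 0)) (at x)"
      by (rule has_derivative_transform_within_open[OF has_derivative_const[of 0]]) (use that supp in auto)
    then have "D x = (\<lambda>_. 0)"
      using der has_derivative_unique by blast
    then show ?thesis by simp
  qed
  \<comment> \<open>One box containing the support of every translate with \<open>s\<close> between
    -1 and 1, so that the Leibniz rule works over a fixed compact domain.\<close>
  obtain c where c: "cball 0 (R + norm v) \<subseteq> cbox (-c) (c::'a)"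
    using bounded_subset_cbox_symmetric[OF bounded_cball] by blast
  have supp': "f (x + s *\<^sub>R v) = 0" if "R + norm v < norm x" "s \<in> {-1..1}" for x s
  proof (rule supp)
    have "norm (s *\<^sub>R v) \<le> norm v"
      using that by (simp add: mult_left_le_one_le abs_le_iff)
    moreover have "norm x \<le> norm (x + s *\<^sub>R v) + norm (s *\<^sub>R v)"
      by (metis add_diff_cancel norm_triangle_ineq4)
    ultimately show "R < norm (x + s *\<^sub>R v)"
      using that by linarith
  qed
  have transl: "(\<integral>x. f (x + w) \<partial>lborel) = integral\<^sup>L lborel f" for w
    using integral_distr[of "(+) w" lborel borel f] borel_measurable_continuous_onI[OF contf]
    by (simp add: lborel_distr_plus add.commute)
  have shift: "integral (cbox (-c) c) (\<lambda>x. f (x + s *\<^sub>R v)) = integral\<^sup>L lborel f" if "s \<in> {-1..1}" for s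
  proof -
    have "integral\<^sup>L lborel (\<lambda>x. f (x + s *\<^sub>R v)) = integral (cbox (-c) c) (\<lambda>x. f (x + s *\<^sub>R v))"
      by (rule integral_bounded_support[OF _ supp' c])
         (use that in \<open>auto intro!: continuous_intros continuous_on_compose2[OF contf]\<close>)
    then show ?thesis using transl by simp
  qed
  have "((\<lambda>s. integral (cbox (-c) c) (\<lambda>x. f (x + s *\<^sub>R v))) has_field_derivative
      integral (cbox (-c) c) (\<lambda>x. D (x + 0 *\<^sub>R v) v)) (at 0 within {-1..1})"
  proof (rule leibniz_rule_field_derivative)
    fix s :: real and x assume "s \<in> {-1..1}"
    have lin: "linear (D (x + s *\<^sub>R v))"
      using der has_derivative_linear by blast
    have "((\<lambda>s. f (x + s *\<^sub>R v)) has_derivative (\<lambda>h. D (x + s *\<^sub>R v) (0 + h *\<^sub>R v))) (at s)"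
      by (rule has_derivative_compose[OF _ der]) (auto intro!: derivative_eq_intros)
    then have "((\<lambda>s. f (x + s *\<^sub>R v)) has_derivative (\<lambda>h. h * D (x + s *\<^sub>R v) v)) (at s)"
      using lin by (simp add: linear_cmul)
    then have "((\<lambda>s. f (x + s *\<^sub>R v)) has_field_derivative D (x + s *\<^sub>R v) v) (at s)"
      by (simp add: has_field_derivative_def mult_commute_abs)
    then show "((\<lambda>s. f (x + s *\<^sub>R v)) has_field_derivative D (x + s *\<^sub>R v) v) (at s within {-1..1})"
      by (rule has_field_derivative_at_within)
  next
    fix s :: real
    show "(\<lambda>x. f (x + s *\<^sub>R v)) integrable_on cbox (- c) c"
      by (intro integrable_continuous continuous_on_compose2[OF contf] continuous_intros) auto
  next
    show "continuous_on ({-1..1} \<times> cbox (- c) c) (\<lambda>(s, x). D (x + s *\<^sub>R v) v)"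
      unfolding split_beta
      by (rule continuous_on_compose2[OF cont]) (auto intro!: continuous_intros)
  qed auto
  then have "((\<lambda>s. integral\<^sup>L lborel f) has_field_derivative
      integral (cbox (-c) c) (\<lambda>x. D x v)) (at 0 within {-1..1})"
    unfolding scaleR_zero_left add_0_right
    by (rule has_field_derivative_transform_within[where d=1]) (auto simp: shift)
  then have "((\<lambda>s::real. integral\<^sup>L lborel f) has_field_derivative
      integral (cbox (-c) c) (\<lambda>x. D x v)) (at 0)"
    by (simp add: at_within_interior[of 0 "{-1..1::real}"])
  then have "integral (cbox (-c) c) (\<lambda>x. D x v) = 0"
    using DERIV_const DERIV_unique by blast
  moreover have "(\<integral>x. D x v \<partial>lborel) = integral (cbox (-c) c) (\<lambda>x. D x v)"
    using suppD subset_trans[OF _ c, of "cball 0 R"]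
    by (intro integral_bounded_support[OF cont, of R]) (simp_all add: subset_cball)
  ultimately show ?thesis by simp
qed

lemma has_gradient_imp_continuous: "has_gradient f G \<Longrightarrow> continuous_on UNIV f"
  unfolding has_gradient_def
  by (rule continuous_on_UNIV_if_has_derivative[of f "\<lambda>x v. G x \<bullet> v"]) simp

lemma has_gradient_support:
  assumes "has_gradient f G" "\<And>x. R < norm x \<Longrightarrow> f x = 0" "R < norm x"
  shows "G x = 0"
proof -
  have "open {x::'a. R < norm x}"
    by (intro open_Collect_less continuous_intros)
  then have "(f has_derivative (\<lambda>_. 0)) (at x)"
    by (rule has_derivative_transform_within_open[OF has_derivative_const[of 0]]) (use assms in auto)
  moreover have "(f has_derivative (\<lambda>v. G x \<bullet> v)) (at x)"
    using assms by (auto simp: has_gradient_def)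
  ultimately have "(\<lambda>v. G x \<bullet> v) = (\<lambda>_. 0)"
    using has_derivative_unique by blast
  then show ?thesis
    by (metis inner_eq_zero_iff)
qed

lemma has_gradient_mult:
  assumes "has_gradient f F" "has_gradient g G"
  shows "has_gradient (\<lambda>x. f x * g x) (\<lambda>x. f x *\<^sub>R G x + g x *\<^sub>R F x)"
  using assms has_gradient_imp_continuous[OF assms(1)] has_gradient_imp_continuous[OF assms(2)]
  unfolding has_gradient_def
  by (auto intro!: continuous_intros derivative_eq_intros simp: inner_add_left algebra_simps)

lemma has_gradient_compose:
  assumes f: "has_gradient f F" and S: "\<And>x. (S has_real_derivative S' (f x)) (at (f x))"
    and S': "continuous_on UNIV (\<lambda>x. S' (f x))"
  shows "has_gradient (\<lambda>x. S (f x)) (\<lambda>x. S' (f x) *\<^sub>R F x)"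
proof -
  have "((\<lambda>x. S (f x)) has_derivative (\<lambda>v. S' (f x) * (F x \<bullet> v))) (at x)" for x
    by (rule has_derivative_compose[of f "\<lambda>v. F x \<bullet> v"])
       (use f S in \<open>auto simp: has_gradient_def has_field_derivative_def\<close>)
  then show ?thesis
    using f S' by (auto simp: has_gradient_def intro!: continuous_intros)
qed

lemma has_gradient_diff:
  assumes "has_gradient f F" "has_gradient g G"
  shows "has_gradient (\<lambda>x. f x - g x) (\<lambda>x. F x - G x)"
  using assms unfolding has_gradient_def
  by (auto intro!: continuous_intros derivative_eq_intros simp: inner_diff_left)

lemma has_gradient_const: "has_gradient (\<lambda>x. c) (\<lambda>x. 0)"
  by (simp add: has_gradient_def)

section \<open>Calculus of continuously differentiable maps and the divergence theorem\<close>

text \<open>Uniqueness of the derivative frees the recursive definition from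
  \<open>frechet_derivative\<close>: for closure properties it suffices to exhibit a candidate
  derivative whose directional values are continuous.\<close>

lemma tcd_Suc0_iff:
  "times_cont_differentiable (Suc 0) f \<longleftrightarrow>
     (\<exists>D. (\<forall>x. (f has_derivative D x) (at x)) \<and> (\<forall>v. continuous_on UNIV (\<lambda>x. D x v)))"
  (is "?L \<longleftrightarrow> ?R")
proof
  assume ?L
  then show ?R
    by (intro exI[of _ "\<lambda>x. frechet_derivative f (at x)"]) (simp add: frechet_derivative_works)
next
  assume ?R
  then obtain D where "\<forall>x. (f has_derivative D x) (at x)" "\<forall>v. continuous_on UNIV (\<lambda>x. D x v)"
    by blast
  moreover from this have "D = (\<lambda>x. frechet_derivative f (at x))"
    by (auto intro!: frechet_derivative_at)
  ultimately show ?L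
    by (auto simp: differentiable_def)
qed

lemma tcd_Suc0_continuous: "times_cont_differentiable (Suc 0) f \<Longrightarrow> continuous_on UNIV f"
  unfolding tcd_Suc0_iff by (blast intro: continuous_on_UNIV_if_has_derivative)

lemma tcd_Suc0_add:
  "times_cont_differentiable (Suc 0) f \<Longrightarrow> times_cont_differentiable (Suc 0) g \<Longrightarrow>
   times_cont_differentiable (Suc 0) (\<lambda>x. f x + g x)"
  unfolding tcd_Suc0_iff
  by (elim exE, rename_tac D E, rule_tac x="\<lambda>x v. D x v + E x v" in exI)
     (auto intro!: continuous_intros derivative_eq_intros)

lemma tcd_Suc0_scaleR:
  assumes "times_cont_differentiable (Suc 0) f" "times_cont_differentiable (Suc 0) g"
  shows "times_cont_differentiable (Suc 0) (\<lambda>x. f x *\<^sub>R g x)"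
proof -
  have "continuous_on UNIV f" "continuous_on UNIV g"
    using assms by (auto intro: tcd_Suc0_continuous)
  with assms show ?thesis
    unfolding tcd_Suc0_iff
    by (elim exE, rename_tac D E, rule_tac x="\<lambda>x v. f x *\<^sub>R E x v + D x v *\<^sub>R g x" in exI)
       (auto intro!: continuous_intros derivative_eq_intros)
qed

lemma tcd_Suc0_bounded_linear:
  assumes "bounded_linear L" "times_cont_differentiable (Suc 0) f"
  shows "times_cont_differentiable (Suc 0) (\<lambda>x. L (f x))"
  using assms(2) unfolding tcd_Suc0_iff
  by (elim exE, rename_tac D, rule_tac x="\<lambda>x v. L (D x v)" in exI)
     (auto intro!: bounded_linear.has_derivative[OF assms(1)] 
        continuous_on_compose2[OF linear_continuous_on[OF assms(1), of UNIV]])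

lemma tcd_Suc_imp: "times_cont_differentiable (Suc k) f \<Longrightarrow> times_cont_differentiable k f"
proof (induction k arbitrary: f)
  case 0
  then show ?case
    by (auto intro!: differentiable_imp_continuous_on simp: differentiable_on_def)
qed auto

lemma tcd_vecI:
  fixes f :: "'a::real_normed_vector \<Rightarrow> real^'d"
  assumes "\<And>i. times_cont_differentiable (Suc 0) (\<lambda>x. f x $ i)"
  shows "times_cont_differentiable (Suc 0) f"
proof -
  have "\<forall>i. \<exists>D. (\<forall>x. ((\<lambda>x. f x $ i) has_derivative D x) (at x)) \<and> (\<forall>v. continuous_on UNIV (\<lambda>x. D x v))"
    using assms unfolding tcd_Suc0_iff by blast
  then obtain D where D: "\<And>i x. ((\<lambda>x. f x $ i) has_derivative D i x) (at x)"
      "\<And>i v. continuous_on UNIV (\<lambda>x. D i x v)"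
    by metis
  have "(f has_derivative (\<lambda>v. \<chi> i. D i x v)) (at x)" for x
    unfolding has_derivative_componentwise_within[of f _ x UNIV]
    by (auto simp: Basis_vec_def inner_axis D)
  then show ?thesis
    unfolding tcd_Suc0_iff using D
    by (intro exI[of _ "\<lambda>x v. \<chi> i. D i x v"]) (auto intro!: continuous_intros)
qed

lemma has_gradient_grad:
  fixes f :: "real^'d \<Rightarrow> real"
  assumes "times_cont_differentiable (Suc 0) f"
  shows "has_gradient f (grad f)"
proof -
  have "(f has_derivative (\<lambda>v. grad f x \<bullet> v)) (at x)" for x
  proof -
    have der: "(f has_derivative frechet_derivative f (at x)) (at x)"
      using assms by (simp add: frechet_derivative_works)
    then have lin: "linear (frechet_derivative f (at x))"
      by (rule has_derivative_linear)
    have "frechet_derivative f (at x) v = grad f x \<bullet> v" for v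
    proof -
      have "frechet_derivative f (at x) v = frechet_derivative f (at x) (\<Sum>i\<in>UNIV. v $ i *\<^sub>R axis i 1)"
        using basis_expansion[of v] by (simp add: scalar_mult_eq_scaleR)
      also have "\<dots> = (\<Sum>i\<in>UNIV. v $ i * frechet_derivative f (at x) (axis i 1))"
        by (simp add: linear_sum[OF lin] linear_cmul[OF lin])
      finally show ?thesis
        by (simp add: inner_vec_def grad_def mult.commute)
    qed
    then show ?thesis using der by presburger
  qed
  moreover have "continuous_on UNIV (grad f)"
    using assms unfolding grad_def by (auto intro!: continuous_intros)
  ultimately show ?thesis
    by (simp add: has_gradient_def)
qed

lemma tcd_grad:
  fixes f :: "real^'d \<Rightarrow> real"
  assumes "times_cont_differentiable (Suc (Suc 0)) f"
  shows "times_cont_differentiable (Suc 0) (grad f)"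
proof (rule tcd_vecI)
  fix i
  have "(\<lambda>x. grad f x $ i) = (\<lambda>x. frechet_derivative f (at x) (axis i 1))"
    by (simp add: grad_def)
  then show "times_cont_differentiable (Suc 0) (\<lambda>x. grad f x $ i)"
    using assms by auto
qed

text \<open>The product of \<open>\<psi>\<close> with the i-th component of \<open>F\<close>,
  differentiated along the i-th axis, integrates to zero; summing over the axes gives the claim. All
  boundedness of support sits in \<open>\<psi>\<close>, so the flux \<open>F\<close> may grow at
  will.\<close>

theorem integration_by_parts:
  fixes F :: "real^'d \<Rightarrow> real^'d"
  assumes \<psi>: "has_gradient \<psi> G" and supp: "\<And>x. R < norm x \<Longrightarrow> \<psi> x = 0"
    and F: "times_cont_differentiable (Suc 0) F"
  shows "(\<integral>x. \<psi> x * divergence F x \<partial>lborel) = - (\<integral>x. G x \<bullet> F x \<partial>lborel)"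
proof -
  define D where "D = (\<lambda>x. frechet_derivative F (at x))"
  have D: "\<And>x. (F has_derivative D x) (at x)" "\<And>v. continuous_on UNIV (\<lambda>x. D x v)"
    using F by (auto simp: D_def frechet_derivative_works)
  have div: "divergence F x = (\<Sum>i\<in>UNIV. D x (axis i 1) $ i)" for x
    by (simp add: divergence_def trace_def jacobian_def D_def matrix_def)
  have cF: "continuous_on UNIV F" and c\<psi>: "continuous_on UNIV \<psi>" and cG: "continuous_on UNIV G"
    using F \<psi> by (auto intro: tcd_Suc0_continuous has_gradient_imp_continuous simp: has_gradient_def)
  have suppG: "\<And>x. R < norm x \<Longrightarrow> G x = 0"
    using has_gradient_support[OF \<psi> supp] by blast
  have zero: "(\<integral>x. \<psi> x * D x (axis i 1) $ i + G x $ i * F x $ i \<partial>lborel) = 0" for i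
  proof -
    have "(\<integral>x. (\<lambda>v. \<psi> x * D x v $ i + (G x \<bullet> v) * F x $ i) (axis i 1) \<partial>lborel) = 0"
    proof (rule integral_directional_derivative_eq_0)
      fix x show "((\<lambda>x. \<psi> x * F x $ i) has_derivative (\<lambda>v. \<psi> x * D x v $ i + G x \<bullet> v * F x $ i)) (at x)"
        using \<psi> D by (auto simp: has_gradient_def intro!: derivative_eq_intros bounded_linear.has_derivative[OF bounded_linear_vec_nth])
    qed (use supp in \<open>auto intro!: continuous_intros c\<psi> cG cF D\<close>)
    then show ?thesis by (simp add: inner_axis)
  qed
  have int1: "integrable lborel (\<lambda>x. \<psi> x * divergence F x)"
    unfolding div using supp by (intro integrable_bounded_support[of _ R] continuous_intros c\<psi> D) auto
  have int2: "integrable lborel (\<lambda>x. G x \<bullet> F x)"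
    using suppG by (intro integrable_bounded_support[of _ R] continuous_intros cG cF) auto
  have "(\<integral>x. \<psi> x * divergence F x \<partial>lborel) + (\<integral>x. G x \<bullet> F x \<partial>lborel) =
      (\<integral>x. \<psi> x * divergence F x + G x \<bullet> F x \<partial>lborel)"
    using int1 int2 by simp
  also have "\<dots> = (\<integral>x. (\<Sum>i\<in>UNIV. \<psi> x * D x (axis i 1) $ i + G x $ i * F x $ i) \<partial>lborel)"
    by (simp add: div inner_vec_def sum.distrib sum_distrib_left)
  also have "\<dots> = (\<Sum>i\<in>UNIV. (\<integral>x. \<psi> x * D x (axis i 1) $ i + G x $ i * F x $ i \<partial>lborel))"
    by (intro Bochner_Integration.integral_sum integrable_bounded_support[of _ R] continuous_intros c\<psi> cG cF D)
       (use supp suppG in auto)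
  finally show ?thesis by (simp add: zero)
qed

section \<open>The Poincare inequality on a ball\<close>

text \<open>The Jacobian of the dilation is \<open>s ^ DIM('a)\<close>, whose inverse is at most
  \<open>2 ^ DIM('a)\<close> once \<open>s\<close> is at least one half.\<close>

lemma nn_integral_dilation_le:
  fixes g :: "'a::euclidean_space \<Rightarrow> ennreal"
  assumes [measurable]: "g \<in> borel_measurable borel" and s: "1 / 2 \<le> (s::real)"
  shows "(\<integral>\<^sup>+x. g (t + s *\<^sub>R x) \<partial>lborel) \<le> 2 ^ DIM('a) * (\<integral>\<^sup>+x. g x \<partial>lborel)"
proof -
  have "(\<integral>\<^sup>+x. g x \<partial>lborel) = ennreal (s ^ DIM('a)) * (\<integral>\<^sup>+x. g (t + s *\<^sub>R x) \<partial>lborel)"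
    by (subst lborel_affine[of s t]) (use s in \<open>simp_all add: nn_integral_density nn_integral_distr nn_integral_cmult\<close>)
  then have eq: "2 ^ DIM('a) * (\<integral>\<^sup>+x. g x \<partial>lborel) = 
      ennreal (2 ^ DIM('a)) * ennreal (s ^ DIM('a)) * (\<integral>\<^sup>+x. g (t + s *\<^sub>R x) \<partial>lborel)"
    by (simp add: mult.assoc flip: ennreal_power)
  have "1 \<le> (2 * s) ^ DIM('a)"
    using s by (intro one_le_power) auto
  then have "1 \<le> ennreal (2 ^ DIM('a)) * ennreal (s ^ DIM('a))"
    using s by (simp add: power_mult_distrib flip: ennreal_mult')
  then show ?thesis
    unfolding eq by (metis mult_1 mult_right_mono zero_le)
qed

lemma nn_integral_indicator_continuous:
  fixes g :: "'a::euclidean_space \<Rightarrow> real"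
  assumes "compact S" "continuous_on S g" and nn: "\<And>x. x \<in> S \<Longrightarrow> 0 \<le> g x"
  shows "(\<integral>\<^sup>+x. indicator S x * ennreal (g x) \<partial>lborel) = ennreal (\<integral>x. indicator S x * g x \<partial>lborel)"
    and "(\<integral>\<^sup>+x. indicator S x * ennreal (g x) \<partial>lborel) = ennreal (integral S g)"
proof -
  have int: "integrable lborel (\<lambda>x. indicator S x *\<^sub>R g x)"
    using assms by (intro borel_integrable_compact)
  have "(\<integral>\<^sup>+x. indicator S x * ennreal (g x) \<partial>lborel) = (\<integral>\<^sup>+x. ennreal (indicator S x *\<^sub>R g x) \<partial>lborel)"
    by (intro nn_integral_cong) (simp add: indicator_def)
  also have "\<dots> = ennreal (\<integral>x. indicator S x *\<^sub>R g x \<partial>lborel)"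
    using int nn by (intro nn_integral_eq_integral) (auto simp: indicator_def)
  finally show *: "(\<integral>\<^sup>+x. indicator S x * ennreal (g x) \<partial>lborel) = ennreal (\<integral>x. indicator S x * g x \<partial>lborel)"
    by simp
  show "(\<integral>\<^sup>+x. indicator S x * ennreal (g x) \<partial>lborel) = ennreal (integral S g)"
    using set_borel_integral_eq_integral(2)[of S g] int
    unfolding * by (simp add: set_integrable_def set_lebesgue_integral_def)
qed

text \<open>The fundamental theorem of calculus along the segment from \<open>y\<close> to
  \<open>x\<close>, followed by Jensen's inequality on the unit interval. Working in
  \<open>ennreal\<close> allows exchanging integrals later without integrability conditions.\<close>

lemma squared_diff_le_integral_gradient:
  fixes f :: "'a::euclidean_space \<Rightarrow> real"
  assumes f: "has_gradient f G"
  shows "ennreal ((f x - f y)\<^sup>2) \<le>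
    (\<integral>\<^sup>+s. indicator {0..1} s * ennreal ((norm (x - y))\<^sup>2 * (norm (G (y + s *\<^sub>R (x - y))))\<^sup>2) \<partial>lborel)"
proof -
  define q where "q = (\<lambda>s. G (y + s *\<^sub>R (x - y)) \<bullet> (x - y))"
  have cG: "continuous_on UNIV G"
    using f by (simp add: has_gradient_def)
  have cont: "continuous_on S q" "continuous_on S (\<lambda>s. G (y + s *\<^sub>R (x - y)))" for S
    unfolding q_def by (auto intro!: continuous_intros continuous_on_compose2[OF cG])
  have "((\<lambda>s. f (y + s *\<^sub>R (x - y))) has_vector_derivative q s) (at s within {0..1})" for s
  proof -
    have "((\<lambda>s. f (y + s *\<^sub>R (x - y))) has_derivative (\<lambda>h. G (y + s *\<^sub>R (x - y)) \<bullet> (0 + h *\<^sub>R (x - y)))) (at s)"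
      by (rule has_derivative_compose[of _ _ _ _ f "\<lambda>v. G (y + s *\<^sub>R (x - y)) \<bullet> v"])
         (use f in \<open>auto intro!: derivative_eq_intros simp: has_gradient_def\<close>)
    then show ?thesis
      unfolding has_vector_derivative_def q_def by (simp add: has_derivative_at_withinI)
  qed
  then have I: "(q has_integral (f x - f y)) {0..1}"
    using fundamental_theorem_of_calculus[of 0 1 "\<lambda>s. f (y + s *\<^sub>R (x - y))" q] by simp
  \<comment> \<open>As \<open>a\<close> is the mean of \<open>q\<close> over the unit interval,
    integrating \<open>(q s - a)\<^sup>2 \<ge> 0\<close> shows that \<open>a\<^sup>2\<close> is at
    most the integral of \<open>(q s)\<^sup>2\<close>.\<close>
  define a where "a = f x - f y"
  have "((\<lambda>s. (q s)\<^sup>2 - (2 * a * q s - a\<^sup>2)) has_integral 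
      (integral {0..1} (\<lambda>s. (q s)\<^sup>2) - (2 * a * (f x - f y) - a\<^sup>2))) {0..1}"
    using has_integral_const_real[of "a\<^sup>2" 0 1]
    by (intro has_integral_diff integrable_integral integrable_continuous_interval continuous_intros cont
        has_integral_mult_right I) simp
  then have "0 \<le> integral {0..1} (\<lambda>s. (q s)\<^sup>2) - (2 * a * (f x - f y) - a\<^sup>2)"
  proof (rule has_integral_nonneg)
    fix s show "0 \<le> (q s)\<^sup>2 - (2 * a * q s - a\<^sup>2)"
      using zero_le_power2[of "q s - a"] by (simp add: power2_diff algebra_simps)
  qed
  then have "(f x - f y)\<^sup>2 \<le> integral {0..1} (\<lambda>s. (q s)\<^sup>2)"
    by (simp add: a_def power2_eq_square algebra_simps)
  also have "\<dots> \<le> integral {0..1} (\<lambda>s. (norm (x - y))\<^sup>2 * (norm (G (y + s *\<^sub>R (x - y))))\<^sup>2)"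
  proof (rule integral_le)
    fix s
    have "\<bar>q s\<bar> \<le> norm (G (y + s *\<^sub>R (x - y))) * norm (x - y)"
      unfolding q_def by (rule Cauchy_Schwarz_ineq2)
    then have "\<bar>q s\<bar>\<^sup>2 \<le> (norm (G (y + s *\<^sub>R (x - y))) * norm (x - y))\<^sup>2"
      by (rule power_mono) simp
    then show "(q s)\<^sup>2 \<le> (norm (x - y))\<^sup>2 * (norm (G (y + s *\<^sub>R (x - y))))\<^sup>2"
      by (simp add: power_mult_distrib mult.commute)
  qed (intro integrable_continuous_interval continuous_intros cont)+
  finally have le: "(f x - f y)\<^sup>2 \<le> \<dots>" .
  have [measurable]: "(\<lambda>s. (norm (x - y))\<^sup>2 * (norm (G (y + s *\<^sub>R (x - y))))\<^sup>2) \<in> borel_measurable borel"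
    by (intro borel_measurable_continuous_onI continuous_intros cont)
  have "(\<integral>\<^sup>+s. indicator {0..1} s * ennreal ((norm (x - y))\<^sup>2 * (norm (G (y + s *\<^sub>R (x - y))))\<^sup>2) \<partial>lborel) =
    ennreal (integral {0..1} (\<lambda>s. (norm (x - y))\<^sup>2 * (norm (G (y + s *\<^sub>R (x - y))))\<^sup>2))"
    by (rule nn_integral_indicator_continuous(2)) (auto intro!: continuous_intros cont)
  with le show ?thesis by (simp add: ennreal_leI)
qed

text \<open>The segment estimate is integrated over all pairs of points of the ball. By convexity
  the segments stay inside, so the gradient is only evaluated there; for fixed \<open>s\<close> the
  point on the segment is an affine image of \<open>x\<close> or of \<open>y\<close>, and a change
  of variables returns the integral of the squared gradient. The factor
  \<open>(2 * R)\<^sup>2\<close> is the squared diameter.\<close>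

lemma poincare_cball_double:
  fixes f :: "'a::euclidean_space \<Rightarrow> real" and R :: real
  assumes f: "has_gradient f G"
  defines "B \<equiv> indicator (cball (0::'a) R) :: 'a \<Rightarrow> ennreal"
  shows "(\<integral>\<^sup>+y. \<integral>\<^sup>+x. B y * (B x * ennreal ((f x - f y)\<^sup>2)) \<partial>lborel \<partial>lborel) \<le>
    ennreal ((2 * R)\<^sup>2) * 2 ^ DIM('a) * (\<integral>\<^sup>+x. B x * ennreal ((norm (G x))\<^sup>2) \<partial>lborel) * (\<integral>\<^sup>+y. B y \<partial>lborel)"
proof -
  define h where "h = (\<lambda>x. B x * ennreal ((norm (G x))\<^sup>2))"
  define N where "N = 2 ^ DIM('a) * integral\<^sup>N lborel h"
  have [measurable]: "G \<in> borel_measurable borel" "f \<in> borel_measurable borel"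
    using f has_gradient_imp_continuous[OF f]
    by (auto simp: has_gradient_def intro!: borel_measurable_continuous_onI)
  have [measurable]: "B \<in> borel_measurable borel"
    unfolding B_def by (rule borel_measurable_indicator) simp
  have [measurable]: "h \<in> borel_measurable borel"
    unfolding h_def by measurable
  have pt: "B y * (B x * ennreal ((f x - f y)\<^sup>2)) \<le> ennreal ((2 * R)\<^sup>2) *
      (\<integral>\<^sup>+s. indicator {0..1} s * (B y * (B x * h ((1 - s) *\<^sub>R y + s *\<^sub>R x))) \<partial>lborel)" for x y
  proof (cases "x \<in> cball 0 R \<and> y \<in> cball 0 R")
    case True
    then have "norm (x - y) \<le> 2 * R"
      using norm_triangle_ineq4[of x y] by simp
    then have n: "(norm (x - y))\<^sup>2 \<le> (2 * R)\<^sup>2"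
      by (rule power_mono) simp
    have "B y * (B x * ennreal ((f x - f y)\<^sup>2)) = ennreal ((f x - f y)\<^sup>2)"
      using True by (simp add: B_def)
    also have "\<dots> \<le> (\<integral>\<^sup>+s. indicator {0..1} s * ennreal ((norm (x - y))\<^sup>2 * (norm (G (y + s *\<^sub>R (x - y))))\<^sup>2) \<partial>lborel)"
      by (rule squared_diff_le_integral_gradient[OF f])
    also have "\<dots> \<le> (\<integral>\<^sup>+s. ennreal ((2 * R)\<^sup>2) * (indicator {0..1} s * (B y * (B x * h ((1 - s) *\<^sub>R y + s *\<^sub>R x)))) \<partial>lborel)"
    proof (rule nn_integral_mono)
      fix s :: real
      show "indicator {0..1} s * ennreal ((norm (x - y))\<^sup>2 * (norm (G (y + s *\<^sub>R (x - y))))\<^sup>2) \<le>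
        ennreal ((2 * R)\<^sup>2) * (indicator {0..1} s * (B y * (B x * h ((1 - s) *\<^sub>R y + s *\<^sub>R x))))"
      proof (cases "s \<in> {0..1}")
        case s: True
        have "(1 - s) *\<^sub>R y + s *\<^sub>R x \<in> cball 0 R"
          using True s by (intro convexD[OF convex_cball]) auto
        moreover have "y + s *\<^sub>R (x - y) = (1 - s) *\<^sub>R y + s *\<^sub>R x"
          by (simp add: algebra_simps)
        ultimately show ?thesis
          using True s n unfolding B_def h_def
          by (simp flip: ennreal_mult add: ennreal_leI mult_right_mono)
      qed simp
    qed
    also have "\<dots> = ennreal ((2 * R)\<^sup>2) *
      (\<integral>\<^sup>+s. indicator {0..1} s * (B y * (B x * h ((1 - s) *\<^sub>R y + s *\<^sub>R x))) \<partial>lborel)"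
      by (rule nn_integral_cmult) measurable
    finally show ?thesis .
  qed (auto simp: B_def)
  text \<open>For \<open>s\<close> at least one half the substitution is made in \<open>x\<close>, otherwise in \<open>y\<close>;
    this keeps the Jacobian bounded.\<close>
  have half: "(\<integral>\<^sup>+y. \<integral>\<^sup>+x. B y * (B x * h ((1 - s) *\<^sub>R y + s *\<^sub>R x)) \<partial>lborel \<partial>lborel) \<le> N * (\<integral>\<^sup>+y. B y \<partial>lborel)"
    if "1 / 2 \<le> s" for s :: real
  proof -
    have "(\<integral>\<^sup>+x. B y * (B x * h ((1 - s) *\<^sub>R y + s *\<^sub>R x)) \<partial>lborel) \<le> N * B y" for y
    proof -
      have "(\<integral>\<^sup>+x. B y * (B x * h ((1 - s) *\<^sub>R y + s *\<^sub>R x)) \<partial>lborel) \<le>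
          (\<integral>\<^sup>+x. B y * h ((1 - s) *\<^sub>R y + s *\<^sub>R x) \<partial>lborel)"
        by (rule nn_integral_mono) (auto simp: B_def indicator_def)
      also have "\<dots> = B y * (\<integral>\<^sup>+x. h ((1 - s) *\<^sub>R y + s *\<^sub>R x) \<partial>lborel)"
        by (rule nn_integral_cmult) measurable
      also have "\<dots> \<le> B y * N"
        unfolding N_def by (intro mult_left_mono nn_integral_dilation_le that) auto
      finally show ?thesis by (simp add: mult.commute)
    qed
    then have "(\<integral>\<^sup>+y. \<integral>\<^sup>+x. B y * (B x * h ((1 - s) *\<^sub>R y + s *\<^sub>R x)) \<partial>lborel \<partial>lborel) \<le> (\<integral>\<^sup>+y. N * B y \<partial>lborel)"
      by (intro nn_integral_mono) 
    then show ?thesis by (simp add: nn_integral_cmult)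
  qed
  have all: "(\<integral>\<^sup>+y. \<integral>\<^sup>+x. B y * (B x * h ((1 - s) *\<^sub>R y + s *\<^sub>R x)) \<partial>lborel \<partial>lborel) \<le> N * (\<integral>\<^sup>+y. B y \<partial>lborel)" for s :: real
  proof (cases "1 / 2 \<le> s")
    case False
    have "(\<integral>\<^sup>+y. \<integral>\<^sup>+x. B y * (B x * h ((1 - s) *\<^sub>R y + s *\<^sub>R x)) \<partial>lborel \<partial>lborel) =
      (\<integral>\<^sup>+x. \<integral>\<^sup>+y. B y * (B x * h ((1 - s) *\<^sub>R y + s *\<^sub>R x)) \<partial>lborel \<partial>lborel)"
      by (rule lborel_pair.Fubini') measurable
    also have "\<dots> = (\<integral>\<^sup>+y. \<integral>\<^sup>+x. B y * (B x * h ((1 - (1 - s)) *\<^sub>R y + (1 - s) *\<^sub>R x)) \<partial>lborel \<partial>lborel)"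
      by (simp add: add.commute mult.left_commute)
    also have "\<dots> \<le> N * (\<integral>\<^sup>+y. B y \<partial>lborel)"
      using False by (intro half) auto
    finally show ?thesis .
  qed (rule half)
  have "(\<integral>\<^sup>+y. \<integral>\<^sup>+x. B y * (B x * ennreal ((f x - f y)\<^sup>2)) \<partial>lborel \<partial>lborel) \<le>
    (\<integral>\<^sup>+y. \<integral>\<^sup>+x. ennreal ((2 * R)\<^sup>2) *
      (\<integral>\<^sup>+s. indicator {0..1} s * (B y * (B x * h ((1 - s) *\<^sub>R y + s *\<^sub>R x))) \<partial>lborel) \<partial>lborel \<partial>lborel)"
    by (intro nn_integral_mono pt)
  also have "\<dots> = ennreal ((2 * R)\<^sup>2) * (\<integral>\<^sup>+y. \<integral>\<^sup>+x. 
      (\<integral>\<^sup>+s. indicator {0..1} s * (B y * (B x * h ((1 - s) *\<^sub>R y + s *\<^sub>R x))) \<partial>lborel) \<partial>lborel \<partial>lborel)"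
    by (simp add: nn_integral_cmult)
  also have "(\<integral>\<^sup>+y. \<integral>\<^sup>+x. 
      (\<integral>\<^sup>+s. indicator {0..1} s * (B y * (B x * h ((1 - s) *\<^sub>R y + s *\<^sub>R x))) \<partial>lborel) \<partial>lborel \<partial>lborel) =
     (\<integral>\<^sup>+y. \<integral>\<^sup>+s. 
      (\<integral>\<^sup>+x. indicator {0..1} s * (B y * (B x * h ((1 - s) *\<^sub>R y + s *\<^sub>R x))) \<partial>lborel) \<partial>lborel \<partial>lborel)"
    by (intro nn_integral_cong lborel_pair.Fubini') measurable
  also have "\<dots> = (\<integral>\<^sup>+s. \<integral>\<^sup>+y. 
      (\<integral>\<^sup>+x. indicator {0..1} s * (B y * (B x * h ((1 - s) *\<^sub>R y + s *\<^sub>R x))) \<partial>lborel) \<partial>lborel \<partial>lborel)"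
    by (rule lborel_pair.Fubini') measurable
  also have "\<dots> = (\<integral>\<^sup>+s. indicator {0..1} s * (\<integral>\<^sup>+y. 
      (\<integral>\<^sup>+x. (B y * (B x * h ((1 - s) *\<^sub>R y + s *\<^sub>R x))) \<partial>lborel) \<partial>lborel) \<partial>lborel)"
    by (simp add: nn_integral_cmult)
  also have "\<dots> \<le> (\<integral>\<^sup>+s. indicator {0..1::real} s * (N * (\<integral>\<^sup>+y. B y \<partial>lborel)) \<partial>lborel)"
    by (intro nn_integral_mono mult_left_mono all) auto
  also have "\<dots> = N * (\<integral>\<^sup>+y. B y \<partial>lborel)"
    by (simp add: nn_integral_multc)
  finally show ?thesis
    by (simp add: N_def h_def mult.assoc mult_left_mono)
qed

text \<open>Averaging the double estimate over \<open>y\<close> produces a point of the ball where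
  the inner integral is at most its average, and \<open>c\<close> is the value of \<open>f\<close>
  there. Any constant serves, since \<open>gibbs_poincare\<close> passes to the mean at the
  end.\<close>

theorem poincare_cball:
  fixes f :: "'a::euclidean_space \<Rightarrow> real"
  assumes f: "has_gradient f G" and R: "0 < R"
  shows "\<exists>c. (\<integral>x. indicator (cball 0 R) x * (f x - c)\<^sup>2 \<partial>lborel) \<le>
     (2 * R)\<^sup>2 * 2 ^ DIM('a) * (\<integral>x. indicator (cball 0 R) x * (norm (G x))\<^sup>2 \<partial>lborel)"
proof -
  define B :: "'a \<Rightarrow> ennreal" where "B = indicator (cball 0 R)"
  define b where "b = integral\<^sup>N lborel B"
  have cont: "continuous_on UNIV f" "continuous_on UNIV G"
    using f has_gradient_imp_continuous[OF f] by (auto simp: has_gradient_def)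
  have [measurable]: "f \<in> borel_measurable borel"
    using cont(1) by (rule borel_measurable_continuous_onI)
  have [measurable]: "B \<in> borel_measurable borel"
    unfolding B_def by (rule borel_measurable_indicator) simp
  have conv: "(\<integral>\<^sup>+x. B x * ennreal (g x) \<partial>lborel) = ennreal (\<integral>x. indicator (cball 0 R) x * g x \<partial>lborel)"
    if "continuous_on UNIV g" "\<And>x. 0 \<le> g x" for g :: "'a \<Rightarrow> real"
    using that by (auto simp: B_def intro!: nn_integral_indicator_continuous intro: continuous_on_subset)
  have b: "b = emeasure lborel (cball (0::'a) R)"
    by (simp add: b_def B_def)
  have b_fin: "b < top"
    unfolding b using emeasure_lborel_cball_finite[of "0::'a" R] by (simp add: infinity_ennreal_def)
  have b_pos: "b \<noteq> 0"
    using content_cball_pos[OF R, of "0::'a"] unfolding b measure_def by auto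
  define K where "K = ennreal ((2 * R)\<^sup>2) * 2 ^ DIM('a) * (\<integral>\<^sup>+x. B x * ennreal ((norm (G x))\<^sup>2) \<partial>lborel)"
  define inner where "inner = (\<lambda>y. \<integral>\<^sup>+x. B x * ennreal ((f x - f y)\<^sup>2) \<partial>lborel)"
  have [measurable]: "inner \<in> borel_measurable borel"
    unfolding inner_def by measurable
  have K: "K = ennreal ((2 * R)\<^sup>2 * 2 ^ DIM('a) * (\<integral>x. indicator (cball 0 R) x * (norm (G x))\<^sup>2 \<partial>lborel))"
    unfolding K_def by (subst conv) (auto intro!: continuous_intros cont simp: ennreal_mult simp flip: ennreal_power)
  have "\<exists>y\<in>cball 0 R. inner y \<le> K"
  proof (rule ccontr)
    assume "\<not> ?thesis"
    then have gt: "K < inner y" if "y \<in> cball 0 R" for y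
      using that by (auto simp: not_le)
    \<comment> \<open>The subtraction in \<open>ennreal\<close> is exact because
      \<open>inner y\<close> exceeds \<open>K\<close> throughout the ball. Cancelling the finite
      \<open>K * b\<close> leaves a zero integral whose integrand is positive on a set of positive
      measure.\<close>
    have "(\<integral>\<^sup>+y. B y * (inner y - K) \<partial>lborel) + K * b = (\<integral>\<^sup>+y. B y * (inner y - K) + K * B y \<partial>lborel)"
      by (simp add: nn_integral_add nn_integral_cmult b_def)
    also have "\<dots> = (\<integral>\<^sup>+y. B y * inner y \<partial>lborel)"
      using gt by (intro nn_integral_cong) (auto simp: B_def indicator_def less_imp_le diff_add_cancel_ennreal)
    also have "\<dots> = (\<integral>\<^sup>+y. \<integral>\<^sup>+x. B y * (B x * ennreal ((f x - f y)\<^sup>2)) \<partial>lborel \<partial>lborel)"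
      by (simp add: inner_def nn_integral_cmult)
    also have "\<dots> \<le> K * b"
      unfolding K_def b_def B_def by (rule poincare_cball_double[OF f])
    finally have "(\<integral>\<^sup>+y. B y * (inner y - K) \<partial>lborel) + K * b \<le> K * b + 0"
      by simp
    moreover have "K * b < top"
      using b_fin by (simp add: K ennreal_mult_less_top)
    ultimately have "(\<integral>\<^sup>+y. B y * (inner y - K) \<partial>lborel) \<le> 0"
      by (subst (asm) add.commute) (simp only: ennreal_add_left_cancel_le infinity_ennreal_def order_less_irrefl, auto)
    then have "AE y in lborel. B y * (inner y - K) = 0"
      by (simp add: nn_integral_0_iff_AE)
    then have "AE y in lborel. (y::'a) \<notin> cball 0 R"
    proof eventually_elim
      case (elim y)
      then show ?case
        using gt[of y] by (auto simp: B_def indicator_def dest!: ennreal_minus_eq_0 dest: leD)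
    qed
    then have "emeasure lborel (cball (0::'a) R) = 0"
      by (simp add: AE_iff_measurable[OF _ refl] cball_def)
    with b b_pos show False by simp
  qed
  then obtain y where "inner y \<le> K" by blast
  moreover have "inner y = ennreal (\<integral>x. indicator (cball 0 R) x * (f x - f y)\<^sup>2 \<partial>lborel)"
    unfolding inner_def by (rule conv) (auto intro!: continuous_intros cont)
  moreover have "0 \<le> (2 * R)\<^sup>2 * 2 ^ DIM('a) * (\<integral>x. indicator (cball 0 R) x * (norm (G x))\<^sup>2 \<partial>lborel)"
    by (intro mult_nonneg_nonneg Bochner_Integration.integral_nonneg) auto
  ultimately have "(\<integral>x. indicator (cball 0 R) x * (f x - f y)\<^sup>2 \<partial>lborel) \<le>
     (2 * R)\<^sup>2 * 2 ^ DIM('a) * (\<integral>x. indicator (cball 0 R) x * (norm (G x))\<^sup>2 \<partial>lborel)"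
    by (simp only: K ennreal_le_iff)
  then show ?thesis ..
qed

section \<open>The Poincare inequality for the Gibbs density\<close>

lemma max_0_power2_deriv: "((\<lambda>s::real. (max 0 s)\<^sup>2) has_real_derivative 2 * max 0 s) (at s)"
proof -
  consider "s < 0" | "s = 0" | "0 < s" by linarith
  then show ?thesis
  proof cases
    case 1
    have "((\<lambda>s::real. 0) has_real_derivative 2 * max 0 s) (at s)"
      using 1 by simp
    then show ?thesis
      by (rule has_field_derivative_transform_within_open[of _ _ _ "{..<0}"]) (use 1 in auto)
  next
    case 2
    have "((\<lambda>h::real. max 0 h) \<longlongrightarrow> max 0 0) (at 0)"
      by (intro tendsto_intros)
    then have "((\<lambda>h::real. max 0 h) \<longlongrightarrow> 0) (at 0)"
      by simp
    then have "((\<lambda>h::real. (max 0 h)\<^sup>2 / h) \<longlongrightarrow> 0) (at 0)"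
      by (rule Lim_transform_eventually) (auto simp: eventually_at_filter max_def power2_eq_square)
    then show ?thesis
      using 2 by (simp add: DERIV_def)
  next
    case 3
    have "((\<lambda>s::real. s\<^sup>2) has_real_derivative 2 * max 0 s) (at s)"
      using 3 by (auto intro!: derivative_eq_intros)
    then show ?thesis
      by (rule has_field_derivative_transform_within_open[of _ _ _ "{0<..}"]) (use 3 in auto)
  qed
qed

section \<open>Radial cutoff functions\<close>

text \<open>Squaring the positive part removes the kink at \<open>norm x = N\<close>, so this is a
  continuously differentiable test function with an explicit gradient.\<close>

definition cutoff :: "real \<Rightarrow> 'a::euclidean_space \<Rightarrow> real" where
  "cutoff N x = (max 0 (1 - (x \<bullet> x) / N\<^sup>2))\<^sup>2"

definition cutoff_grad :: "real \<Rightarrow> 'a::euclidean_space \<Rightarrow> 'a" where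
  "cutoff_grad N x = (2 * max 0 (1 - (x \<bullet> x) / N\<^sup>2)) *\<^sub>R ((- 2 / N\<^sup>2) *\<^sub>R x)"

lemma has_gradient_cutoff:
  assumes "0 < N" shows "has_gradient (cutoff N) (cutoff_grad N)"
proof -
  have "has_gradient (\<lambda>x. 1 - (x \<bullet> x) / N\<^sup>2) (\<lambda>x::'a. (- 2 / N\<^sup>2) *\<^sub>R x)"
    unfolding has_gradient_def
  proof (intro conjI allI)
    fix x :: 'a
    have "((\<lambda>x. 1 - inverse (N\<^sup>2) * (x \<bullet> x)) has_derivative
        (\<lambda>v. - (inverse (N\<^sup>2) * (x \<bullet> v + v \<bullet> x)))) (at x)"
      by (auto intro!: derivative_eq_intros)
    moreover have "(\<bullet>) ((- 2 / N\<^sup>2) *\<^sub>R x) = (\<lambda>v. - (inverse (N\<^sup>2) * (x \<bullet> v + v \<bullet> x)))"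
      by (auto simp: fun_eq_iff inner_commute divide_inverse)
    ultimately show "((\<lambda>x. 1 - (x \<bullet> x) / N\<^sup>2) has_derivative (\<bullet>) ((- 2 / N\<^sup>2) *\<^sub>R x)) (at x)"
      by (simp add: divide_inverse mult.commute)
  qed (use assms in \<open>auto intro!: continuous_intros\<close>)
  then show ?thesis
    unfolding cutoff_def[abs_def] cutoff_grad_def[abs_def]
    by (rule has_gradient_compose[where S="\<lambda>s. (max 0 s)\<^sup>2" and S'="\<lambda>s. 2 * max 0 s"])
       (use assms in \<open>auto intro!: max_0_power2_deriv continuous_intros\<close>)
qed

lemma cutoff_nonneg: "0 \<le> cutoff N x"
  by (simp add: cutoff_def)

lemma cutoff_le_1: "cutoff N x \<le> 1"
  unfolding cutoff_def by (intro power_le_one) (auto simp: field_simps)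

lemma cutoff_support: "0 < N \<Longrightarrow> N < norm x \<Longrightarrow> cutoff N x = 0"
proof -
  assume "0 < N" "N < norm x"
  then have "N\<^sup>2 \<le> x \<bullet> x"
    by (simp add: power2_norm_eq_inner[symmetric] power_mono)
  with \<open>0 < N\<close> show ?thesis
    by (simp add: cutoff_def field_simps max_def)
qed

text \<open>Inside the ball the two factors have norm at most 2 and
  \<open>2 / N\<^sup>2 * N\<close>; outside, the positive part is zero. The decay in
  \<open>N\<close> is what makes the cutoff errors vanish in the limit.\<close>

lemma norm_cutoff_grad_le:
  assumes "0 < N" shows "norm (cutoff_grad N x) \<le> 4 / N"
proof (cases "norm x \<le> N")
  case True
  define m where "m = max 0 (1 - (x \<bullet> x) / N\<^sup>2)"
  have m: "0 \<le> m" "m \<le> 1"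
    by (auto simp: m_def field_simps)
  have "norm (cutoff_grad N x) = (2 * m) * (2 / N\<^sup>2 * norm x)"
    using m by (simp add: cutoff_grad_def m_def[symmetric])
  also have "\<dots> \<le> (2 * 1) * (2 / N\<^sup>2 * N)"
    using m True assms by (intro mult_mono) auto
  finally have "norm (cutoff_grad N x) \<le> 2 * 1 * (2 / N\<^sup>2 * N)" .
  then show ?thesis
    using assms by (simp add: power2_eq_square)
next
  case False
  then have "N\<^sup>2 \<le> x \<bullet> x"
    using assms by (simp add: power2_norm_eq_inner[symmetric] power_mono)
  with assms show ?thesis
    by (simp add: cutoff_grad_def field_simps max_def)
qed

lemma cutoff_tendsto_1: "(\<lambda>n. cutoff (real (Suc n)) x) \<longlonglongrightarrow> 1"
proof -
  have "(\<lambda>n. (max 0 (1 - (x \<bullet> x) * (inverse (real (Suc n)))\<^sup>2))\<^sup>2) \<longlonglongrightarrow> (max 0 (1 - (x \<bullet> x) * 0\<^sup>2))\<^sup>2"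
    by (intro tendsto_intros LIMSEQ_inverse_real_of_nat)
  then show ?thesis
    by (simp add: cutoff_def divide_inverse power_inverse)
qed

section \<open>Matrix identities and the Lyapunov inequality\<close>

lemma inner_mult_transpose:
  fixes \<sigma> :: "real^'d^'d"
  shows "x \<bullet> ((\<sigma> ** transpose \<sigma>) *v y) = (transpose \<sigma> *v x) \<bullet> (transpose \<sigma> *v y)"
  by (simp add: dot_lmul_matrix flip: matrix_vector_mul_assoc)

lemma divergence_matrix_mult:
  fixes F :: "real^'d \<Rightarrow> real^'d"
  assumes "F differentiable at x"
  shows "divergence (\<lambda>x. A *v F x) x = trace (A ** jacobian F (at x))"
proof -
  have "((\<lambda>x. A *v F x) has_derivative (\<lambda>v. A *v (jacobian F (at x) *v v))) (at x)"
    using assms by (intro bounded_linear.has_derivative[OF matrix_vector_mul_bounded_linear])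
      (simp add: jacobian_works)
  then have "frechet_derivative (\<lambda>x. A *v F x) (at x) = (\<lambda>v. (A ** jacobian F (at x)) *v v)"
    by (auto simp: matrix_vector_mul_assoc intro!: frechet_derivative_at[symmetric])
  then show ?thesis
    by (simp add: divergence_def jacobian_def)
qed

lemma smooth_tcd: "smooth f \<Longrightarrow> times_cont_differentiable k f"
  by (simp add: smooth_def)

lemma continuous_on_matrix_mult:
  "continuous_on UNIV f \<Longrightarrow> continuous_on UNIV (\<lambda>x. (A::real^'n^'m) *v f x)"
  by (rule continuous_on_compose2[OF linear_continuous_on[OF matrix_vector_mul_bounded_linear, of UNIV]]) auto

text \<open>Completing the square in \<open>\<bar>\<sigma>\<^sup>T \<nabla>g - g \<sigma>\<^sup>T \<nabla>V / 2\<bar>\<^sup>2\<close>; equivalently,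
  \<open>e\<^sup>V\<^sup>/\<^sup>2\<close> serves as a Lyapunov function.\<close>

lemma lyapunov_inequality:
  fixes V :: "real^'d \<Rightarrow> real" and \<sigma> :: "real^'d^'d"
  assumes V: "smooth V" and g: "has_gradient g G" and supp: "\<And>x. R < norm x \<Longrightarrow> g x = 0"
    and U_def: "U = (\<lambda>x. ((norm (transpose \<sigma> *v grad V x))\<^sup>2
                    - 2 * trace (\<sigma> ** transpose \<sigma> ** hessian V x)) / 4)"
  shows "continuous_on UNIV U"
    and "(\<integral>x. exp (- V x) * (g x)\<^sup>2 * U x \<partial>lborel) \<le>
         (\<integral>x. exp (- V x) * (norm (transpose \<sigma> *v G x))\<^sup>2 \<partial>lborel)"
proof -
  define T where "T = transpose \<sigma>"
  define tr where "tr = (\<lambda>x. trace (\<sigma> ** transpose \<sigma> ** hessian V x))"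
  have V1: "times_cont_differentiable (Suc 0) V" and V2: "times_cont_differentiable (Suc 0) (grad V)"
    using smooth_tcd[OF V] tcd_grad by blast+
  have gV: "has_gradient V (grad V)"
    using V1 by (rule has_gradient_grad)
  have contH: "continuous_on UNIV (\<lambda>x. hessian V x $ i $ j)" for i j
    using V2 by (auto simp: hessian_def jacobian_def matrix_def intro!: continuous_intros)
  have cont: "continuous_on UNIV V" "continuous_on UNIV (grad V)" "continuous_on UNIV g" "continuous_on UNIV G"
    using gV g by (auto intro: has_gradient_imp_continuous simp: has_gradient_def)
  have conttr: "continuous_on UNIV tr"
    unfolding tr_def trace_def matrix_matrix_mult_def by (auto intro!: continuous_intros contH)
  note [continuous_intros] = cont conttr continuous_on_matrix_mult
  have U: "U = (\<lambda>x. ((norm (T *v grad V x))\<^sup>2 - 2 * tr x) / 4)"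
    by (simp add: U_def T_def tr_def)
  show "continuous_on UNIV U"
    unfolding U by (intro continuous_intros) auto
  have e: "has_gradient (\<lambda>x. exp (- V x)) (\<lambda>x. (- exp (- V x)) *\<^sub>R grad V x)"
    by (rule has_gradient_compose[OF gV, of "\<lambda>v. exp (- v)" "\<lambda>v. - exp (- v)"])
       (auto intro!: derivative_eq_intros continuous_intros)
  have g2: "has_gradient (\<lambda>x. (g x)\<^sup>2) (\<lambda>x. (2 * g x) *\<^sub>R G x)"
    by (rule has_gradient_compose[OF g, of "\<lambda>v. v\<^sup>2" "\<lambda>v. 2 * v"])
       (auto intro!: derivative_eq_intros continuous_intros)
  have suppG: "\<And>x. R < norm x \<Longrightarrow> G x = 0"
    using has_gradient_support[OF g supp] by blast
  \<comment> \<open>\<open>X\<close> is the nonnegative square. \<open>Y1 + Y2\<close> is the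
    divergence of \<open>exp (- V x) * (g x)\<^sup>2\<close> times
    \<open>(\<sigma> ** transpose \<sigma>) *v grad V x\<close> and integrates to zero; half of it
    cancels the mixed term of \<open>X\<close> and turns the terms without \<open>G\<close> into
    \<open>- exp (- V x) * (g x)\<^sup>2 * U x\<close>.\<close>
  define X where "X = (\<lambda>x. exp (- V x) * (norm (T *v G x - (g x / 2) *\<^sub>R (T *v grad V x)))\<^sup>2)"
  define Y1 where "Y1 = (\<lambda>x. exp (- V x) * (g x)\<^sup>2 * tr x)"
  define Y2 where "Y2 = (\<lambda>x. exp (- V x) * (2 * g x * ((T *v G x) \<bullet> (T *v grad V x))
      - (g x)\<^sup>2 * (norm (T *v grad V x))\<^sup>2))"
  have int: "integrable lborel X" "integrable lborel Y1" "integrable lborel Y2"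
    "integrable lborel (\<lambda>x. exp (- V x) * (g x)\<^sup>2 * U x)"
    "integrable lborel (\<lambda>x. exp (- V x) * (norm (T *v G x))\<^sup>2)"
    unfolding X_def Y1_def Y2_def
    by (intro integrable_bounded_support[of _ R] continuous_intros \<open>continuous_on UNIV U\<close>;
        simp add: supp suppG)+
  have "(\<integral>x. (exp (- V x) * (g x)\<^sup>2) * divergence (\<lambda>x. (\<sigma> ** transpose \<sigma>) *v grad V x) x \<partial>lborel) =
     - (\<integral>x. (exp (- V x) *\<^sub>R ((2 * g x) *\<^sub>R G x) + (g x)\<^sup>2 *\<^sub>R ((- exp (- V x)) *\<^sub>R grad V x)) \<bullet>
          ((\<sigma> ** transpose \<sigma>) *v grad V x) \<partial>lborel)"
    by (rule integration_by_parts[OF has_gradient_mult[OF e g2], of R])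
       (use supp in \<open>auto intro!: tcd_Suc0_bounded_linear[OF matrix_vector_mul_bounded_linear V2] simp del: times_cont_differentiable.simps\<close>)
  also have "(\<lambda>x. (exp (- V x) *\<^sub>R ((2 * g x) *\<^sub>R G x) + (g x)\<^sup>2 *\<^sub>R ((- exp (- V x)) *\<^sub>R grad V x)) \<bullet>
          ((\<sigma> ** transpose \<sigma>) *v grad V x)) = Y2"
    by (simp add: fun_eq_iff Y2_def T_def inner_mult_transpose inner_add_left inner_diff_left
        power2_norm_eq_inner algebra_simps)
  also have "(\<lambda>x. (exp (- V x) * (g x)\<^sup>2) * divergence (\<lambda>x. (\<sigma> ** transpose \<sigma>) *v grad V x) x) = Y1"
    using V2 by (simp add: fun_eq_iff Y1_def tr_def hessian_def divergence_matrix_mult)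
  finally have Y: "integral\<^sup>L lborel Y1 = - integral\<^sup>L lborel Y2" .
  have "0 \<le> integral\<^sup>L lborel X"
    by (rule Bochner_Integration.integral_nonneg) (simp add: X_def)
  also have "\<dots> = integral\<^sup>L lborel X + (integral\<^sup>L lborel Y1 + integral\<^sup>L lborel Y2) / 2"
    using Y by simp
  also have "\<dots> = (\<integral>x. X x + (Y1 x + Y2 x) / 2 \<partial>lborel)"
    using int by simp
  also have "\<dots> = (\<integral>x. exp (- V x) * (norm (T *v G x))\<^sup>2 - exp (- V x) * (g x)\<^sup>2 * U x \<partial>lborel)"
  proof (rule Bochner_Integration.integral_cong[OF refl])
    fix x
    have sq: "(norm (T *v G x - (g x / 2) *\<^sub>R (T *v grad V x)))\<^sup>2 =
        (norm (T *v G x))\<^sup>2 - g x * ((T *v G x) \<bullet> (T *v grad V x)) + (g x)\<^sup>2 / 4 * (norm (T *v grad V x))\<^sup>2"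
      unfolding power2_norm_eq_inner
      by (simp add: inner_diff_left inner_diff_right inner_commute) (simp add: power2_eq_square algebra_simps)
    show "X x + (Y1 x + Y2 x) / 2 = exp (- V x) * (norm (T *v G x))\<^sup>2 - exp (- V x) * (g x)\<^sup>2 * U x"
      unfolding X_def Y1_def Y2_def U sq
      by (simp add: field_simps)
  qed
  also have "\<dots> = (\<integral>x. exp (- V x) * (norm (T *v G x))\<^sup>2 \<partial>lborel) - (\<integral>x. exp (- V x) * (g x)\<^sup>2 * U x \<partial>lborel)"
    using int by simp
  finally show "(\<integral>x. exp (- V x) * (g x)\<^sup>2 * U x \<partial>lborel) \<le>
         (\<integral>x. exp (- V x) * (norm (transpose \<sigma> *v G x))\<^sup>2 \<partial>lborel)"
    by (simp add: T_def)
qed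

lemma matrix_norm_bound:
  fixes T :: "real^'n^'m"
  obtains s where "0 < s" "\<And>v. norm (T *v v) \<le> s * norm v"
  using linear_bounded_pos[OF matrix_vector_mul_linear[of T]] by blast

lemma invertible_norm_bound:
  fixes T :: "real^'d^'d"
  assumes "invertible T"
  obtains s where "0 < s" "\<And>v. norm v \<le> s * norm (T *v v)"
proof -
  obtain S where S: "S ** T = mat 1"
    using assms by (auto simp: invertible_def)
  obtain s where "0 < s" "\<And>v. norm (S *v v) \<le> s * norm v"
    using matrix_norm_bound by blast
  then have "norm v \<le> s * norm (T *v v)" for v
    by (metis S matrix_vector_mul_assoc matrix_vector_mul_lid)
  with \<open>0 < s\<close> show ?thesis by (rule that)
qed

lemma bounded_if_bounded_support:
  fixes f :: "'a::euclidean_space \<Rightarrow> 'b::real_normed_vector"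
  assumes "continuous_on UNIV f" "\<And>x. R < norm x \<Longrightarrow> f x = 0"
  obtains b where "0 < b" "\<And>x. norm (f x) \<le> b"
proof -
  have "compact (f ` cball 0 R)"
    by (intro compact_continuous_image continuous_on_subset[OF assms(1)]) auto
  then obtain b where b: "\<forall>y\<in>f ` cball 0 R. norm y \<le> b"
    using compact_imp_bounded bounded_iff by blast
  have "norm (f x) \<le> max b 1" for x
    using b assms(2)[of x] by (cases "R < norm x") (force simp: le_max_iff_disj)+
  then show ?thesis
    by (intro that[of "max b 1"]) auto
qed

lemma norm_add_power2_le: "(norm (a + b))\<^sup>2 \<le> 2 * (norm a)\<^sup>2 + 2 * (norm (b :: 'a::real_inner))\<^sup>2"
proof -
  have "(norm (a + b))\<^sup>2 + (norm (a - b))\<^sup>2 = 2 * (norm a)\<^sup>2 + 2 * (norm b)\<^sup>2"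
    unfolding power2_norm_eq_inner
    by (simp add: inner_add_left inner_add_right inner_diff_left inner_diff_right inner_commute)
  then show ?thesis
    using zero_le_power2[of "norm (a - b)"] by linarith
qed

section \<open>From the ball to the whole space\<close>

text \<open>Far out \<open>U\<close> is at least \<open>l\<close>, so the Lyapunov inequality
  controls the square of \<open>f - c\<close>; on a large ball the deficit of \<open>U\<close> is
  paid for by the Poincare inequality of the ball, which dictates \<open>c\<close>. As
  \<open>f - c\<close> has no bounded support, the Lyapunov inequality is applied to its product
  with a cutoff whose radius then tends to infinity.\<close>

lemma weighted_poincare_recentred:
  fixes V :: "real^'d \<Rightarrow> real" and \<sigma> :: "real^'d^'d"
  assumes V: "smooth V" and \<sigma>: "invertible \<sigma>" and II: "assumption_II \<sigma> V"
    and int: "integrable lborel (\<lambda>x. exp (- V x))"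
  shows "\<exists>\<kappa>>0. \<forall>f G R. has_gradient f G \<longrightarrow> (\<forall>x. R < norm x \<longrightarrow> f x = 0) \<longrightarrow>
    (\<exists>c. (\<integral>x. exp (- V x) * (f x - c)\<^sup>2 \<partial>lborel) \<le>
      \<kappa> * (\<integral>x. exp (- V x) * (norm (transpose \<sigma> *v G x))\<^sup>2 \<partial>lborel))"
proof -
  define T where "T = transpose \<sigma>"
  define U where "U = (\<lambda>x. ((norm (transpose \<sigma> *v grad V x))\<^sup>2
                    - 2 * trace (\<sigma> ** transpose \<sigma> ** hessian V x)) / 4)"
  note lyap = lyapunov_inequality[OF V _ _ U_def, folded T_def]
  have contU: "continuous_on UNIV U"
    by (rule lyap(1)[OF has_gradient_const[of 0]]) simp
  have contV: "continuous_on UNIV V"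
    using smooth_tcd[OF V, of 0] by simp
  have "0 < Liminf at_infinity (\<lambda>x. ereal (4 * U x))"
    using II by (simp add: assumption_II_def U_def diff_divide_distrib)
  \<comment> \<open>A real number is interposed because the lower limit may be infinite.\<close>
  then obtain y where y: "0 < ereal y" "ereal y < Liminf at_infinity (\<lambda>x. ereal (4 * U x))"
    using ereal_dense2 by blast
  then obtain R0 where R0: "\<And>x. R0 \<le> norm x \<Longrightarrow> y < 4 * U x"
    using less_LiminfD[OF y(2)] by (auto simp: eventually_at_infinity)
  define R where "R = max R0 1"
  define l where "l = y / 4"
  define B :: "real^'d \<Rightarrow> real" where "B = indicator (cball 0 R)"
  have l: "0 < l" and R: "0 < R"
    using y by (auto simp: l_def R_def)
  have Ul: "l \<le> U x" if "R < norm x" for x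
    using R0[of x] that by (simp add: l_def R_def)
  have comp: "compact (g ` cball 0 R)" if "continuous_on UNIV g" for g :: "real^'d \<Rightarrow> real"
    by (intro compact_continuous_image continuous_on_subset[OF that]) auto
  obtain K where K: "0 < K" "\<And>x. norm x \<le> R \<Longrightarrow> \<bar>U x\<bar> \<le> K"
    using bounded_pos[THEN iffD1, OF compact_imp_bounded[OF comp[OF contU]]] by auto
  obtain E where E: "0 < E" "\<And>x. norm x \<le> R \<Longrightarrow> \<bar>V x\<bar> \<le> E"
    using bounded_pos[THEN iffD1, OF compact_imp_bounded[OF comp[OF contV]]] by auto
  obtain s where s: "0 < s" "\<And>v. norm v \<le> s * norm (T *v v)"
    using invertible_norm_bound[of T] transpose_invertible[OF \<sigma>] unfolding T_def by blast
  obtain S where S: "0 < S" "\<And>v. norm (T *v v) \<le> S * norm v"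
    using matrix_norm_bound[of T] by blast
  \<comment> \<open>On the ball \<open>U\<close> is at least \<open>- K\<close>, so adding
    \<open>K + l\<close> lifts it to \<open>l\<close>.\<close>
  have UK: "l \<le> U x + (K + l) * B x" for x
    using Ul[of x] K(2)[of x] by (auto simp: B_def indicator_def)
  define CR where "CR = (2 * R)\<^sup>2 * 2 ^ CARD('d)"
  have CR: "0 < CR" using R by (simp add: CR_def)
  \<comment> \<open>The 2 comes from splitting the gradient of the product of \<open>f - c\<close>
    and the cutoff. \<open>CR\<close> is the constant of the ball, \<open>s\<^sup>2 * exp E\<close>
    passes there from the plain squared gradient to the weighted one with \<open>T\<close>, and the
    other \<open>exp E\<close> bounds the weight on the ball. Division by \<open>l\<close> undoes
    the lower bound of \<open>U\<close>.\<close>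
  define \<kappa> where "\<kappa> = (2 + (K + l) * exp E * CR * s\<^sup>2 * exp E) / l"
  have "0 < \<kappa>"
    unfolding \<kappa>_def using l K E CR s by (intro divide_pos_pos add_pos_nonneg mult_nonneg_nonneg) auto
  moreover have "\<exists>c. (\<integral>x. exp (- V x) * (f x - c)\<^sup>2 \<partial>lborel) \<le>
      \<kappa> * (\<integral>x. exp (- V x) * (norm (T *v G x))\<^sup>2 \<partial>lborel)"
    if f: "has_gradient f G" and supp: "\<And>x. Rf < norm x \<Longrightarrow> f x = 0" for f G Rf
  proof -
    have cont: "continuous_on UNIV f" "continuous_on UNIV G"
      using f by (auto intro: has_gradient_imp_continuous simp: has_gradient_def)
    have suppG: "\<And>x. Rf < norm x \<Longrightarrow> G x = 0"
      using has_gradient_support[OF f supp] by blast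
    note [continuous_intros] = cont contV contU continuous_on_matrix_mult
    obtain c where c: "(\<integral>x. B x * (f x - c)\<^sup>2 \<partial>lborel) \<le> CR * (\<integral>x. B x * (norm (G x))\<^sup>2 \<partial>lborel)"
      using poincare_cball[OF f R] by (auto simp: B_def CR_def)
    define I where "I = (\<integral>x. exp (- V x) * (norm (T *v G x))\<^sup>2 \<partial>lborel)"
    have intI: "integrable lborel (\<lambda>x. exp (- V x) * (norm (T *v G x))\<^sup>2)"
      by (intro integrable_bounded_support[of _ Rf] continuous_intros) (simp add: suppG)
    have intB: "integrable lborel (\<lambda>x. B x * g x)" if "continuous_on UNIV g" for g :: "real^'d \<Rightarrow> real"
      using borel_integrable_compact[OF compact_cball continuous_on_subset[OF that]]
      by (simp add: B_def)
    have "(\<integral>x. B x * (norm (G x))\<^sup>2 \<partial>lborel) \<le> (\<integral>x. s\<^sup>2 * exp E * (exp (- V x) * (norm (T *v G x))\<^sup>2) \<partial>lborel)"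
    proof (rule integral_mono)
      fix x
      show "B x * (norm (G x))\<^sup>2 \<le> s\<^sup>2 * exp E * (exp (- V x) * (norm (T *v G x))\<^sup>2)"
      proof (cases "norm x \<le> R")
        case True
        have "1 * (norm (G x))\<^sup>2 \<le> (exp E * exp (- V x)) * (s * norm (T *v G x))\<^sup>2"
          using E(2)[OF True] s by (intro mult_mono power_mono) (auto simp flip: exp_add)
        then show ?thesis
          using True by (simp add: B_def power_mult_distrib mult_ac)
      qed (simp add: B_def)
    qed (auto intro!: intB intI continuous_intros integrable_mult_right)
    then have le1: "(\<integral>x. B x * (f x - c)\<^sup>2 \<partial>lborel) \<le> CR * (s\<^sup>2 * exp E * I)"
      using c CR unfolding I_def by (simp add: order_trans mult_left_mono)
    obtain b where b: "0 < b" "\<And>x. norm (f x) \<le> b"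
      using bounded_if_bounded_support[OF cont(1), of Rf] supp by blast
    define b' where "b' = b + \<bar>c\<bar>"
    have b': "0 < b'" "\<And>x. \<bar>f x - c\<bar> \<le> b'"
      using b by (auto simp: b'_def intro: order_trans[OF abs_triangle_ineq4] add_mono)
    have b'2: "(f x - c)\<^sup>2 \<le> b'\<^sup>2" for x
      using power_mono[OF b'(2)[of x], of 2] by simp
    define N where "N = (\<lambda>n. real (Suc n))"
    \<comment> \<open>The contribution of the cutoff gradient: its image under \<open>T\<close> has
      norm at most \<open>S * (4 / N n)\<close>, the bound \<open>b'\<close> of \<open>f - c\<close>
      multiplies it, and the weight has finite total mass.\<close>
    define e where "e = (\<lambda>n. 2 * (b'\<^sup>2 * (S * (4 / N n))\<^sup>2) * (\<integral>x. exp (- V x) \<partial>lborel))"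
    have key: "l * (\<integral>x. exp (- V x) * ((f x - c) * cutoff (N n) x)\<^sup>2 \<partial>lborel) \<le> l * \<kappa> * I + e n" for n
    proof -
      define \<phi> where "\<phi> = (cutoff (N n) :: real^'d \<Rightarrow> real)"
      define \<Phi> where "\<Phi> = (cutoff_grad (N n) :: real^'d \<Rightarrow> real^'d)"
      have Nn: "0 < N n" by (simp add: N_def)
      have \<phi>: "has_gradient \<phi> \<Phi>" "\<And>x. 0 \<le> \<phi> x" "\<And>x. \<phi> x \<le> 1" "\<And>x. N n < norm x \<Longrightarrow> \<phi> x = 0"
          "\<And>x. norm (\<Phi> x) \<le> 4 / N n"
        using Nn by (auto simp: \<phi>_def \<Phi>_def has_gradient_cutoff cutoff_nonneg cutoff_le_1 cutoff_support norm_cutoff_grad_le)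
      have [continuous_intros]: "continuous_on UNIV \<phi>" "continuous_on UNIV \<Phi>"
        using \<phi>(1) by (auto intro: has_gradient_imp_continuous simp: has_gradient_def)
      have supp\<Phi>: "\<And>x. N n < norm x \<Longrightarrow> \<Phi> x = 0"
        using has_gradient_support[OF \<phi>(1,4)] by blast
      define g where "g = (\<lambda>x. (f x - c) * \<phi> x)"
      define H where "H = (\<lambda>x. (f x - c) *\<^sub>R \<Phi> x + \<phi> x *\<^sub>R (G x - 0))"
      have g: "has_gradient g H"
        unfolding g_def H_def by (intro has_gradient_mult has_gradient_diff f has_gradient_const \<phi>)
      have suppg: "\<And>x. N n < norm x \<Longrightarrow> g x = 0"
        by (simp add: g_def \<phi>)
      have [continuous_intros]: "continuous_on UNIV g" "continuous_on UNIV H"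
        using g by (auto intro: has_gradient_imp_continuous simp: has_gradient_def)
      have suppH: "\<And>x. N n < norm x \<Longrightarrow> H x = 0"
        using has_gradient_support[OF g suppg] by blast
      have ints: "integrable lborel (\<lambda>x. exp (- V x) * (g x)\<^sup>2)"
          "integrable lborel (\<lambda>x. exp (- V x) * (g x)\<^sup>2 * U x)"
          "integrable lborel (\<lambda>x. exp (- V x) * (norm (T *v H x))\<^sup>2)"
        by (intro integrable_bounded_support[of _ "N n"] continuous_intros; simp add: suppg suppH)+
      have intB': "integrable lborel (\<lambda>x. B x * (exp E * (f x - c)\<^sup>2))"
        by (intro intB continuous_intros)
      have "l * (\<integral>x. exp (- V x) * (g x)\<^sup>2 \<partial>lborel) = (\<integral>x. l * (exp (- V x) * (g x)\<^sup>2) \<partial>lborel)"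
        by simp
      also have "\<dots> \<le> (\<integral>x. exp (- V x) * (g x)\<^sup>2 * U x + (K + l) * (B x * (exp E * (f x - c)\<^sup>2)) \<partial>lborel)"
      proof (rule integral_mono)
        fix x
        have "\<bar>\<phi> x\<bar> \<le> 1" using \<phi>(2,3)[of x] by simp
        then have g2: "(g x)\<^sup>2 \<le> (f x - c)\<^sup>2"
          by (simp add: g_def power_mult_distrib mult_left_le abs_square_le_1)
        have "B x * (exp (- V x) * (g x)\<^sup>2) \<le> B x * (exp E * (f x - c)\<^sup>2)"
          using E(2)[of x] g2 by (auto simp: B_def indicator_def intro!: mult_mono)
        then have "(K + l) * (B x * (exp (- V x) * (g x)\<^sup>2)) \<le> (K + l) * (B x * (exp E * (f x - c)\<^sup>2))"
          using K l by (simp only: mult_left_mono add_nonneg_nonneg less_imp_le)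
        moreover have "l * (exp (- V x) * (g x)\<^sup>2) \<le> (U x + (K + l) * B x) * (exp (- V x) * (g x)\<^sup>2)"
          by (intro mult_right_mono UK) auto
        ultimately show "l * (exp (- V x) * (g x)\<^sup>2) \<le>
            exp (- V x) * (g x)\<^sup>2 * U x + (K + l) * (B x * (exp E * (f x - c)\<^sup>2))"
          by (simp add: algebra_simps)
      qed (intro integrable_mult_right Bochner_Integration.integrable_add ints intB')+
      also have "\<dots> = (\<integral>x. exp (- V x) * (g x)\<^sup>2 * U x \<partial>lborel) + (K + l) * (\<integral>x. B x * (exp E * (f x - c)\<^sup>2) \<partial>lborel)"
        using ints intB' by simp
      also have "(\<integral>x. B x * (exp E * (f x - c)\<^sup>2) \<partial>lborel) = exp E * (\<integral>x. B x * (f x - c)\<^sup>2 \<partial>lborel)"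
        by (simp only: mult.left_commute[of _ "exp E"] integral_mult_right_zero)
      also have "(\<integral>x. exp (- V x) * (g x)\<^sup>2 * U x \<partial>lborel) \<le> (\<integral>x. exp (- V x) * (norm (T *v H x))\<^sup>2 \<partial>lborel)"
        by (rule lyap(2)[OF g suppg])
      also have "(\<integral>x. exp (- V x) * (norm (T *v H x))\<^sup>2 \<partial>lborel) \<le>
          (\<integral>x. 2 * (b'\<^sup>2 * (S * (4 / N n))\<^sup>2) * exp (- V x) + 2 * (exp (- V x) * (norm (T *v G x))\<^sup>2) \<partial>lborel)"
      proof (rule integral_mono)
        fix x
        have "T *v H x = T *v ((f x - c) *\<^sub>R \<Phi> x) + T *v (\<phi> x *\<^sub>R G x)"
          by (simp add: H_def matrix_vector_right_distrib)
        then have "(norm (T *v H x))\<^sup>2 \<le> 2 * (norm (T *v ((f x - c) *\<^sub>R \<Phi> x)))\<^sup>2 + 2 * (norm (T *v (\<phi> x *\<^sub>R G x)))\<^sup>2"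
          using norm_add_power2_le by metis
        also have "(norm (T *v ((f x - c) *\<^sub>R \<Phi> x)))\<^sup>2 = (f x - c)\<^sup>2 * (norm (T *v \<Phi> x))\<^sup>2"
          by (simp add: matrix_vector_mult_scaleR power_mult_distrib)
        also have "\<dots> \<le> b'\<^sup>2 * (S * (4 / N n))\<^sup>2"
          using S \<phi>(5)[of x] by (intro mult_mono b'2 power_mono order_trans[OF S(2)] mult_left_mono) auto
        also have "(norm (T *v (\<phi> x *\<^sub>R G x)))\<^sup>2 = (\<phi> x)\<^sup>2 * (norm (T *v G x))\<^sup>2"
          by (simp add: matrix_vector_mult_scaleR power_mult_distrib)
        also have "\<dots> \<le> 1 * (norm (T *v G x))\<^sup>2"
          using \<phi>(2,3)[of x] by (intro mult_right_mono power_le_one) auto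
        finally have "exp (- V x) * (norm (T *v H x))\<^sup>2 \<le>
            exp (- V x) * (2 * (b'\<^sup>2 * (S * (4 / N n))\<^sup>2) + 2 * (norm (T *v G x))\<^sup>2)"
          by (intro mult_left_mono) auto
        then show "exp (- V x) * (norm (T *v H x))\<^sup>2 \<le>
            2 * (b'\<^sup>2 * (S * (4 / N n))\<^sup>2) * exp (- V x) + 2 * (exp (- V x) * (norm (T *v G x))\<^sup>2)"
          by (simp only: algebra_simps)
      qed (intro integrable_mult_right Bochner_Integration.integrable_add ints int intI)+
      also have "\<dots> = e n + 2 * I"
        using int intI by (simp add: e_def I_def)
      finally have "l * (\<integral>x. exp (- V x) * (g x)\<^sup>2 \<partial>lborel) \<le>
          e n + 2 * I + (K + l) * (exp E * (\<integral>x. B x * (f x - c)\<^sup>2 \<partial>lborel))"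
        by simp
      also have "\<dots> \<le> e n + 2 * I + (K + l) * (exp E * (CR * (s\<^sup>2 * exp E * I)))"
        using K l by (intro add_left_mono mult_left_mono le1) auto
      also have "\<dots> = (2 + (K + l) * exp E * CR * s\<^sup>2 * exp E) * I + e n"
        by (simp add: algebra_simps)
      also have "\<dots> = l * \<kappa> * I + e n"
        using l by (simp add: \<kappa>_def)
      finally show ?thesis
        by (simp add: g_def \<phi>_def)
    qed
    have "e \<longlonglongrightarrow> 2 * (b'\<^sup>2 * (S * (4 * 0))\<^sup>2) * (\<integral>x. exp (- V x) \<partial>lborel)"
      unfolding e_def N_def divide_inverse by (intro tendsto_intros LIMSEQ_inverse_real_of_nat)
    then have e0: "e \<longlonglongrightarrow> 0" by simp
    have "(\<lambda>n. \<integral>x. exp (- V x) * ((f x - c) * cutoff (N n) x)\<^sup>2 \<partial>lborel) \<longlonglongrightarrow>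
        (\<integral>x. exp (- V x) * ((f x - c) * 1)\<^sup>2 \<partial>lborel)"
    proof (rule integral_dominated_convergence[where w="\<lambda>x. exp (- V x) * b'\<^sup>2"])
      show "AE x in lborel. (\<lambda>n. exp (- V x) * ((f x - c) * cutoff (N n) x)\<^sup>2) \<longlonglongrightarrow> exp (- V x) * ((f x - c) * 1)\<^sup>2"
        unfolding N_def by (intro AE_I2 tendsto_intros cutoff_tendsto_1)
      show "AE x in lborel. norm (exp (- V x) * ((f x - c) * cutoff (N n) x)\<^sup>2) \<le> exp (- V x) * b'\<^sup>2" for n
      proof (rule AE_I2)
        fix x
        have "((f x - c) * cutoff (N n) x)\<^sup>2 \<le> b'\<^sup>2 * 1"
          unfolding power_mult_distrib
          by (intro mult_mono b'2 power_le_one cutoff_nonneg cutoff_le_1) auto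
        then show "norm (exp (- V x) * ((f x - c) * cutoff (N n) x)\<^sup>2) \<le> exp (- V x) * b'\<^sup>2"
          by simp
      qed
      have "continuous_on UNIV (cutoff (N n) :: real^'d \<Rightarrow> real)" for n
        by (rule has_gradient_imp_continuous[OF has_gradient_cutoff]) (simp add: N_def)
      then show "(\<lambda>x. exp (- V x) * ((f x - c) * cutoff (N n) x)\<^sup>2) \<in> borel_measurable lborel" for n
        by (simp, intro borel_measurable_continuous_onI continuous_intros)
      show "(\<lambda>x. exp (- V x) * ((f x - c) * 1)\<^sup>2) \<in> borel_measurable lborel"
        by (simp, intro borel_measurable_continuous_onI continuous_intros)
    qed (use int in auto)
    then have "l * (\<integral>x. exp (- V x) * ((f x - c) * 1)\<^sup>2 \<partial>lborel) \<le> l * \<kappa> * I + 0"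
      by (rule LIMSEQ_le[OF tendsto_mult_left tendsto_add[OF tendsto_const e0]]) (use key in auto)
    then have "(\<integral>x. exp (- V x) * (f x - c)\<^sup>2 \<partial>lborel) \<le> \<kappa> * I"
      using l by (simp add: mult.assoc)
    then show ?thesis unfolding I_def by blast
  qed
  ultimately show ?thesis
    unfolding T_def by blast
qed

lemma continuous_gibbs_density: "smooth V \<Longrightarrow> continuous_on UNIV (gibbs_density V)"
  using smooth_tcd[of V 0] unfolding gibbs_density_def[abs_def] divide_inverse
  by (auto intro!: continuous_intros)

text \<open>Were the normalization zero, division by zero would make \<open>gibbs_density V\<close>
  the zero function, which does not integrate to 1. Integrability of the weight then follows, as it
  is a multiple of the density.\<close>

lemma gibbs_density_normalization_pos:
  assumes "prob_density (gibbs_density V)"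
  shows "0 < (\<integral>x. exp (- V x) \<partial>lborel)" "integrable lborel (\<lambda>x. exp (- V x))"
proof -
  define Z where "Z = (\<integral>x. exp (- V x) \<partial>lborel)"
  have g: "gibbs_density V = (\<lambda>x. exp (- V x) / Z)"
    by (simp add: gibbs_density_def fun_eq_iff Z_def)
  have "Z \<noteq> 0"
    using assms by (auto simp: prob_density_def g)
  moreover have "0 \<le> Z"
    unfolding Z_def by (rule Bochner_Integration.integral_nonneg) simp
  ultimately have "0 < Z" by simp
  then show "0 < (\<integral>x. exp (- V x) \<partial>lborel)" by (simp add: Z_def)
  have "integrable lborel (\<lambda>x. Z * (exp (- V x) / Z))"
    using assms unfolding prob_density_def g by (intro integrable_mult_right) auto
  then show "integrable lborel (\<lambda>x. exp (- V x))"
    using \<open>Z \<noteq> 0\<close> by simp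
qed

text \<open>As a function of \<open>c\<close>, the weighted integral of
  \<open>(f x - c)\<^sup>2\<close> is smallest at the mean, so a bound for some \<open>c\<close>
  bounds the variance. The squared mean stays on the right because multiplication by a cutoff spoils
  mean zero; each application has to estimate it.\<close>

theorem gibbs_poincare:
  fixes V :: "real^'d \<Rightarrow> real" and \<sigma> :: "real^'d^'d"
  assumes V: "smooth V" and "invertible \<sigma>" and "assumption_II \<sigma> V"
    and p: "prob_density (gibbs_density V)"
  shows "\<exists>\<kappa>>0. \<forall>f G R. has_gradient f G \<longrightarrow> (\<forall>x. R < norm x \<longrightarrow> f x = 0) \<longrightarrow>
    (\<integral>x. gibbs_density V x * (f x)\<^sup>2 \<partial>lborel) \<le> (\<integral>x. gibbs_density V x * f x \<partial>lborel)\<^sup>2 +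
      \<kappa> * (\<integral>x. gibbs_density V x * (norm (transpose \<sigma> *v G x))\<^sup>2 \<partial>lborel)"
proof -
  define Z where "Z = (\<integral>x. exp (- V x) \<partial>lborel)"
  define q where "q = gibbs_density V"
  have q: "q = (\<lambda>x. exp (- V x) / Z)"
    by (simp add: q_def gibbs_density_def fun_eq_iff Z_def)
  have Z: "0 < Z"
    using gibbs_density_normalization_pos[OF p] by (simp add: Z_def)
  have [continuous_intros]: "continuous_on UNIV q"
    unfolding q_def by (rule continuous_gibbs_density[OF V])
  obtain \<kappa> where \<kappa>: "0 < \<kappa>" "\<And>f G R. has_gradient f G \<Longrightarrow> (\<And>x. R < norm x \<Longrightarrow> f x = 0) \<Longrightarrow>
    \<exists>c. (\<integral>x. exp (- V x) * (f x - c)\<^sup>2 \<partial>lborel) \<le>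
      \<kappa> * (\<integral>x. exp (- V x) * (norm (transpose \<sigma> *v G x))\<^sup>2 \<partial>lborel)"
    using weighted_poincare_recentred[OF assms(1-3) gibbs_density_normalization_pos(2)[OF p]] by blast
  have "(\<integral>x. q x * (f x)\<^sup>2 \<partial>lborel) \<le> (\<integral>x. q x * f x \<partial>lborel)\<^sup>2 +
      \<kappa> * (\<integral>x. q x * (norm (transpose \<sigma> *v G x))\<^sup>2 \<partial>lborel)"
    if f: "has_gradient f G" and supp: "\<And>x. R < norm x \<Longrightarrow> f x = 0" for f G R
  proof -
    obtain c where c: "(\<integral>x. exp (- V x) * (f x - c)\<^sup>2 \<partial>lborel) \<le>
      \<kappa> * (\<integral>x. exp (- V x) * (norm (transpose \<sigma> *v G x))\<^sup>2 \<partial>lborel)"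
      using \<kappa>(2)[OF f supp] by blast
    have [continuous_intros]: "continuous_on UNIV f"
      using f by (rule has_gradient_imp_continuous)
    have int: "integrable lborel (\<lambda>x. q x * (f x)\<^sup>2)" "integrable lborel (\<lambda>x. q x * f x)"
      by (intro integrable_bounded_support[of _ R] continuous_intros; simp add: supp)+
    have intq: "integrable lborel q" "integral\<^sup>L lborel q = 1"
      using p by (auto simp: prob_density_def q_def)
    have "(\<integral>x. q x * (f x - c)\<^sup>2 \<partial>lborel) = (\<integral>x. q x * (f x)\<^sup>2 - (2 * c) * (q x * f x) + c\<^sup>2 * q x \<partial>lborel)"
      by (simp add: power2_diff algebra_simps)
    also have "\<dots> = (\<integral>x. q x * (f x)\<^sup>2 \<partial>lborel) - 2 * c * (\<integral>x. q x * f x \<partial>lborel) + c\<^sup>2"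
      using int intq by simp
    finally have "(\<integral>x. q x * (f x)\<^sup>2 \<partial>lborel) =
        (\<integral>x. q x * f x \<partial>lborel)\<^sup>2 - (c - (\<integral>x. q x * f x \<partial>lborel))\<^sup>2 + (\<integral>x. q x * (f x - c)\<^sup>2 \<partial>lborel)"
      by (simp add: power2_diff)
    also have "\<dots> \<le> (\<integral>x. q x * f x \<partial>lborel)\<^sup>2 + (\<integral>x. q x * (f x - c)\<^sup>2 \<partial>lborel)"
      by simp
    also have "(\<integral>x. q x * (f x - c)\<^sup>2 \<partial>lborel) = (\<integral>x. exp (- V x) * (f x - c)\<^sup>2 \<partial>lborel) / Z"
      by (simp add: q)
    also have "\<dots> \<le> \<kappa> * (\<integral>x. exp (- V x) * (norm (transpose \<sigma> *v G x))\<^sup>2 \<partial>lborel) / Z"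
      using c Z by (intro divide_right_mono) auto
    also have "\<dots> = \<kappa> * (\<integral>x. q x * (norm (transpose \<sigma> *v G x))\<^sup>2 \<partial>lborel)"
      by (simp add: q)
    finally show ?thesis by simp
  qed
  with \<kappa>(1) show ?thesis
    unfolding q_def by blast
qed

section \<open>Energy estimates\<close>

text \<open>The integrating factor \<open>exp (- c * s)\<close> and a linear correction for
  \<open>e\<close> give a function with nonpositive derivative. The inequality is asked for only
  inside the interval because the equation holds only at positive times. The sign of
  \<open>c\<close> is free, so growth and decay are both covered; the crude factor with
  \<open>\<bar>c\<bar>\<close> multiplies only \<open>e\<close>, which tends to zero in every
  application.\<close>

lemma gronwall:
  fixes Y :: "real \<Rightarrow> real"
  assumes t: "0 \<le> t" and cont: "continuous_on {0..t} Y" and e: "0 \<le> e"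
    and der: "\<And>s. 0 < s \<Longrightarrow> s < t \<Longrightarrow> \<exists>D. (Y has_real_derivative D) (at s) \<and> D \<le> c * Y s + e"
  shows "Y t \<le> exp (c * t) * (Y 0 + e * t * exp (\<bar>c\<bar> * t))"
proof -
  define Q where "Q = (\<lambda>s. Y s * exp (- c * s) - e * exp (\<bar>c\<bar> * t) * s)"
  have "Q t \<le> Q 0"
  proof (rule DERIV_nonpos_imp_decreasing_open[OF t])
    fix s assume s: "0 < s" "s < t"
    then obtain D where D: "(Y has_real_derivative D) (at s)" "D \<le> c * Y s + e"
      using der by blast
    have "(Q has_real_derivative (D * exp (- c * s) - c * exp (- c * s) * Y s - e * exp (\<bar>c\<bar> * t))) (at s)"
      unfolding Q_def by (auto intro!: derivative_eq_intros D)
    moreover have "D * exp (- c * s) - c * exp (- c * s) * Y s - e * exp (\<bar>c\<bar> * t) \<le> 0"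
    proof -
      have "(D - c * Y s) * exp (- c * s) \<le> e * exp (\<bar>c\<bar> * t)"
      proof -
        have "- c * s \<le> \<bar>c\<bar> * s" using s by (intro mult_right_mono) auto
        also have "\<dots> \<le> \<bar>c\<bar> * t" using s by (intro mult_left_mono) auto
        finally have "exp (- c * s) \<le> exp (\<bar>c\<bar> * t)" by simp
        moreover have "(D - c * Y s) * exp (- c * s) \<le> e * exp (- c * s)"
          using D by (intro mult_right_mono) auto
        ultimately show ?thesis
          using mult_left_mono[OF _ e] order_trans by blast
      qed
      then show ?thesis by (simp add: algebra_simps)
    qed
    ultimately show "\<exists>y. (Q has_real_derivative y) (at s) \<and> y \<le> 0" by blast
  qed (use cont in \<open>auto simp: Q_def intro!: continuous_intros\<close>)
  then have "Y t * exp (- c * t) \<le> Y 0 + e * t * exp (\<bar>c\<bar> * t)"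
    by (simp add: Q_def algebra_simps)
  then have "exp (c * t) * (Y t * exp (- c * t)) \<le> exp (c * t) * (Y 0 + e * t * exp (\<bar>c\<bar> * t))"
    by (rule mult_left_mono) simp
  moreover have "exp (c * t) * (Y t * exp (- c * t)) = Y t"
    by (simp add: exp_minus field_simps)
  ultimately show ?thesis by metis
qed

text \<open>Fatou's lemma with integrability of the limit among its conclusions; this is how square
  integrability is gained below.\<close>

lemma integral_le_fatou:
  fixes f :: "nat \<Rightarrow> 'a \<Rightarrow> real"
  assumes int: "\<And>n. integrable M (f n)" and nn: "\<And>n x. 0 \<le> f n x"
    and le: "\<And>n. integral\<^sup>L M (f n) \<le> c n" and c: "c \<longlonglongrightarrow> C"
    and lim: "\<And>x. (\<lambda>n. f n x) \<longlonglongrightarrow> g x"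
  shows "integrable M g" "integral\<^sup>L M g \<le> C"
proof -
  have [measurable]: "\<And>n. f n \<in> borel_measurable M"
    using int by auto
  have gm[measurable]: "g \<in> borel_measurable M"
    by (rule borel_measurable_LIMSEQ_metric[OF _ lim]) measurable
  have g0: "0 \<le> g x" for x
    by (rule LIMSEQ_le_const[OF lim]) (use nn in auto)
  have cn: "0 \<le> c n" for n
    using le[of n] Bochner_Integration.integral_nonneg[of M "f n"] nn by (meson order_trans)
  then have "0 \<le> C"
    by (intro LIMSEQ_le_const[OF c]) auto
  have "(\<integral>\<^sup>+x. ennreal (g x) \<partial>M) = (\<integral>\<^sup>+x. liminf (\<lambda>n. ennreal (f n x)) \<partial>M)"
  proof (rule nn_integral_cong)
    fix x
    have "(\<lambda>n. ennreal (f n x)) \<longlonglongrightarrow> ennreal (g x)"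
      by (intro tendsto_ennrealI lim)
    then show "ennreal (g x) = liminf (\<lambda>n. ennreal (f n x))"
      by (intro lim_imp_Liminf[symmetric]) auto
  qed
  also have "\<dots> \<le> liminf (\<lambda>n. \<integral>\<^sup>+x. ennreal (f n x) \<partial>M)"
    by (rule nn_integral_liminf) measurable
  also have "\<dots> \<le> liminf (\<lambda>n. ennreal (c n))"
    by (intro Liminf_mono always_eventually allI) (simp add: nn_integral_eq_integral int nn le ennreal_leI)
  also have "\<dots> = ennreal C"
    by (intro lim_imp_Liminf tendsto_ennrealI c) auto
  finally have *: "(\<integral>\<^sup>+x. ennreal (g x) \<partial>M) \<le> ennreal C" .
  then show i: "integrable M g"
    by (intro integrableI_nonneg) (auto simp: g0 intro: le_less_trans)
  then show "integral\<^sup>L M g \<le> C"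
    using * \<open>0 \<le> C\<close> by (simp add: nn_integral_eq_integral g0)
qed

text \<open>The integral of \<open>p x * (v x - s * u x)\<^sup>2\<close> is a nonnegative quadratic
  polynomial in \<open>s\<close>. It is evaluated at its minimizer \<open>B / A\<close>, or, if
  \<open>A = 0\<close> and \<open>B \<noteq> 0\<close>, at the point where the remaining affine
  function equals -1, a contradiction.\<close>

lemma integral_Cauchy_Schwarz:
  fixes p u v :: "'a \<Rightarrow> real"
  assumes p: "\<And>x. 0 \<le> p x"
    and int: "integrable M (\<lambda>x. p x * (u x)\<^sup>2)" "integrable M (\<lambda>x. p x * (v x)\<^sup>2)"
      "integrable M (\<lambda>x. p x * (u x * v x))"
  shows "(\<integral>x. p x * (u x * v x) \<partial>M)\<^sup>2 \<le> (\<integral>x. p x * (u x)\<^sup>2 \<partial>M) * (\<integral>x. p x * (v x)\<^sup>2 \<partial>M)"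
proof -
  define A where "A = (\<integral>x. p x * (u x)\<^sup>2 \<partial>M)"
  define B where "B = (\<integral>x. p x * (u x * v x) \<partial>M)"
  define C where "C = (\<integral>x. p x * (v x)\<^sup>2 \<partial>M)"
  have AC: "0 \<le> A" "0 \<le> C"
    unfolding A_def C_def by (auto intro!: Bochner_Integration.integral_nonneg mult_nonneg_nonneg p)
  have q: "0 \<le> C - 2 * s * B + s\<^sup>2 * A" for s
  proof -
    have "0 \<le> (\<integral>x. p x * (v x - s * u x)\<^sup>2 \<partial>M)"
      by (auto intro!: Bochner_Integration.integral_nonneg mult_nonneg_nonneg p)
    also have "\<dots> = (\<integral>x. p x * (v x)\<^sup>2 - (2 * s) * (p x * (u x * v x)) + s\<^sup>2 * (p x * (u x)\<^sup>2) \<partial>M)"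
      by (simp add: power2_eq_square algebra_simps)
    also have "\<dots> = C - 2 * s * B + s\<^sup>2 * A"
      using int by (simp add: A_def B_def C_def)
    finally show ?thesis .
  qed
  show ?thesis
    unfolding A_def[symmetric] B_def[symmetric] C_def[symmetric]
  proof (cases "A = 0")
    case True
    show "B\<^sup>2 \<le> A * C"
    proof (cases "B = 0")
      case False
      then show ?thesis
        using q[of "(C + 1) / (2 * B)"] True AC by (simp add: field_simps)
    qed (use AC in auto)
  next
    case False
    then have "0 < A" using AC by simp
    then show "B\<^sup>2 \<le> A * C"
      using q[of "B / A"] by (simp add: field_simps power2_eq_square)
  qed
qed

lemma young: "a * x \<le> a\<^sup>2 / 4 + (x::real)\<^sup>2"
  using zero_le_power2[of "a / 2 - x"] by (simp add: power2_diff power2_eq_square algebra_simps)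

text \<open>The pointwise core of both energy estimates. For an energy density \<open>H\<close> and
  a cutoff \<open>\<phi>\<close>, \<open>u\<close> is \<open>\<phi>\<close> times the square root of
  \<open>H''(w)\<close>, \<open>A\<close> is the image of the gradient of \<open>w\<close> under
  \<open>T\<close>, \<open>B\<close> the drift, \<open>P\<close> the image of the cutoff gradient,
  \<open>v = u w\<close>, \<open>u s = 2 \<phi> H'(w)\<close> and
  \<open>z = 2 \<phi> w H'(w)\<close>. Each of the two terms linear in \<open>A\<close> consumes a
  quarter of \<open>(u * norm A)\<^sup>2\<close>, so one half survives.\<close>

lemma energy_integrand_bound:
  fixes A B P :: "'a::real_inner" and u v s z :: real
  assumes u: "0 \<le> u" and B: "norm B \<le> \<delta>" and P: "norm P \<le> q"
  shows "u\<^sup>2 * (norm A)\<^sup>2 - u * v * (A \<bullet> B) + u * s * (P \<bullet> A) - z * (P \<bullet> B) \<ge>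
     (u * norm A)\<^sup>2 / 2 - \<delta>\<^sup>2 * v\<^sup>2 - s\<^sup>2 * q\<^sup>2 - \<bar>z\<bar> * (q * \<delta>)"
proof -
  have q: "0 \<le> q" "0 \<le> \<delta>" using norm_ge_zero[of P] norm_ge_zero[of B] P B by linarith+
  have 1: "u * v * (A \<bullet> B) \<le> (u * norm A) * (\<bar>v\<bar> * \<delta>)"
  proof -
    have "\<bar>u * v * (A \<bullet> B)\<bar> \<le> u * \<bar>v\<bar> * (norm A * norm B)"
      using u Cauchy_Schwarz_ineq2[of A B] by (simp add: abs_mult mult_left_mono)
    also have "\<dots> \<le> u * \<bar>v\<bar> * (norm A * \<delta>)"
      using u B by (intro mult_left_mono) auto
    finally show ?thesis by (simp add: mult_ac)
  qed
  have 2: "- (u * s * (P \<bullet> A)) \<le> (u * norm A) * (\<bar>s\<bar> * q)"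
  proof -
    have "\<bar>u * s * (P \<bullet> A)\<bar> \<le> u * \<bar>s\<bar> * (norm P * norm A)"
      using u Cauchy_Schwarz_ineq2[of P A] by (simp add: abs_mult mult_left_mono)
    also have "\<dots> \<le> u * \<bar>s\<bar> * (q * norm A)"
      using u P by (intro mult_left_mono mult_right_mono) auto
    finally show ?thesis by (simp add: mult_ac)
  qed
  have 3: "z * (P \<bullet> B) \<le> \<bar>z\<bar> * (q * \<delta>)"
  proof -
    have "\<bar>z * (P \<bullet> B)\<bar> \<le> \<bar>z\<bar> * (norm P * norm B)"
      using Cauchy_Schwarz_ineq2[of P B] by (simp add: abs_mult mult_left_mono)
    also have "\<dots> \<le> \<bar>z\<bar> * (q * \<delta>)"
      using B P q by (intro mult_left_mono mult_mono) auto
    finally show ?thesis by simp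
  qed
  have "(u * norm A) * (\<bar>v\<bar> * \<delta>) \<le> (u * norm A)\<^sup>2 / 4 + \<delta>\<^sup>2 * v\<^sup>2"
       "(u * norm A) * (\<bar>s\<bar> * q) \<le> (u * norm A)\<^sup>2 / 4 + s\<^sup>2 * q\<^sup>2"
    using young[of "u * norm A" "\<bar>v\<bar> * \<delta>"] young[of "u * norm A" "\<bar>s\<bar> * q"]
    by (simp_all add: power_mult_distrib mult.commute)
  moreover have "u\<^sup>2 * (norm A)\<^sup>2 = (u * norm A)\<^sup>2"
    by (simp add: power_mult_distrib)
  ultimately show ?thesis
    using 1 2 3 by linarith
qed

lemma continuous_on_slice:
  assumes "continuous_on (A \<times> UNIV) (\<lambda>(t, x). f t x)" "t \<in> A"
  shows "continuous_on UNIV (f t)"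
proof -
  have "continuous_on UNIV (\<lambda>x. (\<lambda>(t, x). f t x) (t, x))"
    by (rule continuous_on_compose2[OF assms(1)]) (use assms(2) in \<open>auto intro!: continuous_intros\<close>)
  then show ?thesis by simp
qed

section \<open>Truncated squares\<close>

text \<open>Half the harmonic mean of \<open>k\<close> and \<open>h\<close>: a rational substitute
  for their minimum, with derivative \<open>(k / (k + h))\<^sup>2\<close> in
  \<open>h\<close>.\<close>

definition truncation :: "real \<Rightarrow> real \<Rightarrow> real" where
  "truncation k h = k * h / (k + h)"

text \<open>A convex function with second derivative \<open>(truncation k)'\<^sup>2\<close> that is bounded on the
  half line: \<open>k/3 h + truncated_energy k h\<close> behaves like \<open>h\<^sup>2/2\<close> for \<open>h\<close> much smaller than \<open>k\<close>,
  and the integral of the linear part is known from conservation of mass.\<close>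

definition truncated_energy :: "real \<Rightarrow> real \<Rightarrow> real" where
  "truncated_energy k h = k\<^sup>2 / 6 * ((k / (k + h))\<^sup>2 - 1)"

text \<open>Written in \<open>r = k / (k + h)\<close>, which lies in (0,1], both differences acquire
  the factor \<open>(1 - r) ^ 3\<close> and the remaining factors are visibly nonnegative.\<close>

lemma truncated_energy_bounds:
  assumes "0 < k" "0 \<le> h"
  shows "(truncation k h)\<^sup>2 / 2 \<le> k / 3 * h + truncated_energy k h"
    and "k / 3 * h + truncated_energy k h \<le> h\<^sup>2 / 2"
proof -
  define r where "r = k / (k + h)"
  have r: "0 < r" "r \<le> 1"
    using assms by (auto simp: r_def field_simps)
  have "1 - r = h / (k + h)"
    using assms by (simp add: r_def field_simps)
  then have h: "h = k * (1 - r) / r"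
    using assms by (simp add: r_def)
  have tr: "truncation k h = k * (1 - r)" and te: "truncated_energy k h = k\<^sup>2 / 6 * (r\<^sup>2 - 1)"
    using assms by (simp_all add: truncation_def truncated_energy_def r_def field_simps)
  have "k / 3 * h + truncated_energy k h - (truncation k h)\<^sup>2 / 2 = k\<^sup>2 * (1 - r) ^ 3 / (3 * r)"
    unfolding tr te using r by (subst h) (simp add: field_simps power2_eq_square power3_eq_cube)
  moreover have "0 \<le> k\<^sup>2 * (1 - r) ^ 3 / (3 * r)"
    using r assms by (intro divide_nonneg_nonneg mult_nonneg_nonneg zero_le_power) auto
  ultimately show "(truncation k h)\<^sup>2 / 2 \<le> k / 3 * h + truncated_energy k h" by linarith
  have "h\<^sup>2 / 2 - (k / 3 * h + truncated_energy k h) = k\<^sup>2 * (1 - r) ^ 3 * (3 + r) / (6 * r\<^sup>2)"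
    unfolding tr te using r by (subst (1 2) h) (simp add: field_simps power2_eq_square power3_eq_cube)
  moreover have "0 \<le> k\<^sup>2 * (1 - r) ^ 3 * (3 + r) / (6 * r\<^sup>2)"
    using r assms by (intro divide_nonneg_nonneg mult_nonneg_nonneg zero_le_power) auto
  ultimately show "k / 3 * h + truncated_energy k h \<le> h\<^sup>2 / 2" by linarith
qed

lemma truncation_le:
  assumes "0 < k" "0 \<le> h"
  shows "0 \<le> truncation k h" "truncation k h \<le> k" "truncation k h \<le> h"
  using assms by (auto simp: truncation_def field_simps)

lemma truncation_tendsto:
  assumes "0 \<le> h" shows "(\<lambda>j. truncation (real (Suc j)) h) \<longlonglongrightarrow> h"
proof -
  have "(\<lambda>j. h / (1 + h * inverse (real (Suc j)))) \<longlonglongrightarrow> h / (1 + h * 0)"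
    by (intro tendsto_intros LIMSEQ_inverse_real_of_nat) simp
  moreover have "h / (1 + h * inverse (real (Suc j))) = truncation (real (Suc j)) h" for j
    using assms by (simp add: truncation_def field_simps)
  ultimately show ?thesis by simp
qed

lemma continuous_truncation:
  assumes "continuous_on UNIV f" "\<And>x. 0 \<le> f x" "0 < k"
  shows "continuous_on UNIV (\<lambda>x. truncation k (f x))"
  unfolding truncation_def using assms
  by (intro continuous_intros) (auto simp: add_pos_nonneg less_imp_neq[symmetric])

text \<open>The abstract form of the Fokker--Planck equation for \<open>w = \<rho> / p\<close>, where \<open>p\<close> is the
  Gibbs density, \<open>T = \<sigma>\<^sup>T\<close> and \<open>b = \<epsilon> \<sigma>\<^sup>T M\<close>.\<close>

locale weighted_space =
  fixes p :: "real^'d \<Rightarrow> real" and T :: "real^'d^'d" and b :: "real^'d \<Rightarrow> real^'d" and \<kappa> \<delta> S :: real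
  assumes p_cont: "continuous_on UNIV p" and p_pos: "\<And>x. 0 < p x"
    and p_int: "integrable lborel p" and p_one: "integral\<^sup>L lborel p = 1"
    and b_cont: "continuous_on UNIV b" and b_bound: "\<And>x. norm (b x) \<le> \<delta>"
    and T_bound: "\<And>v. norm (T *v v) \<le> S * norm v" and S_pos: "0 < S"
    and \<kappa>_pos: "0 < \<kappa>"
    and poincare: "\<And>f G R. has_gradient f G \<Longrightarrow> (\<And>x. R < norm x \<Longrightarrow> f x = 0) \<Longrightarrow>
      (\<integral>x. p x * (f x)\<^sup>2 \<partial>lborel) \<le> (\<integral>x. p x * f x \<partial>lborel)\<^sup>2 +
        \<kappa> * (\<integral>x. p x * (norm (T *v G x))\<^sup>2 \<partial>lborel)"
begin

section \<open>Weak formulation and energy identity\<close>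

text \<open>Weak in space only: the time derivative is classical for positive times, while the
  equation is tested at each fixed time, so no second derivative of \<open>w\<close> occurs. The
  condition is linear, hence stable under differences, and a stationary state is the special case of
  a family that is constant in time.\<close>

definition weak_solution ::
    "(real \<Rightarrow> real^'d \<Rightarrow> real) \<Rightarrow> (real \<Rightarrow> real^'d \<Rightarrow> real) \<Rightarrow> (real \<Rightarrow> real^'d \<Rightarrow> real^'d) \<Rightarrow> bool" where
  "weak_solution w w' W \<longleftrightarrow>
     continuous_on ({0..} \<times> UNIV) (\<lambda>(t, x). w t x) \<and>
     (\<forall>t>0. \<forall>x. ((\<lambda>s. w s x) has_real_derivative w' t x) (at t)) \<and>
     continuous_on ({0<..} \<times> UNIV) (\<lambda>(t, x). w' t x) \<and>
     (\<forall>t>0. has_gradient (w t) (W t)) \<and>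
     (\<forall>t>0. \<forall>\<psi> G R. has_gradient \<psi> G \<longrightarrow> (\<forall>x. R < norm x \<longrightarrow> \<psi> x = 0) \<longrightarrow>
        (\<integral>x. p x * (\<psi> x * w' t x) \<partial>lborel) =
        - (\<integral>x. p x * ((T *v G x) \<bullet> (T *v W t x - w t x *\<^sub>R b x)) \<partial>lborel))"

lemma weak_solutionD:
  assumes "weak_solution w w' W" "0 < t" "has_gradient \<psi> G" "\<forall>x. R < norm x \<longrightarrow> \<psi> x = 0"
  shows "(\<integral>x. p x * (\<psi> x * w' t x) \<partial>lborel) =
    - (\<integral>x. p x * ((T *v G x) \<bullet> (T *v W t x - w t x *\<^sub>R b x)) \<partial>lborel)"
  using assms unfolding weak_solution_def by blast

lemma \<delta>_nonneg: "0 \<le> \<delta>"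
  using b_bound[of 0] norm_ge_zero[of "b 0"] by linarith

lemma weak_solution_continuous:
  "weak_solution w w' W \<Longrightarrow> 0 \<le> t \<Longrightarrow> continuous_on UNIV (w t)"
  unfolding weak_solution_def by (blast intro: continuous_on_slice[of "{0..}"] atLeast_iff[THEN iffD2])

lemma weak_solution_continuous_derivative:
  "weak_solution w w' W \<Longrightarrow> 0 < t \<Longrightarrow> continuous_on UNIV (w' t)"
  unfolding weak_solution_def by (blast intro: continuous_on_slice[of "{0<..}"] greaterThan_iff[THEN iffD2])

lemma weak_solution_diff:
  assumes w: "weak_solution w w' W" and v: "weak_solution v v' X"
  shows "weak_solution (\<lambda>t x. w t x - v t x) (\<lambda>t x. w' t x - v' t x) (\<lambda>t x. W t x - X t x)"
  unfolding weak_solution_def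
proof (intro conjI allI impI)
  show "continuous_on ({0..} \<times> UNIV) (\<lambda>(t, x). w t x - v t x)"
    using w v by (auto simp: weak_solution_def split_beta intro!: continuous_intros)
  show "continuous_on ({0<..} \<times> UNIV) (\<lambda>(t, x). w' t x - v' t x)"
    using w v by (auto simp: weak_solution_def split_beta intro!: continuous_intros)
  fix t :: real assume t: "0 < t"
  then show "((\<lambda>s. w s x - v s x) has_real_derivative w' t x - v' t x) (at t)" for x
    using w v by (auto simp: weak_solution_def intro!: derivative_intros)
  show "has_gradient (\<lambda>x. w t x - v t x) (\<lambda>x. W t x - X t x)"
    using w v t by (auto simp: weak_solution_def intro!: has_gradient_diff)
  fix \<psi> :: "real^'d \<Rightarrow> real" and G R assume \<psi>: "has_gradient \<psi> G" "\<forall>x. R < norm x \<longrightarrow> \<psi> x = 0"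
  have suppG: "R < norm x \<Longrightarrow> G x = 0" for x
    using has_gradient_support[OF \<psi>(1), of R] \<psi>(2) by blast
  have [continuous_intros]: "continuous_on UNIV G" "continuous_on UNIV \<psi>" "continuous_on UNIV (W t)" "continuous_on UNIV (X t)"
    using \<psi> w v t has_gradient_imp_continuous by (auto simp: has_gradient_def weak_solution_def)
  note [continuous_intros] = p_cont b_cont continuous_on_matrix_mult
    weak_solution_continuous[OF w less_imp_le[OF t]] weak_solution_continuous[OF v less_imp_le[OF t]]
    weak_solution_continuous_derivative[OF w t] weak_solution_continuous_derivative[OF v t]
  have int: "integrable lborel (\<lambda>x. p x * (\<psi> x * w' t x))" "integrable lborel (\<lambda>x. p x * (\<psi> x * v' t x))"
    "integrable lborel (\<lambda>x. p x * ((T *v G x) \<bullet> (T *v W t x - w t x *\<^sub>R b x)))"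
    "integrable lborel (\<lambda>x. p x * ((T *v G x) \<bullet> (T *v X t x - v t x *\<^sub>R b x)))"
    by (intro integrable_bounded_support[of _ R] continuous_intros; simp add: suppG \<psi>(2))+
  have "(\<integral>x. p x * (\<psi> x * (w' t x - v' t x)) \<partial>lborel) =
    (\<integral>x. p x * (\<psi> x * w' t x) - p x * (\<psi> x * v' t x) \<partial>lborel)"
    by (simp add: algebra_simps)
  also have "\<dots> = (\<integral>x. p x * (\<psi> x * w' t x) \<partial>lborel) - (\<integral>x. p x * (\<psi> x * v' t x) \<partial>lborel)"
    using int by simp
  also have "\<dots> = - ((\<integral>x. p x * ((T *v G x) \<bullet> (T *v W t x - w t x *\<^sub>R b x)) \<partial>lborel) - 
      (\<integral>x. p x * ((T *v G x) \<bullet> (T *v X t x - v t x *\<^sub>R b x)) \<partial>lborel))"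
    by (simp add: weak_solutionD[OF w t \<psi>] weak_solutionD[OF v t \<psi>])
  also have "(\<integral>x. p x * ((T *v G x) \<bullet> (T *v W t x - w t x *\<^sub>R b x)) \<partial>lborel) - 
      (\<integral>x. p x * ((T *v G x) \<bullet> (T *v X t x - v t x *\<^sub>R b x)) \<partial>lborel) =
      (\<integral>x. p x * ((T *v G x) \<bullet> (T *v W t x - w t x *\<^sub>R b x)) - 
         p x * ((T *v G x) \<bullet> (T *v X t x - v t x *\<^sub>R b x)) \<partial>lborel)"
    using int by simp
  also have "\<dots> = (\<integral>x. p x * ((T *v G x) \<bullet> (T *v (W t x - X t x) - (w t x - v t x) *\<^sub>R b x)) \<partial>lborel)"
    by (rule Bochner_Integration.integral_cong[OF refl])
       (simp add: matrix_vector_mult_diff_distrib inner_diff_right scaleR_diff_left algebra_simps)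
  finally show "(\<integral>x. p x * (\<psi> x * (w' t x - v' t x)) \<partial>lborel) =
        - (\<integral>x. p x * ((T *v G x) \<bullet> (T *v (W t x - X t x) - (w t x - v t x) *\<^sub>R b x)) \<partial>lborel)" .
qed

text \<open>Differentiation under the integral over a box, then the equation tested with
  \<open>(\<phi> x)\<^sup>2 * H' (w t x)\<close>. The cutoff enters squared so that its derivative
  keeps a factor \<open>\<phi> x\<close> to pair with the dissipation. The set \<open>I\<close>
  confines \<open>H\<close> to the values of \<open>w\<close>, since the truncated energy is
  singular at \<open>- k\<close>.\<close>

lemma
  assumes w: "weak_solution w w' W" and range: "\<And>t x. 0 \<le> t \<Longrightarrow> w t x \<in> I"
    and H: "\<And>y. y \<in> I \<Longrightarrow> (H has_real_derivative H' y) (at y)"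
    and H': "\<And>y. y \<in> I \<Longrightarrow> (H' has_real_derivative H'' y) (at y)"
    and contH: "continuous_on I H''"
    and \<phi>: "has_gradient \<phi> \<Phi>" "\<And>x. N < norm x \<Longrightarrow> \<phi> x = 0"
  shows energy_continuous: "continuous_on {0..} (\<lambda>t. \<integral>x. p x * ((\<phi> x)\<^sup>2 * H (w t x)) \<partial>lborel)"
    and energy_derivative: "0 < t \<Longrightarrow>
      ((\<lambda>t. \<integral>x. p x * ((\<phi> x)\<^sup>2 * H (w t x)) \<partial>lborel) has_real_derivative
       - (\<integral>x. p x * ((\<phi> x)\<^sup>2 * H'' (w t x) * ((norm (T *v W t x))\<^sup>2 - w t x * ((T *v W t x) \<bullet> b x))
           + 2 * \<phi> x * H' (w t x) * ((T *v \<Phi> x) \<bullet> (T *v W t x - w t x *\<^sub>R b x))) \<partial>lborel)) (at t)"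
proof -
  have contw: "continuous_on ({0..} \<times> UNIV) (\<lambda>(t, x). w t x)"
    and contw': "continuous_on ({0<..} \<times> UNIV) (\<lambda>(t, x). w' t x)"
    and der: "\<And>t x. 0 < t \<Longrightarrow> ((\<lambda>s. w s x) has_real_derivative w' t x) (at t)"
    and grad: "\<And>t. 0 < t \<Longrightarrow> has_gradient (w t) (W t)"
    using w by (auto simp: weak_solution_def)
  have contHs: "continuous_on I H" "continuous_on I H'"
    by (rule DERIV_continuous_on, rule has_field_derivative_at_within, erule H H')+
  have cont\<phi>: "continuous_on UNIV \<phi>" "continuous_on UNIV \<Phi>"
    using \<phi> by (auto intro: has_gradient_imp_continuous simp: has_gradient_def)
  obtain c where c: "cball 0 N \<subseteq> cbox (-c) (c::real^'d)"
    using bounded_subset_cbox_symmetric[OF bounded_cball] by blast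
  define f where "f = (\<lambda>t x. p x * ((\<phi> x)\<^sup>2 * H (w t x)))"
  define f' where "f' = (\<lambda>t x. p x * ((\<phi> x)\<^sup>2 * H' (w t x) * w' t x))"
  have contf: "continuous_on ({0..} \<times> UNIV) (\<lambda>(t, x). f t x)"
    unfolding f_def split_beta
    by (intro continuous_intros continuous_on_compose2[OF p_cont] continuous_on_compose2[OF cont\<phi>(1)]
         continuous_on_compose2[OF contHs(1)] contw[unfolded split_beta]) (use range in auto)
  have contf': "continuous_on ({0<..} \<times> UNIV) (\<lambda>(t, x). f' t x)"
    unfolding f'_def split_beta
    by (intro continuous_intros continuous_on_compose2[OF p_cont] continuous_on_compose2[OF cont\<phi>(1)]
         continuous_on_compose2[OF contHs(2)] contw'[unfolded split_beta]
         continuous_on_subset[OF contw[unfolded split_beta]]) (use range in auto)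
  have slice: "continuous_on UNIV (f t)" if "0 \<le> t" for t
    by (rule continuous_on_slice[OF contf]) (use that in simp)
  have slice': "continuous_on UNIV (f' t)" if "0 < t" for t
    by (rule continuous_on_slice[OF contf']) (use that in simp)
  have eq: "(\<integral>x. f t x \<partial>lborel) = integral (cbox (-c) c) (f t)" if "0 \<le> t" for t
    by (rule integral_bounded_support[OF slice[OF that] _ c]) (simp add: f_def \<phi>)
  have eq': "(\<integral>x. f' t x \<partial>lborel) = integral (cbox (-c) c) (f' t)" if "0 < t" for t
    by (rule integral_bounded_support[OF slice'[OF that] _ c]) (simp add: f'_def \<phi>)
  have "continuous_on {0..} (\<lambda>t. integral (cbox (-c) c) (f t))"
    by (rule integral_continuous_on_param) (rule continuous_on_subset[OF contf], auto)
  then show "continuous_on {0..} (\<lambda>t. \<integral>x. p x * ((\<phi> x)\<^sup>2 * H (w t x)) \<partial>lborel)"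
    by (rule continuous_on_eq) (subst eq[symmetric], simp_all add: f_def)
  assume t: "0 < t"
  have "((\<lambda>t. integral (cbox (-c) c) (f t)) has_field_derivative integral (cbox (-c) c) (f' t)) (at t within {0<..})"
  proof (rule leibniz_rule_field_derivative)
    fix s :: real and x :: "real^'d" assume s: "s \<in> {0<..}"
    have "((\<lambda>s. H (w s x)) has_real_derivative H' (w s x) * w' s x) (at s)"
      using s by (intro DERIV_chain2[OF H der] range) auto
    then have "((\<lambda>s. p x * ((\<phi> x)\<^sup>2 * H (w s x))) has_real_derivative p x * ((\<phi> x)\<^sup>2 * (H' (w s x) * w' s x))) (at s)"
      by (intro DERIV_cmult)
    then show "((\<lambda>s. f s x) has_real_derivative f' s x) (at s within {0<..})"
      by (auto simp: f_def f'_def mult.assoc intro: has_field_derivative_at_within)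
  next
    show "f s integrable_on cbox (- c) c" if "s \<in> {0<..}" for s
      using that by (intro integrable_continuous continuous_on_subset[OF slice]) auto
    show "continuous_on ({0<..} \<times> cbox (- c) c) (\<lambda>(x, y). f' x y)"
      by (rule continuous_on_subset[OF contf']) auto
  qed (use t in auto)
  then have "((\<lambda>t. integral (cbox (-c) c) (f t)) has_field_derivative integral (cbox (-c) c) (f' t)) (at t)"
    using t by (simp add: at_within_open[of t "{0<..}"])
  then have d: "((\<lambda>t. \<integral>x. f t x \<partial>lborel) has_real_derivative (\<integral>x. f' t x \<partial>lborel)) (at t)"
    unfolding eq'[OF t] by (rule has_field_derivative_transform_within_open[of _ _ _ "{0<..}"]) (use t eq in auto)
  have contw_t: "continuous_on UNIV (w t)"
    using weak_solution_continuous[OF w] t by simp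
  have H'w: "has_gradient (\<lambda>x. H' (w t x)) (\<lambda>x. H'' (w t x) *\<^sub>R W t x)"
    using t range by (intro has_gradient_compose[OF grad H'] continuous_on_compose2[OF contH contw_t]) auto
  have \<phi>2: "has_gradient (\<lambda>x. (\<phi> x)\<^sup>2) (\<lambda>x. (2 * \<phi> x) *\<^sub>R \<Phi> x)"
    by (rule has_gradient_compose[OF \<phi>(1), of "\<lambda>v. v\<^sup>2" "\<lambda>v. 2 * v"])
       (auto intro!: derivative_eq_intros continuous_intros cont\<phi>)
  have "(\<integral>x. f' t x \<partial>lborel) = (\<integral>x. p x * (((\<phi> x)\<^sup>2 * H' (w t x)) * w' t x) \<partial>lborel)"
    by (simp add: f'_def)
  also have "\<dots> = - (\<integral>x. p x * ((T *v ((\<phi> x)\<^sup>2 *\<^sub>R (H'' (w t x) *\<^sub>R W t x) + H' (w t x) *\<^sub>R ((2 * \<phi> x) *\<^sub>R \<Phi> x)))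
      \<bullet> (T *v W t x - w t x *\<^sub>R b x)) \<partial>lborel)"
  proof -
    have "\<forall>x. N < norm x \<longrightarrow> (\<phi> x)\<^sup>2 * H' (w t x) = 0"
      by (simp add: \<phi>)
    then show ?thesis
      by (rule weak_solutionD[OF w t has_gradient_mult[OF \<phi>2 H'w]])
  qed
  also have "(\<lambda>x. p x * ((T *v ((\<phi> x)\<^sup>2 *\<^sub>R (H'' (w t x) *\<^sub>R W t x) + H' (w t x) *\<^sub>R ((2 * \<phi> x) *\<^sub>R \<Phi> x)))
      \<bullet> (T *v W t x - w t x *\<^sub>R b x))) = 
      (\<lambda>x. p x * ((\<phi> x)\<^sup>2 * H'' (w t x) * ((norm (T *v W t x))\<^sup>2 - w t x * ((T *v W t x) \<bullet> b x))
           + 2 * \<phi> x * H' (w t x) * ((T *v \<Phi> x) \<bullet> (T *v W t x - w t x *\<^sub>R b x))))"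
    unfolding power2_norm_eq_inner
    by (simp add: fun_eq_iff matrix_vector_right_distrib matrix_vector_mult_scaleR inner_add_left inner_diff_right algebra_simps)
  finally show "((\<lambda>t. \<integral>x. p x * ((\<phi> x)\<^sup>2 * H (w t x)) \<partial>lborel) has_real_derivative
       - (\<integral>x. p x * ((\<phi> x)\<^sup>2 * H'' (w t x) * ((norm (T *v W t x))\<^sup>2 - w t x * ((T *v W t x) \<bullet> b x))
           + 2 * \<phi> x * H' (w t x) * ((T *v \<Phi> x) \<bullet> (T *v W t x - w t x *\<^sub>R b x))) \<partial>lborel)) (at t)"
    using d by (simp add: f_def)
qed

section \<open>Differential inequality for the truncated energy\<close>

lemma cutoff_facts:
  assumes "0 < N"
  shows "has_gradient (cutoff N) (cutoff_grad N :: real^'d \<Rightarrow> real^'d)"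
    and "continuous_on UNIV (cutoff N :: real^'d \<Rightarrow> real)"
    and "continuous_on UNIV (cutoff_grad N :: real^'d \<Rightarrow> real^'d)"
    and "N < norm x \<Longrightarrow> cutoff_grad N (x :: real^'d) = 0"
    and "norm (T *v cutoff_grad N x) \<le> S * (4 / N)"
proof -
  show g: "has_gradient (cutoff N) (cutoff_grad N :: real^'d \<Rightarrow> real^'d)"
    by (rule has_gradient_cutoff[OF assms])
  then show "continuous_on UNIV (cutoff N :: real^'d \<Rightarrow> real)"
    "continuous_on UNIV (cutoff_grad N :: real^'d \<Rightarrow> real^'d)"
    by (auto intro: has_gradient_imp_continuous simp: has_gradient_def)
  show "N < norm x \<Longrightarrow> cutoff_grad N x = 0"
    by (rule has_gradient_support[OF g cutoff_support[OF assms]])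
  show "norm (T *v cutoff_grad N x) \<le> S * (4 / N)"
    using S_pos assms by (intro order_trans[OF T_bound] mult_left_mono norm_cutoff_grad_le) auto
qed

text \<open>The remainder terms of \<open>energy_integrand_bound\<close> for the truncated energy:
  \<open>4 / 9 * k\<^sup>2\<close> is the square of \<open>2 * k / 3\<close>, the bound of
  \<open>s\<close>, and \<open>2 / 3 * k\<^sup>2\<close> bounds \<open>z\<close>;
  \<open>S * (4 / N)\<close> bounds the cutoff gradient after applying \<open>T\<close>.\<close>

definition cutoff_error :: "real \<Rightarrow> real \<Rightarrow> real" where
  "cutoff_error k N = 4 / 9 * k\<^sup>2 * (S * (4 / N))\<^sup>2 + 2 / 3 * k\<^sup>2 * (S * (4 / N) * \<delta>)"

lemma cutoff_error_nonneg: "0 < N \<Longrightarrow> 0 \<le> cutoff_error k N"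
  using S_pos \<delta>_nonneg by (simp add: cutoff_error_def)

text \<open>With \<open>r = k / (k + w)\<close> the drift leaves \<open>\<delta>\<^sup>2\<close>
  times the square of \<open>\<phi> r\<^sup>2 w\<close>. Since \<open>r w\<close> is
  \<open>truncation k w\<close> and \<open>r\<close> is at most 1, this is bounded by the square of
  the cut-off truncation, a quantity that the energy plus its linear part controls, so the
  inequality closes.\<close>

lemma truncated_energy_derivative:
  assumes w: "weak_solution w w' W" and nn: "\<And>t x. 0 \<le> t \<Longrightarrow> 0 \<le> w t x"
    and k: "0 < k" and N: "0 < N"
  shows "continuous_on {0..} (\<lambda>t. \<integral>x. p x * ((cutoff N x)\<^sup>2 * truncated_energy k (w t x)) \<partial>lborel)"
    and "0 < t \<Longrightarrow> \<exists>D. ((\<lambda>t. \<integral>x. p x * ((cutoff N x)\<^sup>2 * truncated_energy k (w t x)) \<partial>lborel)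
        has_real_derivative D) (at t) \<and>
      D \<le> - (\<integral>x. p x * (cutoff N x * (k / (k + w t x))\<^sup>2 * norm (T *v W t x))\<^sup>2 \<partial>lborel) / 2 +
        \<delta>\<^sup>2 * (\<integral>x. p x * (cutoff N x * truncation k (w t x))\<^sup>2 \<partial>lborel) + cutoff_error k N"
proof -
  define H' where "H' = (\<lambda>h. - (k / 3) * (k / (k + h)) ^ 3)"
  define H'' where "H'' = (\<lambda>h. (k / (k + h)) ^ 4)"
  \<comment> \<open>An open interval containing the half line, so that two-sided derivatives exist
    also where \<open>w\<close> vanishes.\<close>
  have range: "w t x \<in> {- k<..}" if "0 \<le> t" for t x
    using nn[OF that, of x] k by simp
  \<comment> \<open>The energy is a polynomial in \<open>r = k / (k + h)\<close>, and each
    differentiation through \<open>r\<close> contributes the factor \<open>- r\<^sup>2 / k\<close>;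
    this produces \<open>r ^ 3\<close> and then \<open>r ^ 4\<close>.\<close>
  have dr: "((\<lambda>y. k / (k + y)) has_real_derivative - (1 / k) * (k / (k + y))\<^sup>2) (at y)" if "y \<in> {- k<..}" for y
    using that k by (auto intro!: derivative_eq_intros simp: power2_eq_square)
  have H: "(truncated_energy k has_real_derivative H' y) (at y)" if y: "y \<in> {- k<..}" for y
  proof -
    have "((\<lambda>r. k\<^sup>2 / 6 * (r\<^sup>2 - 1)) has_real_derivative k\<^sup>2 / 3 * r) (at r)" for r
      by (auto intro!: derivative_eq_intros)
    from DERIV_chain2[OF this dr[OF y]]
    have "(truncated_energy k has_real_derivative k\<^sup>2 / 3 * (k / (k + y)) * (- (1 / k) * (k / (k + y))\<^sup>2)) (at y)"
      by (simp only: truncated_energy_def[abs_def])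
    moreover have "k\<^sup>2 / 3 * r * (- (1 / k) * r\<^sup>2) = - (k / 3) * r ^ 3" for r
      using k by (simp add: power2_eq_square power3_eq_cube)
    ultimately show ?thesis by (simp only: H'_def)
  qed
  have H': "(H' has_real_derivative H'' y) (at y)" if y: "y \<in> {- k<..}" for y
  proof -
    have "((\<lambda>r. - (k / 3) * r ^ 3) has_real_derivative - k * r\<^sup>2) (at r)" for r
      by (auto intro!: derivative_eq_intros)
    from DERIV_chain2[OF this dr[OF y]]
    have "(H' has_real_derivative - k * (k / (k + y))\<^sup>2 * (- (1 / k) * (k / (k + y))\<^sup>2)) (at y)"
      by (simp only: H'_def)
    moreover have "- k * r\<^sup>2 * (- (1 / k) * r\<^sup>2) = r ^ 4" for r
      using k by (simp add: power2_eq_square power4_eq_xxxx)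
    ultimately show ?thesis by (simp only: H''_def)
  qed
  have contH: "continuous_on {- k<..} H''"
    unfolding H''_def by (intro continuous_intros) auto
  show "continuous_on {0..} (\<lambda>t. \<integral>x. p x * ((cutoff N x)\<^sup>2 * truncated_energy k (w t x)) \<partial>lborel)"
    by (rule energy_continuous[OF w range H H' contH cutoff_facts(1)[OF N] cutoff_support[OF N]])
  assume t: "0 < t"
  define J where "J = (\<lambda>x. (cutoff N x)\<^sup>2 * H'' (w t x) * ((norm (T *v W t x))\<^sup>2 - w t x * ((T *v W t x) \<bullet> b x))
           + 2 * cutoff N x * H' (w t x) * ((T *v cutoff_grad N x) \<bullet> (T *v W t x - w t x *\<^sub>R b x)))"
  have der: "((\<lambda>t. \<integral>x. p x * ((cutoff N x)\<^sup>2 * truncated_energy k (w t x)) \<partial>lborel)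
        has_real_derivative - (\<integral>x. p x * J x \<partial>lborel)) (at t)"
    unfolding J_def
    by (rule energy_derivative[OF w range H H' contH cutoff_facts(1)[OF N] cutoff_support[OF N] t])
  define X where "X = (\<lambda>x. (cutoff N x * (k / (k + w t x))\<^sup>2 * norm (T *v W t x))\<^sup>2)"
  define Y where "Y = (\<lambda>x. (cutoff N x * truncation k (w t x))\<^sup>2)"
  have w0: "0 \<le> w t x" for x using nn t by simp
  have pt: "X x / 2 - \<delta>\<^sup>2 * Y x - cutoff_error k N \<le> J x" for x
  proof -
    define r where "r = k / (k + w t x)"
    define \<phi> where "\<phi> = cutoff N x"
    have r: "0 < r" "r \<le> 1" using k w0[of x] by (auto simp: r_def field_simps)
    have \<phi>: "0 \<le> \<phi>" "\<phi> \<le> 1" by (auto simp: \<phi>_def cutoff_nonneg cutoff_le_1)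
    have rw: "r * w t x = truncation k (w t x)"
      by (simp add: r_def truncation_def)
    note tr = truncation_le[OF k w0[of x]]
    have J: "J x = (\<phi> * r\<^sup>2)\<^sup>2 * (norm (T *v W t x))\<^sup>2 
        - (\<phi> * r\<^sup>2) * (\<phi> * r\<^sup>2 * w t x) * ((T *v W t x) \<bullet> b x)
        + (\<phi> * r\<^sup>2) * (- (2 / 3 * k * r)) * ((T *v cutoff_grad N x) \<bullet> (T *v W t x))
        - (- (2 / 3 * \<phi> * k * r ^ 3 * w t x)) * ((T *v cutoff_grad N x) \<bullet> b x)"
      unfolding J_def H'_def H''_def r_def[symmetric] \<phi>_def[symmetric]
      by (simp add: inner_diff_right power2_eq_square power3_eq_cube power4_eq_xxxx algebra_simps)
    have bound: "(\<phi> * r\<^sup>2 * norm (T *v W t x))\<^sup>2 / 2 - \<delta>\<^sup>2 * (\<phi> * r\<^sup>2 * w t x)\<^sup>2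
        - (- (2 / 3 * k * r))\<^sup>2 * (S * (4 / N))\<^sup>2
        - \<bar>- (2 / 3 * \<phi> * k * r ^ 3 * w t x)\<bar> * (S * (4 / N) * \<delta>) \<le> J x"
      unfolding J using \<phi> r
      by (intro energy_integrand_bound b_bound cutoff_facts(5)[OF N]) auto
    have "\<phi> * r\<^sup>2 * w t x = r * (\<phi> * truncation k (w t x))"
      by (simp add: power2_eq_square flip: rw)
    also have "\<dots> \<le> 1 * (\<phi> * truncation k (w t x))"
      using r \<phi> tr by (intro mult_right_mono) auto
    finally have "(\<phi> * r\<^sup>2 * w t x)\<^sup>2 \<le> Y x"
      unfolding Y_def \<phi>_def[symmetric] using \<phi> w0[of x] by (intro power_mono) auto
    then have 1: "\<delta>\<^sup>2 * (\<phi> * r\<^sup>2 * w t x)\<^sup>2 \<le> \<delta>\<^sup>2 * Y x"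
      by (rule mult_left_mono) simp
    have "(- (2 / 3 * k * r))\<^sup>2 = 4 / 9 * k\<^sup>2 * r\<^sup>2"
      by (simp add: power2_eq_square)
    also have "\<dots> \<le> 4 / 9 * k\<^sup>2 * 1"
      using r by (intro mult_left_mono power_le_one) auto
    finally have 2: "(- (2 / 3 * k * r))\<^sup>2 * (S * (4 / N))\<^sup>2 \<le> 4 / 9 * k\<^sup>2 * (S * (4 / N))\<^sup>2"
      by (intro mult_right_mono) auto
    have "\<bar>- (2 / 3 * \<phi> * k * r ^ 3 * w t x)\<bar> = 2 / 3 * k * ((\<phi> * r\<^sup>2) * truncation k (w t x))"
      using \<phi> r k w0[of x] by (simp add: abs_mult power2_eq_square power3_eq_cube flip: rw)
    also have "\<dots> \<le> 2 / 3 * k * ((1 * 1) * k)"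
      using \<phi> r k tr by (intro mult_left_mono mult_mono power_le_one) auto
    finally have 3: "\<bar>- (2 / 3 * \<phi> * k * r ^ 3 * w t x)\<bar> * (S * (4 / N) * \<delta>) \<le> 2 / 3 * k\<^sup>2 * (S * (4 / N) * \<delta>)"
      using S_pos N \<delta>_nonneg by (intro mult_right_mono) (auto simp: power2_eq_square)
    have "X x = (\<phi> * r\<^sup>2 * norm (T *v W t x))\<^sup>2"
      by (simp add: X_def \<phi>_def r_def)
    then show ?thesis
      using bound 1 2 3 unfolding cutoff_error_def by linarith
  qed
  have [continuous_intros]: "continuous_on UNIV (w t)" "continuous_on UNIV (W t)"
    using w t weak_solution_continuous[OF w] by (auto simp: weak_solution_def has_gradient_def)
  have kw: "k + w t x \<noteq> 0" for x using k w0[of x] by linarith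
  note [continuous_intros] = p_cont b_cont continuous_on_matrix_mult cutoff_facts(2,3)[OF N]
  have int: "integrable lborel (\<lambda>x. p x * J x)" "integrable lborel (\<lambda>x. p x * X x)" "integrable lborel (\<lambda>x. p x * Y x)"
    unfolding J_def X_def Y_def H'_def H''_def truncation_def
    by (intro integrable_bounded_support[of _ N] continuous_intros;
        simp add: cutoff_support[OF N] cutoff_facts(4)[OF N] kw)+
  have "(\<integral>x. p x * X x / 2 - \<delta>\<^sup>2 * (p x * Y x) - cutoff_error k N * p x \<partial>lborel) \<le> (\<integral>x. p x * J x \<partial>lborel)"
  proof (rule integral_mono)
    fix x
    have "p x * (X x / 2 - \<delta>\<^sup>2 * Y x - cutoff_error k N) \<le> p x * J x"
      using p_pos[of x] by (intro mult_left_mono pt) simp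
    then show "p x * X x / 2 - \<delta>\<^sup>2 * (p x * Y x) - cutoff_error k N * p x \<le> p x * J x"
      by (simp add: algebra_simps)
  qed (intro Bochner_Integration.integrable_diff integrable_mult_right integrable_divide int p_int)+
  also have "(\<integral>x. p x * X x / 2 - \<delta>\<^sup>2 * (p x * Y x) - cutoff_error k N * p x \<partial>lborel) =
      (\<integral>x. p x * X x \<partial>lborel) / 2 - \<delta>\<^sup>2 * (\<integral>x. p x * Y x \<partial>lborel) - cutoff_error k N"
    using int p_int p_one by simp
  finally show "\<exists>D. ((\<lambda>t. \<integral>x. p x * ((cutoff N x)\<^sup>2 * truncated_energy k (w t x)) \<partial>lborel)
        has_real_derivative D) (at t) \<and>
      D \<le> - (\<integral>x. p x * (cutoff N x * (k / (k + w t x))\<^sup>2 * norm (T *v W t x))\<^sup>2 \<partial>lborel) / 2 +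
        \<delta>\<^sup>2 * (\<integral>x. p x * (cutoff N x * truncation k (w t x))\<^sup>2 \<partial>lborel) + cutoff_error k N"
    using der unfolding X_def Y_def by (intro exI[of _ "- (\<integral>x. p x * J x \<partial>lborel)"]) auto
qed

text \<open>Dominated convergence with \<open>p\<close> as majorant. It is stated for a function
  \<open>g\<close> of the cutoff because both its square (initial energy) and the square of its
  complement (lost mass) occur.\<close>

lemma cutoff_integral_tendsto:
  assumes g: "continuous_on UNIV g" "\<And>y. 0 \<le> y \<Longrightarrow> y \<le> 1 \<Longrightarrow> \<bar>g y\<bar> \<le> (1::real)"
  shows "integrable lborel (\<lambda>x. p x * g (cutoff (real (Suc n)) x))"
    and "(\<lambda>n. \<integral>x. p x * g (cutoff (real (Suc n)) x) \<partial>lborel) \<longlonglongrightarrow> g 1"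
proof -
  have c: "continuous_on UNIV (cutoff (real (Suc n)) :: real^'d \<Rightarrow> real)" for n
    by (rule cutoff_facts) simp
  have meas: "(\<lambda>x. p x * g (cutoff (real (Suc n)) x)) \<in> borel_measurable lborel" for n
  proof -
    have "continuous_on UNIV (\<lambda>x. p x * g (cutoff (real (Suc n)) x))"
      by (intro continuous_intros p_cont continuous_on_compose2[OF g(1) c]) auto
    from borel_measurable_continuous_onI[OF this] show ?thesis by simp
  qed
  have bound: "norm (p x * g (cutoff (real (Suc n)) x)) \<le> p x" for n x
    using mult_left_mono[OF g(2)[OF cutoff_nonneg cutoff_le_1], of "p x" "real (Suc n)" x] p_pos[of x]
    by (simp add: abs_mult)
  show "integrable lborel (\<lambda>x. p x * g (cutoff (real (Suc n)) x))"
    using bound by (intro Bochner_Integration.integrable_bound[OF p_int meas] AE_I2) (use p_pos in \<open>simp add: less_imp_le\<close>)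
  have "(\<lambda>n. \<integral>x. p x * g (cutoff (real (Suc n)) x) \<partial>lborel) \<longlonglongrightarrow> (\<integral>x. p x * g 1 \<partial>lborel)"
  proof (rule integral_dominated_convergence[OF _ meas p_int])
    show "AE x in lborel. (\<lambda>n. p x * g (cutoff (real (Suc n)) x)) \<longlonglongrightarrow> p x * g 1"
      by (intro AE_I2 tendsto_mult tendsto_const continuous_on_tendsto_compose[OF g(1) cutoff_tendsto_1]) auto
    show "AE x in lborel. norm (p x * g (cutoff (real (Suc n)) x)) \<le> p x" for n
      using bound by simp
    show "(\<lambda>x. p x * g 1) \<in> borel_measurable lborel"
      using borel_measurable_continuous_onI[OF p_cont] by simp
  qed
  then show "(\<lambda>n. \<integral>x. p x * g (cutoff (real (Suc n)) x) \<partial>lborel) \<longlonglongrightarrow> g 1"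
    by (simp add: p_one)
qed

lemma inverse_radius_tendsto: "(\<lambda>n. S * (4 / real (Suc n))) \<longlonglongrightarrow> 0"
proof -
  have "(\<lambda>n. S * (4 * inverse (real (Suc n)))) \<longlonglongrightarrow> S * (4 * 0)"
    by (intro tendsto_intros LIMSEQ_inverse_real_of_nat)
  then show ?thesis by (simp add: divide_inverse)
qed

lemma cutoff_error_tendsto: "(\<lambda>n. cutoff_error k (real (Suc n))) \<longlonglongrightarrow> 0"
proof -
  have "(\<lambda>n. cutoff_error k (real (Suc n))) \<longlonglongrightarrow> 4 / 9 * k\<^sup>2 * 0\<^sup>2 + 2 / 3 * k\<^sup>2 * (0 * \<delta>)"
    unfolding cutoff_error_def by (intro tendsto_intros inverse_radius_tendsto)
  then show ?thesis by simp
qed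

section \<open>Square integrability of solutions\<close>

text \<open>Fatou's lemma twice, and in this order: the cutoff errors grow with \<open>k\<close>, so
  the radius goes to infinity at fixed \<open>k\<close>, and only the limiting bounds have to be
  uniform in \<open>k\<close>.\<close>

lemma L2_bound_if_truncated_bound:
  assumes f: "continuous_on UNIV f" "\<And>x. 0 \<le> f x"
    and le: "\<And>n k. 0 < k \<Longrightarrow> (\<integral>x. p x * (cutoff (real (Suc n)) x * truncation k (f x))\<^sup>2 \<partial>lborel) \<le> c k n"
    and c: "\<And>k. 0 < k \<Longrightarrow> c k \<longlonglongrightarrow> c' k" and c': "\<And>k. 0 < k \<Longrightarrow> c' k \<le> C"
  shows "integrable lborel (\<lambda>x. p x * (f x)\<^sup>2)" "(\<integral>x. p x * (f x)\<^sup>2 \<partial>lborel) \<le> C"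
proof -
  have tr: "integrable lborel (\<lambda>x. p x * (truncation k (f x))\<^sup>2)"
    "(\<integral>x. p x * (truncation k (f x))\<^sup>2 \<partial>lborel) \<le> C" if k: "0 < k" for k
  proof -
    define g where "g = (\<lambda>n x. p x * (cutoff (real (Suc n)) x * truncation k (f x))\<^sup>2)"
    have int: "integrable lborel (g n)" for n
      unfolding g_def
      by (intro integrable_bounded_support[of _ "real (Suc n)"] continuous_intros p_cont cutoff_facts(2)
          continuous_truncation f k) (simp_all add: cutoff_support)
    have nn: "0 \<le> g n x" for n x
      using p_pos[of x] by (simp add: g_def)
    have lim: "(\<lambda>n. g n x) \<longlonglongrightarrow> p x * (1 * truncation k (f x))\<^sup>2" for x
      unfolding g_def by (intro tendsto_intros cutoff_tendsto_1)
    have "integral\<^sup>L lborel (g n) \<le> c k n" for n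
      using le[OF k] by (simp add: g_def)
    note fatou = integral_le_fatou[OF int nn this c[OF k] lim]
    show "integrable lborel (\<lambda>x. p x * (truncation k (f x))\<^sup>2)"
      "(\<integral>x. p x * (truncation k (f x))\<^sup>2 \<partial>lborel) \<le> C"
      using fatou c'[OF k] by simp_all
  qed
  have k: "0 < real (Suc j)" for j by simp
  have nn: "0 \<le> p x * (truncation (real (Suc j)) (f x))\<^sup>2" for j x
    using p_pos[of x] by (simp del: of_nat_Suc)
  have lim: "(\<lambda>j. p x * (truncation (real (Suc j)) (f x))\<^sup>2) \<longlonglongrightarrow> p x * (f x)\<^sup>2" for x
    by (intro tendsto_intros truncation_tendsto f)
  show "integrable lborel (\<lambda>x. p x * (f x)\<^sup>2)" "(\<integral>x. p x * (f x)\<^sup>2 \<partial>lborel) \<le> C"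
    by (rule integral_le_fatou[OF tr(1)[OF k] nn tr(2)[OF k] tendsto_const lim])+
qed

text \<open>Twice the truncated energy with its linear part dominates the squared truncation, so the
  drift term is at most \<open>2 * \<delta>\<^sup>2\<close> times that energy and Gronwall applies.
  The initial value is bounded uniformly in \<open>k\<close> because \<open>w\<close> starts as the
  constant 1.\<close>

lemma L2_bound_evolution:
  assumes w: "weak_solution w w' W" and nn: "\<And>t x. 0 \<le> t \<Longrightarrow> 0 \<le> w t x"
    and mass: "\<And>t. 0 \<le> t \<Longrightarrow> integrable lborel (\<lambda>x. p x * w t x)"
      "\<And>t. 0 \<le> t \<Longrightarrow> (\<integral>x. p x * w t x \<partial>lborel) = 1"
    and init: "\<And>x. w 0 x = 1" and t: "0 \<le> t"
  shows "integrable lborel (\<lambda>x. p x * (w t x)\<^sup>2)"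
    and "(\<integral>x. p x * (w t x)\<^sup>2 \<partial>lborel) \<le> exp (2 * \<delta>\<^sup>2 * t)"
proof -
  define E where "E = exp (2 * \<delta>\<^sup>2 * t)"
  \<comment> \<open>The linear part enters without a cutoff, through its value \<open>k / 3\<close>
    known from the mass; being constant in time, it adds nothing to the derivative.\<close>
  define Y where "Y = (\<lambda>k n s. k / 3 + (\<integral>x. p x * ((cutoff (real (Suc n)) x)\<^sup>2 * truncated_energy k (w s x)) \<partial>lborel))"
  define c where "c = (\<lambda>k n. 2 * (E * (Y k n 0 + cutoff_error k (real (Suc n)) * t * E)))"
  have le: "(\<integral>x. p x * (cutoff (real (Suc n)) x * truncation k (w t x))\<^sup>2 \<partial>lborel) \<le> c k n" if k: "0 < k" for k n
  proof -
    define N where "N = real (Suc n)"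
    have N: "0 < N" by (simp add: N_def)
    have half: "(\<integral>x. p x * (cutoff N x * truncation k (w s x))\<^sup>2 \<partial>lborel) \<le> 2 * Y k n s" if s: "0 \<le> s" for s
    proof -
      note [continuous_intros] = p_cont cutoff_facts(2)[OF N] weak_solution_continuous[OF w s]
      have kw: "k + w s x \<noteq> 0" for x using k nn[OF s, of x] by linarith
      have int: "integrable lborel (\<lambda>x. p x * (cutoff N x * truncation k (w s x))\<^sup>2)"
        "integrable lborel (\<lambda>x. p x * ((cutoff N x)\<^sup>2 * truncated_energy k (w s x)))"
        unfolding truncation_def truncated_energy_def
        by (intro integrable_bounded_support[of _ N] continuous_intros; simp add: cutoff_support[OF N] kw)+
      have "(\<integral>x. p x * (cutoff N x * truncation k (w s x))\<^sup>2 \<partial>lborel) \<le>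
        (\<integral>x. 2 * (k / 3 * (p x * w s x) + p x * ((cutoff N x)\<^sup>2 * truncated_energy k (w s x))) \<partial>lborel)"
      proof (rule integral_mono)
        fix x
        note nn' = nn[OF s, of x]
        have "(cutoff N x)\<^sup>2 * ((truncation k (w s x))\<^sup>2 / 2) \<le> (cutoff N x)\<^sup>2 * (k / 3 * w s x + truncated_energy k (w s x))"
          by (intro mult_left_mono truncated_energy_bounds k nn') auto
        also have "\<dots> = (cutoff N x)\<^sup>2 * (k / 3 * w s x) + (cutoff N x)\<^sup>2 * truncated_energy k (w s x)"
          by (simp add: algebra_simps)
        \<comment> \<open>The cutoff is dropped from the linear part only, which is nonnegative; the
          energy part is negative and must keep it.\<close>
        also have "(cutoff N x)\<^sup>2 * (k / 3 * w s x) \<le> 1 * (k / 3 * w s x)"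
          using k nn' by (intro mult_right_mono power_le_one cutoff_nonneg cutoff_le_1) auto
        finally have "p x * (2 * ((cutoff N x)\<^sup>2 * ((truncation k (w s x))\<^sup>2 / 2))) \<le>
            p x * (2 * (1 * (k / 3 * w s x) + (cutoff N x)\<^sup>2 * truncated_energy k (w s x)))"
          using p_pos[of x] by (intro mult_left_mono) auto
        then show "p x * (cutoff N x * truncation k (w s x))\<^sup>2 \<le>
            2 * (k / 3 * (p x * w s x) + p x * ((cutoff N x)\<^sup>2 * truncated_energy k (w s x)))"
          by (simp add: power_mult_distrib algebra_simps)
      qed (intro int integrable_mult_right Bochner_Integration.integrable_add mass(1)[OF s])+
      also have "\<dots> = 2 * Y k n s"
        using int mass[OF s] by (simp add: Y_def N_def)
      finally show ?thesis .
    qed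
    have "Y k n t \<le> exp (2 * \<delta>\<^sup>2 * t) * (Y k n 0 + cutoff_error k N * t * exp (\<bar>2 * \<delta>\<^sup>2\<bar> * t))"
    proof (rule gronwall[OF t _ cutoff_error_nonneg[OF N]])
      show "continuous_on {0..t} (Y k n)"
        unfolding Y_def N_def[symmetric]
        by (intro continuous_intros continuous_on_subset[OF truncated_energy_derivative(1)[OF w nn k N]]) auto
      fix s assume s: "0 < s" "s < t"
      obtain D where D: "((\<lambda>t. \<integral>x. p x * ((cutoff N x)\<^sup>2 * truncated_energy k (w t x)) \<partial>lborel)
          has_real_derivative D) (at s)"
        "D \<le> - (\<integral>x. p x * (cutoff N x * (k / (k + w s x))\<^sup>2 * norm (T *v W s x))\<^sup>2 \<partial>lborel) / 2 +
          \<delta>\<^sup>2 * (\<integral>x. p x * (cutoff N x * truncation k (w s x))\<^sup>2 \<partial>lborel) + cutoff_error k N"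
        using truncated_energy_derivative(2)[OF w nn k N s(1)] by blast
      have "(Y k n has_real_derivative 0 + D) (at s)"
        unfolding Y_def N_def[symmetric] by (intro derivative_intros D)
      moreover have "0 \<le> (\<integral>x. p x * (cutoff N x * (k / (k + w s x))\<^sup>2 * norm (T *v W s x))\<^sup>2 \<partial>lborel)"
        by (intro Bochner_Integration.integral_nonneg mult_nonneg_nonneg less_imp_le[OF p_pos]) auto
      moreover have "\<delta>\<^sup>2 * (\<integral>x. p x * (cutoff N x * truncation k (w s x))\<^sup>2 \<partial>lborel) \<le> \<delta>\<^sup>2 * (2 * Y k n s)"
        using s by (intro mult_left_mono half) auto
      ultimately show "\<exists>D. (Y k n has_real_derivative D) (at s) \<and> D \<le> 2 * \<delta>\<^sup>2 * Y k n s + cutoff_error k N"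
        using D(2) by (intro exI[of _ "0 + D"] conjI) auto
    qed
    then show ?thesis
      using half[OF t] by (simp add: c_def E_def N_def)
  qed
  have lim: "c k \<longlonglongrightarrow> 2 * (E * (k / 3 + truncated_energy k 1))" if k: "0 < k" for k
  proof -
    have "(\<lambda>n. \<integral>x. p x * (cutoff (real (Suc n)) x)\<^sup>2 \<partial>lborel) \<longlonglongrightarrow> 1\<^sup>2"
      by (rule cutoff_integral_tendsto(2)) (auto intro!: continuous_intros power_le_one)
    then have "(\<lambda>n. 2 * (E * (k / 3 + (\<integral>x. p x * (cutoff (real (Suc n)) x)\<^sup>2 \<partial>lborel) * truncated_energy k 1
        + cutoff_error k (real (Suc n)) * t * E))) \<longlonglongrightarrow> 2 * (E * (k / 3 + 1\<^sup>2 * truncated_energy k 1 + 0 * t * E))"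
      by (intro tendsto_intros cutoff_error_tendsto)
    moreover have "c k = (\<lambda>n. 2 * (E * (k / 3 + (\<integral>x. p x * (cutoff (real (Suc n)) x)\<^sup>2 \<partial>lborel) * truncated_energy k 1
        + cutoff_error k (real (Suc n)) * t * E)))"
      by (simp only: c_def Y_def init mult.assoc[symmetric] integral_mult_left_zero)
    ultimately show ?thesis by simp
  qed
  \<comment> \<open>The upper bound of the truncated energy at \<open>h = 1\<close> is one half,
    whatever \<open>k\<close> is.\<close>
  have "2 * (E * (k / 3 + truncated_energy k 1)) \<le> E" if "0 < k" for k
    using truncated_energy_bounds(2)[OF that, of 1] mult_left_mono[of _ _ E] by (fastforce simp: E_def)
  from L2_bound_if_truncated_bound[OF weak_solution_continuous[OF w t] nn[OF t] le lim this]
  show "integrable lborel (\<lambda>x. p x * (w t x)\<^sup>2)" "(\<integral>x. p x * (w t x)\<^sup>2 \<partial>lborel) \<le> exp (2 * \<delta>\<^sup>2 * t)"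
    unfolding E_def by blast+
qed

text \<open>The energy of a stationary state has zero derivative, so its dissipation is bounded by
  the drift term and a cutoff error. The Poincare inequality for the cut-off truncation then bounds
  \<open>J\<close> by the squared mean, at most 1, plus a small multiple of \<open>J\<close> itself.
  The truncation makes \<open>J\<close> finite beforehand, which permits absorbing that
  multiple.\<close>

lemma L2_bound_stationary:
  assumes w: "weak_solution (\<lambda>t. h) h' H" and nn: "\<And>x. 0 \<le> h x"
    and mass: "integrable lborel (\<lambda>x. p x * h x)" "(\<integral>x. p x * h x \<partial>lborel) = 1"
    and small: "8 * \<kappa> * \<delta>\<^sup>2 \<le> 1"
  shows "integrable lborel (\<lambda>x. p x * (h x)\<^sup>2)" and "(\<integral>x. p x * (h x)\<^sup>2 \<partial>lborel) \<le> 2"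
proof -
  define c where "c = (\<lambda>k n. 2 + 8 * \<kappa> * cutoff_error k (real (Suc n)) + 4 * \<kappa> * k\<^sup>2 * (S * (4 / real (Suc n)))\<^sup>2)"
  \<comment> \<open>The gradient of \<open>h\<close> is the same at all positive times; time 1
    stands for any of them.\<close>
  define G where "G = H 1"
  have grad: "has_gradient h G"
    using w by (simp add: weak_solution_def G_def)
  have cont: "continuous_on UNIV h" "continuous_on UNIV G"
    using grad has_gradient_imp_continuous by (auto simp: has_gradient_def)
  have le: "(\<integral>x. p x * (cutoff (real (Suc n)) x * truncation k (h x))\<^sup>2 \<partial>lborel) \<le> c k n" if k: "0 < k" for k n
  proof -
    define N where "N = real (Suc n)"
    define q where "q = S * (4 / N)"
    have N: "0 < N" by (simp add: N_def)
    define J where "J = (\<integral>x. p x * (cutoff N x * truncation k (h x))\<^sup>2 \<partial>lborel)"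
    define X where "X = (\<integral>x. p x * (cutoff N x * (k / (k + h x))\<^sup>2 * norm (T *v G x))\<^sup>2 \<partial>lborel)"
    have kh: "k + h x \<noteq> 0" for x using k nn[of x] by linarith
    note [continuous_intros] = p_cont cutoff_facts(2,3)[OF N] cont continuous_on_matrix_mult
    have "\<exists>D. ((\<lambda>t. \<integral>x. p x * ((cutoff N x)\<^sup>2 * truncated_energy k (h x)) \<partial>lborel)
          has_real_derivative D) (at (1::real)) \<and> D \<le> - X / 2 + \<delta>\<^sup>2 * J + cutoff_error k N"
      using truncated_energy_derivative(2)[OF w nn k N, of 1] by (simp add: X_def J_def G_def)
    then have X: "X \<le> 2 * \<delta>\<^sup>2 * J + 2 * cutoff_error k N"
      using DERIV_unique[OF DERIV_const] by fastforce
    define f where "f = (\<lambda>x. cutoff N x * truncation k (h x))"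
    define F where "F = (\<lambda>x. cutoff N x *\<^sub>R ((k / (k + h x))\<^sup>2 *\<^sub>R G x) + truncation k (h x) *\<^sub>R cutoff_grad N x)"
    have tr: "(truncation k has_real_derivative (k / (k + y))\<^sup>2) (at y)" if "0 \<le> y" for y
      unfolding truncation_def[abs_def] using k that
      by (auto intro!: derivative_eq_intros simp: power2_eq_square add_pos_nonneg less_imp_neq[symmetric] field_simps)
    have "has_gradient (\<lambda>x. truncation k (h x)) (\<lambda>x. (k / (k + h x))\<^sup>2 *\<^sub>R G x)"
      by (rule has_gradient_compose[OF grad tr[OF nn]]) (intro continuous_intros, simp add: kh)
    then have f: "has_gradient f F"
      unfolding f_def F_def by (intro has_gradient_mult cutoff_facts(1)[OF N])
    have supp: "\<And>x. N < norm x \<Longrightarrow> f x = 0"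
      by (simp add: f_def cutoff_support[OF N])
    have int: "integrable lborel (\<lambda>x. p x * f x)" "integrable lborel (\<lambda>x. p x * (norm (T *v F x))\<^sup>2)"
      "integrable lborel (\<lambda>x. p x * (cutoff N x * (k / (k + h x))\<^sup>2 * norm (T *v G x))\<^sup>2)"
      unfolding f_def F_def truncation_def
      by (intro integrable_bounded_support[of _ N] continuous_intros; simp add: cutoff_support[OF N] cutoff_facts(4)[OF N] kh)+
    have "0 \<le> (\<integral>x. p x * f x \<partial>lborel)"
      unfolding f_def by (intro Bochner_Integration.integral_nonneg mult_nonneg_nonneg less_imp_le[OF p_pos] cutoff_nonneg truncation_le k nn)
    moreover have "(\<integral>x. p x * f x \<partial>lborel) \<le> (\<integral>x. p x * h x \<partial>lborel)"
    proof (rule integral_mono[OF int(1) mass(1)])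
      fix x
      have "f x \<le> 1 * h x"
        unfolding f_def by (intro mult_mono cutoff_le_1 truncation_le k nn) auto
      then show "p x * f x \<le> p x * h x"
        using p_pos[of x] by simp
    qed
    ultimately have mean: "(\<integral>x. p x * f x \<partial>lborel)\<^sup>2 \<le> 1"
      using mass(2) by (intro power_le_one) auto
    have "(\<integral>x. p x * (norm (T *v F x))\<^sup>2 \<partial>lborel) \<le>
        (\<integral>x. 2 * (p x * (cutoff N x * (k / (k + h x))\<^sup>2 * norm (T *v G x))\<^sup>2) + 2 * k\<^sup>2 * q\<^sup>2 * p x \<partial>lborel)"
    proof (rule integral_mono)
      fix x
      define A where "A = cutoff N x *\<^sub>R ((k / (k + h x))\<^sup>2 *\<^sub>R (T *v G x))"
      define B where "B = truncation k (h x) *\<^sub>R (T *v cutoff_grad N x)"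
      have "(norm (T *v F x))\<^sup>2 \<le> 2 * (norm A)\<^sup>2 + 2 * (norm B)\<^sup>2"
        using norm_add_power2_le[of A B] by (simp add: A_def B_def F_def matrix_vector_right_distrib matrix_vector_mult_scaleR)
      also have "norm A = cutoff N x * (k / (k + h x))\<^sup>2 * norm (T *v G x)"
        by (simp add: A_def cutoff_nonneg)
      also have "norm B \<le> k * q"
        unfolding B_def q_def using truncation_le[OF k nn[of x]] k S_pos N
        by (simp only: norm_scaleR) (intro mult_mono cutoff_facts(5)[OF N], auto)
      then have "(norm B)\<^sup>2 \<le> k\<^sup>2 * q\<^sup>2"
        using power_mono[of "norm B" "k * q" 2] by (simp add: power_mult_distrib)
      finally have "(norm (T *v F x))\<^sup>2 \<le> 2 * (cutoff N x * (k / (k + h x))\<^sup>2 * norm (T *v G x))\<^sup>2 + 2 * (k\<^sup>2 * q\<^sup>2)"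
        by simp
      then have "p x * (norm (T *v F x))\<^sup>2 \<le> p x * (2 * (cutoff N x * (k / (k + h x))\<^sup>2 * norm (T *v G x))\<^sup>2 + 2 * (k\<^sup>2 * q\<^sup>2))"
        using p_pos[of x] by (intro mult_left_mono) auto
      then show "p x * (norm (T *v F x))\<^sup>2 \<le> 2 * (p x * (cutoff N x * (k / (k + h x))\<^sup>2 * norm (T *v G x))\<^sup>2) + 2 * k\<^sup>2 * q\<^sup>2 * p x"
        by (simp only: algebra_simps)
    qed (intro int p_int Bochner_Integration.integrable_add integrable_mult_right)+
    also have "\<dots> = 2 * X + 2 * k\<^sup>2 * q\<^sup>2"
      using int p_int p_one by (simp add: X_def)
    finally have TF: "(\<integral>x. p x * (norm (T *v F x))\<^sup>2 \<partial>lborel) \<le> 2 * X + 2 * k\<^sup>2 * q\<^sup>2" .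
    have "J \<le> (\<integral>x. p x * f x \<partial>lborel)\<^sup>2 + \<kappa> * (\<integral>x. p x * (norm (T *v F x))\<^sup>2 \<partial>lborel)"
      using poincare[OF f supp] by (simp add: J_def f_def)
    also have "\<dots> \<le> 1 + \<kappa> * (2 * (2 * \<delta>\<^sup>2 * J + 2 * cutoff_error k N) + 2 * k\<^sup>2 * q\<^sup>2)"
      using TF X \<kappa>_pos mean by (intro add_mono mult_left_mono) auto
    also have "\<dots> = 1 + 4 * \<kappa> * \<delta>\<^sup>2 * J + 4 * \<kappa> * cutoff_error k N + 2 * \<kappa> * k\<^sup>2 * q\<^sup>2"
      by (simp add: algebra_simps)
    \<comment> \<open>The smallness assumption is exactly what lets half of \<open>J\<close> be
      absorbed on the left; doubling the rest yields \<open>c k n\<close>.\<close>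
    also have "4 * \<kappa> * \<delta>\<^sup>2 * J \<le> 1 / 2 * J"
    proof (rule mult_right_mono)
      show "0 \<le> J"
        unfolding J_def by (intro Bochner_Integration.integral_nonneg mult_nonneg_nonneg less_imp_le[OF p_pos]) auto
    qed (use small in simp)
    finally show ?thesis
      by (simp add: c_def J_def N_def q_def)
  qed
  have lim: "c k \<longlonglongrightarrow> 2" if "0 < k" for k
  proof -
    have "c k \<longlonglongrightarrow> 2 + 8 * \<kappa> * 0 + 4 * \<kappa> * k\<^sup>2 * 0\<^sup>2"
      unfolding c_def by (intro tendsto_intros cutoff_error_tendsto inverse_radius_tendsto)
    then show ?thesis by simp
  qed
  from L2_bound_if_truncated_bound[OF cont(1) nn le lim order_refl]
  show "integrable lborel (\<lambda>x. p x * (h x)\<^sup>2)" "(\<integral>x. p x * (h x)\<^sup>2 \<partial>lborel) \<le> 2" by blast+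
qed

section \<open>Exponential decay\<close>

text \<open>Energy estimate for the plain square, with a cutoff. The bound \<open>B\<close> may
  depend on \<open>t\<close>: it only multiplies errors that vanish as the radius grows, and so it
  is absent from the conclusion. No sign of \<open>g\<close> is available here, as \<open>g\<close>
  will be a difference of densities.\<close>

lemma L2_decay:
  assumes w: "weak_solution g g' G" and t: "0 \<le> t"
    and mean: "\<And>s. 0 \<le> s \<Longrightarrow> s \<le> t \<Longrightarrow> integrable lborel (\<lambda>x. p x * g s x)"
      "\<And>s. 0 \<le> s \<Longrightarrow> s \<le> t \<Longrightarrow> (\<integral>x. p x * g s x \<partial>lborel) = 0"
    and L2: "\<And>s. 0 \<le> s \<Longrightarrow> s \<le> t \<Longrightarrow> integrable lborel (\<lambda>x. p x * (g s x)\<^sup>2)"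
      "\<And>s. 0 \<le> s \<Longrightarrow> s \<le> t \<Longrightarrow> (\<integral>x. p x * (g s x)\<^sup>2 \<partial>lborel) \<le> B"
    and small: "8 * \<kappa> * \<delta>\<^sup>2 \<le> 1"
  shows "(\<integral>x. p x * (g t x)\<^sup>2 \<partial>lborel) \<le> exp (- t / (4 * \<kappa>)) * (\<integral>x. p x * (g 0 x)\<^sup>2 \<partial>lborel)"
proof -
  define c where "c = - 1 / (4 * \<kappa>)"
  define q where "q = (\<lambda>n. S * (4 / real (Suc n)))"
  define \<eta> where "\<eta> = (\<lambda>n. \<integral>x. p x * (1 - cutoff (real (Suc n)) x)\<^sup>2 \<partial>lborel)"
  \<comment> \<open>The three terms stem from the mean of the cut-off function in the Poincare
    inequality, from the cutoff gradient in that inequality, and from the cutoff gradient in the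
    energy identity.\<close>
  define e where "e = (\<lambda>n. B * \<eta> n / (4 * \<kappa>) + B * (q n)\<^sup>2 / 2 + (4 * (q n)\<^sup>2 + 2 * (q n * \<delta>)) * B)"
  define Y where "Y = (\<lambda>n s. \<integral>x. p x * ((cutoff (real (Suc n)) x)\<^sup>2 * ((g s x)\<^sup>2 / 2)) \<partial>lborel)"
  have int\<eta>: "integrable lborel (\<lambda>x. p x * (1 - cutoff (real (Suc n)) x)\<^sup>2)" for n
    by (rule cutoff_integral_tendsto(1)[of "\<lambda>y. (1 - y)\<^sup>2"]) (auto intro!: continuous_intros power_le_one)
  have "\<eta> \<longlonglongrightarrow> (1 - 1)\<^sup>2"
    unfolding \<eta>_def
    by (rule cutoff_integral_tendsto(2)[of "\<lambda>y. (1 - y)\<^sup>2"]) (auto intro!: continuous_intros power_le_one)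
  then have "e \<longlonglongrightarrow> B * (1 - 1)\<^sup>2 / (4 * \<kappa>) + B * 0\<^sup>2 / 2 + (4 * 0\<^sup>2 + 2 * (0 * \<delta>)) * B"
    unfolding e_def q_def using \<kappa>_pos by (intro tendsto_intros inverse_radius_tendsto) auto
  then have e0: "e \<longlonglongrightarrow> 0" by simp
  have "0 \<le> (\<integral>x. p x * (g 0 x)\<^sup>2 \<partial>lborel)"
    by (intro Bochner_Integration.integral_nonneg mult_nonneg_nonneg less_imp_le[OF p_pos]) auto
  then have B: "0 \<le> B"
    using L2(2)[of 0] t by linarith
  have \<eta>0: "0 \<le> \<eta> n" for n
    unfolding \<eta>_def by (intro Bochner_Integration.integral_nonneg mult_nonneg_nonneg less_imp_le[OF p_pos]) auto
  have q0: "0 \<le> q n" for n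
    using S_pos by (simp add: q_def)
  have en: "0 \<le> e n" for n
    unfolding e_def using B \<eta>0 q0 \<delta>_nonneg \<kappa>_pos
    by (intro add_nonneg_nonneg mult_nonneg_nonneg divide_nonneg_nonneg) auto
  have le: "Y n t \<le> exp (c * t) * (Y n 0 + e n * t * exp (\<bar>c\<bar> * t))" for n
  proof (rule gronwall[OF t _ en])
    define N where "N = real (Suc n)"
    have N: "0 < N" by (simp add: N_def)
    have H: "((\<lambda>y::real. y\<^sup>2 / 2) has_real_derivative y) (at y)" for y
      by (auto intro!: derivative_eq_intros)
    have H': "((\<lambda>y::real. y) has_real_derivative 1) (at y)" for y
      by (auto intro!: derivative_eq_intros)
    note energy = energy_continuous[OF w UNIV_I H H' continuous_on_const cutoff_facts(1)[OF N] cutoff_support[OF N]]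
      energy_derivative[OF w UNIV_I H H' continuous_on_const cutoff_facts(1)[OF N] cutoff_support[OF N]]
    show "continuous_on {0..t} (Y n)"
      unfolding Y_def N_def[symmetric] by (rule continuous_on_subset[OF energy(1)]) auto
    fix s assume s: "0 < s" "s < t"
    then have s': "0 \<le> s" "s \<le> t" by auto
    have grad: "has_gradient (g s) (G s)"
      using w s by (simp add: weak_solution_def)
    define J where "J = (\<lambda>x. (cutoff N x)\<^sup>2 * 1 * ((norm (T *v G s x))\<^sup>2 - g s x * ((T *v G s x) \<bullet> b x))
           + 2 * cutoff N x * g s x * ((T *v cutoff_grad N x) \<bullet> (T *v G s x - g s x *\<^sub>R b x)))"
    have der: "(Y n has_real_derivative - (\<integral>x. p x * J x \<partial>lborel)) (at s)"
      unfolding Y_def J_def N_def[symmetric] by (rule energy(2)) (use s in auto)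
    define X where "X = (\<integral>x. p x * (cutoff N x * norm (T *v G s x))\<^sup>2 \<partial>lborel)"
    have [continuous_intros]: "continuous_on UNIV (g s)" "continuous_on UNIV (G s)"
      using grad has_gradient_imp_continuous by (auto simp: has_gradient_def)
    note [continuous_intros] = p_cont b_cont continuous_on_matrix_mult cutoff_facts(2,3)[OF N]
    have int: "integrable lborel (\<lambda>x. p x * J x)" "integrable lborel (\<lambda>x. p x * (cutoff N x * norm (T *v G s x))\<^sup>2)"
      "integrable lborel (\<lambda>x. p x * ((cutoff N x)\<^sup>2 * ((g s x)\<^sup>2 / 2)))" "integrable lborel (\<lambda>x. p x * (cutoff N x * g s x))"
      unfolding J_def
      by (intro integrable_bounded_support[of _ N] continuous_intros;
          simp add: cutoff_support[OF N] cutoff_facts(4)[OF N])+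
    note g2 = L2(1)[OF s']
    have pt: "(cutoff N x * norm (T *v G s x))\<^sup>2 / 2 - \<delta>\<^sup>2 * (2 * ((cutoff N x)\<^sup>2 * ((g s x)\<^sup>2 / 2)))
        - (4 * (q n)\<^sup>2 + 2 * (q n * \<delta>)) * (g s x)\<^sup>2 \<le> J x" for x
    proof -
      define \<phi> where "\<phi> = cutoff N x"
      have \<phi>: "0 \<le> \<phi>" "\<phi> \<le> 1" by (auto simp: \<phi>_def cutoff_nonneg cutoff_le_1)
      have J: "J x = \<phi>\<^sup>2 * (norm (T *v G s x))\<^sup>2 - \<phi> * (\<phi> * g s x) * ((T *v G s x) \<bullet> b x)
          + \<phi> * (2 * g s x) * ((T *v cutoff_grad N x) \<bullet> (T *v G s x))
          - (2 * \<phi> * (g s x)\<^sup>2) * ((T *v cutoff_grad N x) \<bullet> b x)"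
        unfolding J_def \<phi>_def[symmetric] by (simp add: inner_diff_right power2_eq_square algebra_simps)
      have 1: "(\<phi> * norm (T *v G s x))\<^sup>2 / 2 - \<delta>\<^sup>2 * (\<phi> * g s x)\<^sup>2 - (2 * g s x)\<^sup>2 * (q n)\<^sup>2
          - \<bar>2 * \<phi> * (g s x)\<^sup>2\<bar> * (q n * \<delta>) \<le> J x"
        unfolding J using \<phi> cutoff_facts(5)[OF N, of x]
        by (intro energy_integrand_bound b_bound) (auto simp: q_def N_def)
      have "\<bar>2 * \<phi> * (g s x)\<^sup>2\<bar> * (q n * \<delta>) = \<phi> * (2 * (q n * \<delta>) * (g s x)\<^sup>2)"
        using \<phi> by (simp add: abs_mult)
      also have "\<dots> \<le> 1 * (2 * (q n * \<delta>) * (g s x)\<^sup>2)"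
        using \<phi> q0[of n] \<delta>_nonneg by (intro mult_right_mono) auto
      finally show ?thesis
        using 1 unfolding \<phi>_def[symmetric] by (simp add: power_mult_distrib algebra_simps)
    qed
    have "(\<integral>x. p x * (cutoff N x * norm (T *v G s x))\<^sup>2 / 2 - \<delta>\<^sup>2 * (2 * (p x * ((cutoff N x)\<^sup>2 * ((g s x)\<^sup>2 / 2))))
        - (4 * (q n)\<^sup>2 + 2 * (q n * \<delta>)) * (p x * (g s x)\<^sup>2) \<partial>lborel) \<le> (\<integral>x. p x * J x \<partial>lborel)"
    proof (rule integral_mono)
      fix x
      show "p x * (cutoff N x * norm (T *v G s x))\<^sup>2 / 2 - \<delta>\<^sup>2 * (2 * (p x * ((cutoff N x)\<^sup>2 * ((g s x)\<^sup>2 / 2))))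
        - (4 * (q n)\<^sup>2 + 2 * (q n * \<delta>)) * (p x * (g s x)\<^sup>2) \<le> p x * J x"
        using mult_left_mono[OF pt[of x] less_imp_le[OF p_pos[of x]]] by (simp add: algebra_simps)
    qed (intro Bochner_Integration.integrable_diff integrable_mult_right integrable_divide int g2)+
    also have "(\<integral>x. p x * (cutoff N x * norm (T *v G s x))\<^sup>2 / 2 - \<delta>\<^sup>2 * (2 * (p x * ((cutoff N x)\<^sup>2 * ((g s x)\<^sup>2 / 2))))
        - (4 * (q n)\<^sup>2 + 2 * (q n * \<delta>)) * (p x * (g s x)\<^sup>2) \<partial>lborel) =
        X / 2 - \<delta>\<^sup>2 * (2 * Y n s) - (4 * (q n)\<^sup>2 + 2 * (q n * \<delta>)) * (\<integral>x. p x * (g s x)\<^sup>2 \<partial>lborel)"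
    proof -
      have "integrable lborel (\<lambda>x. p x * (cutoff N x * norm (T *v G s x))\<^sup>2 / 2)"
        "integrable lborel (\<lambda>x. \<delta>\<^sup>2 * (2 * (p x * ((cutoff N x)\<^sup>2 * ((g s x)\<^sup>2 / 2)))))"
        "integrable lborel (\<lambda>x. (4 * (q n)\<^sup>2 + 2 * (q n * \<delta>)) * (p x * (g s x)\<^sup>2))"
        by (intro integrable_mult_right integrable_divide int g2)+
      then show ?thesis
        by (simp only: Bochner_Integration.integral_diff Bochner_Integration.integrable_diff
            integral_mult_right_zero integral_divide_zero X_def Y_def N_def)
    qed
    finally have D: "- (\<integral>x. p x * J x \<partial>lborel) \<le>
        - X / 2 + \<delta>\<^sup>2 * (2 * Y n s) + (4 * (q n)\<^sup>2 + 2 * (q n * \<delta>)) * (\<integral>x. p x * (g s x)\<^sup>2 \<partial>lborel)"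
      by linarith
    also have "(4 * (q n)\<^sup>2 + 2 * (q n * \<delta>)) * (\<integral>x. p x * (g s x)\<^sup>2 \<partial>lborel) \<le> (4 * (q n)\<^sup>2 + 2 * (q n * \<delta>)) * B"
      using q0 \<delta>_nonneg by (intro mult_left_mono L2(2) s') auto
    finally have D: "- (\<integral>x. p x * J x \<partial>lborel) \<le>
        - X / 2 + \<delta>\<^sup>2 * (2 * Y n s) + (4 * (q n)\<^sup>2 + 2 * (q n * \<delta>)) * B"
      by simp
    define F where "F = (\<lambda>x. cutoff N x *\<^sub>R G s x + g s x *\<^sub>R cutoff_grad N x)"
    have f: "has_gradient (\<lambda>x. cutoff N x * g s x) F"
      unfolding F_def by (intro has_gradient_mult cutoff_facts(1)[OF N] grad)
    have intF: "integrable lborel (\<lambda>x. p x * (norm (T *v F x))\<^sup>2)"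
      unfolding F_def by (intro integrable_bounded_support[of _ N] continuous_intros;
          simp add: cutoff_support[OF N] cutoff_facts(4)[OF N])
    have "(\<integral>x. p x * (norm (T *v F x))\<^sup>2 \<partial>lborel) \<le>
        (\<integral>x. 2 * (p x * (cutoff N x * norm (T *v G s x))\<^sup>2) + 2 * (q n)\<^sup>2 * (p x * (g s x)\<^sup>2) \<partial>lborel)"
    proof (rule integral_mono)
      fix x
      define A1 where "A1 = cutoff N x *\<^sub>R (T *v G s x)"
      define B1 where "B1 = g s x *\<^sub>R (T *v cutoff_grad N x)"
      have "(norm (T *v F x))\<^sup>2 \<le> 2 * (norm A1)\<^sup>2 + 2 * (norm B1)\<^sup>2"
        using norm_add_power2_le[of A1 B1] by (simp add: A1_def B1_def F_def matrix_vector_right_distrib matrix_vector_mult_scaleR)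
      also have "norm A1 = cutoff N x * norm (T *v G s x)"
        by (simp add: A1_def cutoff_nonneg)
      also have "(norm B1)\<^sup>2 \<le> (g s x)\<^sup>2 * (q n)\<^sup>2"
        using cutoff_facts(5)[OF N, of x]
        by (auto simp: B1_def power_mult_distrib q_def N_def intro!: mult_left_mono power_mono)
      finally have "p x * (norm (T *v F x))\<^sup>2 \<le> p x * (2 * (cutoff N x * norm (T *v G s x))\<^sup>2 + 2 * ((g s x)\<^sup>2 * (q n)\<^sup>2))"
        using p_pos[of x] by (intro mult_left_mono) auto
      then show "p x * (norm (T *v F x))\<^sup>2 \<le> 2 * (p x * (cutoff N x * norm (T *v G s x))\<^sup>2) + 2 * (q n)\<^sup>2 * (p x * (g s x)\<^sup>2)"
        by (simp only: algebra_simps)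
    qed (intro intF int g2 Bochner_Integration.integrable_add integrable_mult_right)+
    also have "\<dots> = 2 * X + 2 * (q n)\<^sup>2 * (\<integral>x. p x * (g s x)\<^sup>2 \<partial>lborel)"
      using int g2 by (simp add: X_def)
    also have "\<dots> \<le> 2 * X + 2 * (q n)\<^sup>2 * B"
      by (intro add_left_mono mult_left_mono L2(2) s') auto
    finally have TF: "(\<integral>x. p x * (norm (T *v F x))\<^sup>2 \<partial>lborel) \<le> 2 * X + 2 * (q n)\<^sup>2 * B" .
    \<comment> \<open>As \<open>g s\<close> has mean zero, its product with the cutoff has the
      opposite mean to its product with the complement of the cutoff, which is small by
      Cauchy--Schwarz.\<close>
    have mean_le: "(\<integral>x. p x * (cutoff N x * g s x) \<partial>lborel)\<^sup>2 \<le> \<eta> n * B"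
    proof -
      have intd: "integrable lborel (\<lambda>x. p x * ((1 - cutoff N x) * g s x))"
        using Bochner_Integration.integrable_diff[OF mean(1)[OF s'] int(4)] by (simp add: algebra_simps)
      have "(\<integral>x. p x * ((1 - cutoff N x) * g s x) \<partial>lborel) = (\<integral>x. p x * g s x - p x * (cutoff N x * g s x) \<partial>lborel)"
        by (simp add: algebra_simps)
      also have "\<dots> = - (\<integral>x. p x * (cutoff N x * g s x) \<partial>lborel)"
        using mean[OF s'] int(4) by simp
      finally have "(\<integral>x. p x * (cutoff N x * g s x) \<partial>lborel)\<^sup>2 = (\<integral>x. p x * ((1 - cutoff N x) * g s x) \<partial>lborel)\<^sup>2"
        by simp
      also have "\<dots> \<le> \<eta> n * (\<integral>x. p x * (g s x)\<^sup>2 \<partial>lborel)"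
        unfolding \<eta>_def N_def[symmetric]
        by (rule integral_Cauchy_Schwarz[OF less_imp_le[OF p_pos] int\<eta>[of n, folded N_def] g2 intd])
      also have "\<dots> \<le> \<eta> n * B"
        by (intro mult_left_mono L2(2) s' \<eta>0)
      finally show ?thesis .
    qed
    have "2 * Y n s = (\<integral>x. p x * (cutoff N x * g s x)\<^sup>2 \<partial>lborel)"
      unfolding Y_def N_def[symmetric] integral_mult_right_zero[symmetric] by (simp add: power_mult_distrib)
    also have "\<dots> \<le> (\<integral>x. p x * (cutoff N x * g s x) \<partial>lborel)\<^sup>2 + \<kappa> * (\<integral>x. p x * (norm (T *v F x))\<^sup>2 \<partial>lborel)"
      by (rule poincare[OF f, of N]) (simp add: cutoff_support[OF N])
    also have "\<dots> \<le> \<eta> n * B + \<kappa> * (2 * X + 2 * (q n)\<^sup>2 * B)"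
      using \<kappa>_pos by (intro add_mono mean_le mult_left_mono TF) auto
    finally have "2 * Y n s / (4 * \<kappa>) \<le> (\<eta> n * B + \<kappa> * (2 * X + 2 * (q n)\<^sup>2 * B)) / (4 * \<kappa>)"
      using \<kappa>_pos by (intro divide_right_mono) auto
    also have "\<dots> = B * \<eta> n / (4 * \<kappa>) + X / 2 + B * (q n)\<^sup>2 / 2"
      using \<kappa>_pos by (simp add: field_simps)
    finally have P: "- X / 2 \<le> B * \<eta> n / (4 * \<kappa>) + B * (q n)\<^sup>2 / 2 - 2 * Y n s / (4 * \<kappa>)" by linarith
    have "0 \<le> Y n s"
      unfolding Y_def by (intro Bochner_Integration.integral_nonneg mult_nonneg_nonneg less_imp_le[OF p_pos]) auto
    \<comment> \<open>The Poincare inequality turns half the dissipation into the rate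
      \<open>1 / (2 * \<kappa>)\<close> for \<open>Y\<close>; the drift may consume half of that
      rate, which leaves \<open>- c = 1 / (4 * \<kappa>)\<close>.\<close>
    moreover have "2 * \<delta>\<^sup>2 \<le> 1 / (4 * \<kappa>)"
      using small \<kappa>_pos by (simp add: field_simps)
    ultimately have "2 * \<delta>\<^sup>2 * Y n s \<le> 1 / (4 * \<kappa>) * Y n s"
      by (rule mult_right_mono[rotated])
    then have "- (\<integral>x. p x * J x \<partial>lborel) \<le> c * Y n s + e n"
      using D P unfolding e_def c_def by simp
    with der show "\<exists>D. (Y n has_real_derivative D) (at s) \<and> D \<le> c * Y n s + e n"
      by blast
  qed
  define I0 where "I0 = (\<integral>x. p x * (g 0 x)\<^sup>2 \<partial>lborel)"
  have cont: "continuous_on UNIV (g s)" if "0 \<le> s" for s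
    by (rule weak_solution_continuous[OF w that])
  have intY: "integrable lborel (\<lambda>x. p x * (cutoff (real (Suc n)) x * g s x)\<^sup>2)" if "0 \<le> s" for n s
    by (intro integrable_bounded_support[of _ "real (Suc n)"] continuous_intros p_cont cutoff_facts(2) cont that)
       (simp_all add: cutoff_support)
  have Y2: "2 * Y n s = (\<integral>x. p x * (cutoff (real (Suc n)) x * g s x)\<^sup>2 \<partial>lborel)" for n s
    unfolding Y_def integral_mult_right_zero[symmetric] by (simp add: power_mult_distrib)
  have "2 * Y n 0 \<le> I0" for n
    unfolding Y2 I0_def
  proof (rule integral_mono[OF intY L2(1)])
    fix x
    have "(cutoff (real (Suc n)) x)\<^sup>2 * (g 0 x)\<^sup>2 \<le> 1 * (g 0 x)\<^sup>2"
      by (intro mult_right_mono power_le_one cutoff_nonneg cutoff_le_1) auto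
    then show "p x * (cutoff (real (Suc n)) x * g 0 x)\<^sup>2 \<le> p x * (g 0 x)\<^sup>2"
      using p_pos[of x] by (simp add: power_mult_distrib)
  qed (use t in auto)
  then have mono: "exp (c * t) * (2 * Y n 0 + 2 * e n * t * exp (\<bar>c\<bar> * t)) \<le>
      exp (c * t) * (I0 + 2 * e n * t * exp (\<bar>c\<bar> * t))" for n
    by (intro mult_left_mono add_right_mono) auto
  have "2 * Y n t \<le> exp (c * t) * (2 * Y n 0 + 2 * e n * t * exp (\<bar>c\<bar> * t))" for n
    using le[of n] by (simp add: algebra_simps)
  then have "2 * Y n t \<le> exp (c * t) * (I0 + 2 * e n * t * exp (\<bar>c\<bar> * t))" for n
    using mono order_trans by blast
  then have le': "(\<integral>x. p x * (cutoff (real (Suc n)) x * g t x)\<^sup>2 \<partial>lborel) \<le> exp (c * t) * (I0 + 2 * e n * t * exp (\<bar>c\<bar> * t))" for n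
    unfolding Y2 .
  have "(\<lambda>n. exp (c * t) * (I0 + 2 * e n * t * exp (\<bar>c\<bar> * t))) \<longlonglongrightarrow> exp (c * t) * (I0 + 2 * 0 * t * exp (\<bar>c\<bar> * t))"
    by (intro tendsto_intros e0)
  then have lim: "(\<lambda>n. exp (c * t) * (I0 + 2 * e n * t * exp (\<bar>c\<bar> * t))) \<longlonglongrightarrow> exp (c * t) * I0"
    by simp
  have nn: "0 \<le> p x * (cutoff (real (Suc n)) x * g t x)\<^sup>2" for n x
    using p_pos[of x] by (simp del: of_nat_Suc)
  have ptw: "(\<lambda>n. p x * (cutoff (real (Suc n)) x * g t x)\<^sup>2) \<longlonglongrightarrow> p x * (1 * g t x)\<^sup>2" for x
    by (intro tendsto_intros cutoff_tendsto_1)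
  show ?thesis
    using integral_le_fatou(2)[OF intY[OF t] nn le' lim ptw] by (simp add: c_def I0_def)
qed

text \<open>Cauchy--Schwarz against the probability density \<open>p\<close> passes from the square
  norm to the absolute one and so halves the rate \<open>1 / (4 * \<kappa>)\<close>. The two
  preceding square bounds are what makes \<open>L2_decay\<close> applicable to the
  difference.\<close>

theorem L1_decay:
  assumes w: "weak_solution w w' W" and w0: "\<And>t x. 0 \<le> t \<Longrightarrow> 0 \<le> w t x"
    and w_mass: "\<And>t. 0 \<le> t \<Longrightarrow> integrable lborel (\<lambda>x. p x * w t x)"
      "\<And>t. 0 \<le> t \<Longrightarrow> (\<integral>x. p x * w t x \<partial>lborel) = 1"
    and init: "\<And>x. w 0 x = 1"
    and h: "weak_solution (\<lambda>t. h) h' H" and h0: "\<And>x. 0 \<le> h x"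
    and h_mass: "integrable lborel (\<lambda>x. p x * h x)" "(\<integral>x. p x * h x \<partial>lborel) = 1"
    and small: "8 * \<kappa> * \<delta>\<^sup>2 \<le> 1" and t: "0 \<le> t"
  shows "(\<integral>x. p x * \<bar>w t x - h x\<bar> \<partial>lborel) \<le> exp (- (1 / (8 * \<kappa>)) * t)"
proof -
  define g where "g = (\<lambda>t x. w t x - h x)"
  note hL2 = L2_bound_stationary[OF h h0 h_mass small]
  have wL2: "integrable lborel (\<lambda>x. p x * (w s x)\<^sup>2)" "(\<integral>x. p x * (w s x)\<^sup>2 \<partial>lborel) \<le> exp (2 * \<delta>\<^sup>2 * s)"
    if "0 \<le> s" for s
    by (rule L2_bound_evolution[OF w w0 w_mass init that]; assumption)+
  have g: "weak_solution g (\<lambda>t x. w' t x - h' t x) (\<lambda>t x. W t x - H t x)"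
    unfolding g_def by (rule weak_solution_diff[OF w h])
  have cont: "continuous_on UNIV (g s)" if "0 \<le> s" for s
    by (rule weak_solution_continuous[OF g that])
  \<comment> \<open>From \<open>(a - b)\<^sup>2 \<le> 2 * a\<^sup>2 + 2 * b\<^sup>2\<close> with the
    bounds for \<open>w\<close> up to time \<open>t\<close> and the bound 2 for
    \<open>h\<close>.\<close>
  define B where "B = 2 * exp (2 * \<delta>\<^sup>2 * t) + 4"
  have gL2: "integrable lborel (\<lambda>x. p x * (g s x)\<^sup>2)" "(\<integral>x. p x * (g s x)\<^sup>2 \<partial>lborel) \<le> B" if s: "0 \<le> s" "s \<le> t" for s
  proof -
    have le: "p x * (g s x)\<^sup>2 \<le> 2 * (p x * (w s x)\<^sup>2) + 2 * (p x * (h x)\<^sup>2)" for x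
    proof -
      have "(g s x)\<^sup>2 \<le> 2 * (w s x)\<^sup>2 + 2 * (h x)\<^sup>2"
        using zero_le_power2[of "w s x + h x"] by (simp add: g_def power2_sum power2_diff)
      from mult_left_mono[OF this less_imp_le[OF p_pos[of x]]] show ?thesis
        by (simp add: algebra_simps)
    qed
    have int: "integrable lborel (\<lambda>x. 2 * (p x * (w s x)\<^sup>2) + 2 * (p x * (h x)\<^sup>2))"
      by (intro Bochner_Integration.integrable_add integrable_mult_right wL2 hL2 s)
    have "continuous_on UNIV (\<lambda>x. p x * (g s x)\<^sup>2)"
      by (intro continuous_intros p_cont cont s)
    then show int': "integrable lborel (\<lambda>x. p x * (g s x)\<^sup>2)"
      using le p_pos by (intro Bochner_Integration.integrable_bound[OF int])
        (auto intro!: AE_I2 order_trans[OF _ abs_ge_self] dest: borel_measurable_continuous_onI simp: abs_mult less_imp_le)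
    have "(\<integral>x. p x * (g s x)\<^sup>2 \<partial>lborel) \<le> (\<integral>x. 2 * (p x * (w s x)\<^sup>2) + 2 * (p x * (h x)\<^sup>2) \<partial>lborel)"
      by (rule integral_mono[OF int' int le])
    also have "\<dots> = 2 * (\<integral>x. p x * (w s x)\<^sup>2 \<partial>lborel) + 2 * (\<integral>x. p x * (h x)\<^sup>2 \<partial>lborel)"
      using wL2[OF s(1)] hL2 by simp
    also have "\<dots> \<le> 2 * exp (2 * \<delta>\<^sup>2 * s) + 2 * 2"
      using wL2[OF s(1)] hL2 by linarith
    also have "\<dots> \<le> B"
      using s by (simp add: B_def mult_left_mono)
    finally show "(\<integral>x. p x * (g s x)\<^sup>2 \<partial>lborel) \<le> B" .
  qed
  have gmean: "integrable lborel (\<lambda>x. p x * g s x)" "(\<integral>x. p x * g s x \<partial>lborel) = 0" if "0 \<le> s" for s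
    using w_mass[OF that] h_mass by (simp_all add: g_def right_diff_distrib)
  \<comment> \<open>Both masses being 1, this integral is that of \<open>p x * (h x)\<^sup>2\<close>
    minus 1, hence at most 1; this is why the final prefactor is 1.\<close>
  have "(\<integral>x. p x * (g 0 x)\<^sup>2 \<partial>lborel) = (\<integral>x. p x - 2 * (p x * h x) + p x * (h x)\<^sup>2 \<partial>lborel)"
    by (simp add: g_def init power2_diff algebra_simps)
  also have "\<dots> \<le> 1"
    using p_int p_one h_mass hL2 by simp
  finally have g0: "(\<integral>x. p x * (g 0 x)\<^sup>2 \<partial>lborel) \<le> 1" .
  have absg: "integrable lborel (\<lambda>x. p x * \<bar>g t x\<bar>)"
    using integrable_abs[OF gmean(1)[OF t]] p_pos by (simp add: abs_mult less_imp_le)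
  have "(\<integral>x. p x * (1 * \<bar>g t x\<bar>) \<partial>lborel)\<^sup>2 \<le> (\<integral>x. p x * 1\<^sup>2 \<partial>lborel) * (\<integral>x. p x * \<bar>g t x\<bar>\<^sup>2 \<partial>lborel)"
    using gL2[OF t order_refl] p_int absg
    by (intro integral_Cauchy_Schwarz less_imp_le[OF p_pos]) auto
  also have "\<dots> \<le> exp (- t / (4 * \<kappa>)) * (\<integral>x. p x * (g 0 x)\<^sup>2 \<partial>lborel)"
    using L2_decay[OF g t gmean gL2 small] p_one by simp
  also have "\<dots> \<le> exp (- t / (4 * \<kappa>)) * 1"
    using g0 by (intro mult_left_mono) auto
  also have "\<dots> = (exp (- (1 / (8 * \<kappa>)) * t))\<^sup>2"
    by (simp add: power2_eq_square field_simps flip: exp_add)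
  finally have "(\<integral>x. p x * (1 * \<bar>g t x\<bar>) \<partial>lborel) \<le> exp (- (1 / (8 * \<kappa>)) * t)"
    by (rule power2_le_imp_le) simp
  then show ?thesis by (simp add: g_def)
qed

end

section \<open>From the classical equation to the weak formulation\<close>

text \<open>The gradient of \<open>1 / p\<close> is \<open>(1 / p) *\<^sub>R grad V\<close>, so
  \<open>grad u + u *\<^sub>R grad V\<close> equals \<open>p\<close> times the gradient of
  \<open>u / p\<close>. The flux thus becomes \<open>p\<close> times the gradient minus the drift,
  and the factor \<open>\<sigma> ** transpose \<sigma>\<close> is shared between the two sides of
  the inner product.\<close>

lemma fokker_planck_weak_solution:
  fixes V :: "real^'d \<Rightarrow> real" and M :: "real^'d \<Rightarrow> real^'d" and \<sigma> :: "real^'d^'d"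
  assumes "weighted_space p (transpose \<sigma>) (\<lambda>x. \<epsilon> *\<^sub>R (transpose \<sigma> *v M x)) \<kappa> \<delta> S"
    and V: "smooth V" and M: "smooth M" and p: "p = gibbs_density V"
    and u: "fokker_planck_equation V M \<sigma> \<epsilon> u"
  shows "weighted_space.weak_solution p (transpose \<sigma>) (\<lambda>x. \<epsilon> *\<^sub>R (transpose \<sigma> *v M x))
    (\<lambda>t x. u t x / p x) (\<lambda>t x. deriv (\<lambda>s. u s x) t / p x)
    (\<lambda>t x. (1 / p x) *\<^sub>R (grad (u t) x + u t x *\<^sub>R grad V x))"
proof -
  interpret weighted_space p "transpose \<sigma>" "\<lambda>x. \<epsilon> *\<^sub>R (transpose \<sigma> *v M x)" \<kappa> \<delta> S by fact
  define Z where "Z = (\<integral>x. exp (- V x) \<partial>lborel)"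
  have pZ: "p = (\<lambda>x. exp (- V x) / Z)"
    by (simp add: p gibbs_density_def[abs_def] Z_def)
  have p0: "p x \<noteq> 0" for x
    using p_pos[of x] by simp
  have V1: "times_cont_differentiable (Suc 0) V" and V2: "times_cont_differentiable (Suc 0) (grad V)"
    using smooth_tcd[OF V] tcd_grad by blast+
  have u2: "times_cont_differentiable (Suc (Suc 0)) (u t)" if "0 < t" for t
    using u that by (simp only: fokker_planck_equation_def C12_regular_def numeral_2_eq_2)
  have "has_gradient (\<lambda>x. Z * exp (V x)) (\<lambda>x. (Z * exp (V x)) *\<^sub>R grad V x)"
    by (rule has_gradient_compose[OF has_gradient_grad[OF V1], of "\<lambda>v. Z * exp v" "\<lambda>v. Z * exp v"])
       (auto intro!: derivative_eq_intros continuous_intros has_gradient_imp_continuous[OF has_gradient_grad[OF V1]])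
  then have gp: "has_gradient (\<lambda>x. 1 / p x) (\<lambda>x. (1 / p x) *\<^sub>R grad V x)"
    by (simp add: pZ exp_minus divide_inverse mult.commute)
  show ?thesis
    unfolding weak_solution_def
  proof (intro conjI allI impI)
    show "continuous_on ({0..} \<times> UNIV) (\<lambda>(t, x). u t x / p x)"
      using u p0 unfolding fokker_planck_equation_def C12_regular_def split_beta
      by (intro continuous_intros continuous_on_compose2[OF p_cont]) auto
    show "continuous_on ({0<..} \<times> UNIV) (\<lambda>(t, x). deriv (\<lambda>s. u s x) t / p x)"
      using u p0 unfolding fokker_planck_equation_def C12_regular_def split_beta
      by (intro continuous_intros continuous_on_compose2[OF p_cont]) auto
    fix t :: real assume t: "0 < t"
    show "((\<lambda>s. u s x / p x) has_real_derivative deriv (\<lambda>s. u s x) t / p x) (at t)" for x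
    proof -
      have "(\<lambda>s. u s x) differentiable at t"
        using u t unfolding fokker_planck_equation_def C12_regular_def by blast
      then show ?thesis
        by (intro DERIV_cdivide) (simp only: DERIV_deriv_iff_real_differentiable)
    qed
    have ut: "has_gradient (u t) (grad (u t))"
      by (rule has_gradient_grad[OF tcd_Suc_imp[OF u2[OF t]]])
    show "has_gradient (\<lambda>x. u t x / p x) (\<lambda>x. (1 / p x) *\<^sub>R (grad (u t) x + u t x *\<^sub>R grad V x))"
      using has_gradient_mult[OF ut gp] by (simp add: scaleR_add_right add.commute mult.commute)
    fix \<psi> :: "real^'d \<Rightarrow> real" and G R
    assume \<psi>: "has_gradient \<psi> G" "\<forall>x. R < norm x \<longrightarrow> \<psi> x = 0"
    define F where "F = (\<lambda>x. (\<sigma> ** transpose \<sigma>) *v (u t x *\<^sub>R (grad V x - \<epsilon> *\<^sub>R M x) + grad (u t) x))"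
    have "times_cont_differentiable (Suc 0) (\<lambda>x. grad V x + (- \<epsilon>) *\<^sub>R M x)"
      by (intro tcd_Suc0_add V2 tcd_Suc0_bounded_linear[OF bounded_linear_scaleR_right] smooth_tcd M)
    then have F: "times_cont_differentiable (Suc 0) F"
      unfolding F_def
      by (intro tcd_Suc0_bounded_linear[OF matrix_vector_mul_bounded_linear] tcd_Suc0_add tcd_Suc0_scaleR
          tcd_grad u2 tcd_Suc_imp[OF u2] t) (simp del: times_cont_differentiable.simps)
    have "(\<integral>x. p x * (\<psi> x * (deriv (\<lambda>s. u s x) t / p x)) \<partial>lborel) = (\<integral>x. \<psi> x * divergence F x \<partial>lborel)"
      using u t p0 unfolding F_def fokker_planck_equation_def by simp
    also have "\<dots> = - (\<integral>x. G x \<bullet> F x \<partial>lborel)"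
      by (rule integration_by_parts[OF \<psi>(1) _ F]) (use \<psi>(2) in blast)
    also have "(\<lambda>x. G x \<bullet> F x) = (\<lambda>x. p x * ((transpose \<sigma> *v G x) \<bullet>
        (transpose \<sigma> *v ((1 / p x) *\<^sub>R (grad (u t) x + u t x *\<^sub>R grad V x)) -
         (u t x / p x) *\<^sub>R (\<epsilon> *\<^sub>R (transpose \<sigma> *v M x)))))"
      unfolding F_def inner_mult_transpose
      using p0
      by (simp add: fun_eq_iff matrix_vector_right_distrib matrix_vector_mult_diff_distrib
          matrix_vector_mult_scaleR inner_add_right inner_diff_right field_simps del: transpose_matrix_vector)
    finally show "(\<integral>x. p x * (\<psi> x * (deriv (\<lambda>s. u s x) t / p x)) \<partial>lborel) =
      - (\<integral>x. p x * ((transpose \<sigma> *v G x) \<bullet>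
        (transpose \<sigma> *v ((1 / p x) *\<^sub>R (grad (u t) x + u t x *\<^sub>R grad V x)) -
         (u t x / p x) *\<^sub>R (\<epsilon> *\<^sub>R (transpose \<sigma> *v M x)))) \<partial>lborel)" .
  qed
qed

lemma smooth_compactly_supported_bounded:
  fixes M :: "'a::euclidean_space \<Rightarrow> 'b::real_normed_vector"
  assumes "smooth_compactly_supported M"
  obtains b where "0 < b" "\<And>x. norm (M x) \<le> b"
proof -
  have "bounded {x. M x \<noteq> 0}"
    using bounded_subset[OF compact_imp_bounded closure_subset] assms
    unfolding smooth_compactly_supported_def by blast
  then obtain R where "\<And>x. M x \<noteq> 0 \<Longrightarrow> norm x \<le> R"
    by (auto simp: bounded_iff)
  then have "\<And>x. R < norm x \<Longrightarrow> M x = 0"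
    by (meson not_le)
  moreover have "continuous_on UNIV M"
    using assms smooth_tcd[of M 0] by (simp add: smooth_compactly_supported_def)
  ultimately show ?thesis
    using bounded_if_bounded_support that by blast
qed

theorem proposition3p1:
  fixes V :: "real^'d \<Rightarrow> real"
    and M :: "real^'d \<Rightarrow> real^'d"
    and \<sigma> :: "real^'d^'d"
  assumes "smooth V"
    and "assumption_I V"
    and "invertible \<sigma>"
    and "assumption_II \<sigma> V"
    and "smooth_compactly_supported M"
  shows "\<exists>\<epsilon>0>0. \<exists>C>0. \<exists>r>0.
           \<forall>\<epsilon>\<in>{0..<\<epsilon>0}. \<forall>\<rho> \<rho>inf.
             fokker_planck_solution V M \<sigma> \<epsilon> (gibbs_density V) \<rho> \<longrightarrow>
             invariant_density V M \<sigma> \<epsilon> \<rho>inf \<longrightarrow>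
             (\<forall>t\<ge>0. (\<integral>q. \<bar>\<rho> t q - \<rho>inf q\<bar> \<partial>lborel) \<le> C * exp (- r * t))"
proof (cases "prob_density (gibbs_density V)")
  case False
  \<comment> \<open>A solution is a probability density at time 0, where it equals
    \<open>gibbs_density V\<close>; in this case there is none, and any constants do.\<close>
  then have "\<not> fokker_planck_solution V M \<sigma> \<epsilon> (gibbs_density V) \<rho>" for \<epsilon> \<rho>
    by (auto simp: fokker_planck_solution_def dest!: spec[of _ 0])
  then show ?thesis
    by (simp add: gt_ex)
next
  case True
  define p where "p = gibbs_density V"
  define T where "T = transpose \<sigma>"
  have M: "smooth M"
    using assms by (simp add: smooth_compactly_supported_def)
  obtain \<kappa> where \<kappa>: "0 < \<kappa>" "\<And>f G R. has_gradient f G \<Longrightarrow> (\<And>x. R < norm x \<Longrightarrow> f x = 0) \<Longrightarrow>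
    (\<integral>x. p x * (f x)\<^sup>2 \<partial>lborel) \<le> (\<integral>x. p x * f x \<partial>lborel)\<^sup>2 +
      \<kappa> * (\<integral>x. p x * (norm (T *v G x))\<^sup>2 \<partial>lborel)"
    using gibbs_poincare[OF assms(1,3,4) True] unfolding p_def T_def by blast
  obtain S where S: "0 < S" "\<And>v. norm (T *v v) \<le> S * norm v"
    using matrix_norm_bound by blast
  obtain m where m: "0 < m" "\<And>x. norm (M x) \<le> m"
    using smooth_compactly_supported_bounded[OF assms(5)] by blast
  \<comment> \<open>Chosen for \<open>8 * \<kappa> * \<delta>\<^sup>2 \<le> 1\<close> with
    \<open>\<delta> = \<epsilon> * (S * m)\<close>: one factor \<open>\<epsilon>\<close> is
    estimated by 1, the other by the quotient.\<close>
  define \<epsilon>0 where "\<epsilon>0 = min 1 (1 / (8 * \<kappa> * (S * m)\<^sup>2))"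
  have "(\<integral>q. \<bar>\<rho> t q - \<rho>inf q\<bar> \<partial>lborel) \<le> 1 * exp (- (1 / (8 * \<kappa>)) * t)"
    if \<epsilon>: "\<epsilon> \<in> {0..<\<epsilon>0}" and \<rho>: "fokker_planck_solution V M \<sigma> \<epsilon> (gibbs_density V) \<rho>"
      and \<rho>inf: "invariant_density V M \<sigma> \<epsilon> \<rho>inf" and t: "0 \<le> t" for \<epsilon> \<rho> \<rho>inf t
  proof -
    define \<delta> where "\<delta> = \<epsilon> * (S * m)"
    have ws: "weighted_space p T (\<lambda>x. \<epsilon> *\<^sub>R (T *v M x)) \<kappa> \<delta> S"
    proof
      show "continuous_on UNIV p"
        unfolding p_def by (rule continuous_gibbs_density[OF assms(1)])
      show "0 < p x" for x
        using gibbs_density_normalization_pos(1)[OF True] by (simp add: p_def gibbs_density_def)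
      show "integrable lborel p" "integral\<^sup>L lborel p = 1"
        using True by (auto simp: p_def prob_density_def)
      show "continuous_on UNIV (\<lambda>x. \<epsilon> *\<^sub>R (T *v M x))"
        using smooth_tcd[OF M, of 0] by (intro continuous_intros continuous_on_matrix_mult) simp
      show "norm (\<epsilon> *\<^sub>R (T *v M x)) \<le> \<delta>" for x
        using \<epsilon> S m unfolding \<delta>_def
        by (auto intro!: mult_left_mono order_trans[OF S(2)])
      show "(\<integral>x. p x * (f x)\<^sup>2 \<partial>lborel) \<le> (\<integral>x. p x * f x \<partial>lborel)\<^sup>2 +
          \<kappa> * (\<integral>x. p x * (norm (T *v G x))\<^sup>2 \<partial>lborel)"
        if "has_gradient f G" "\<And>x. R < norm x \<Longrightarrow> f x = 0" for f G R
        using that by (rule \<kappa>(2))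
    qed (use S \<kappa> in auto)
    interpret weighted_space p T "\<lambda>x. \<epsilon> *\<^sub>R (T *v M x)" \<kappa> \<delta> S by (rule ws)
    have "8 * \<kappa> * \<delta>\<^sup>2 = \<epsilon> * (\<epsilon> * (8 * \<kappa> * (S * m)\<^sup>2))"
      by (simp add: \<delta>_def power2_eq_square)
    also have "\<dots> \<le> 1 * 1"
      using \<epsilon> S m \<kappa> by (intro mult_mono) (auto simp: \<epsilon>0_def field_simps)
    finally have small: "8 * \<kappa> * \<delta>\<^sup>2 \<le> 1" by simp
    have p0: "p x \<noteq> 0" for x using p_pos[of x] by simp
    have \<rho>': "fokker_planck_equation V M \<sigma> \<epsilon> \<rho>" "\<rho> 0 = p" "\<And>t. 0 \<le> t \<Longrightarrow> prob_density (\<rho> t)"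
      using \<rho> by (auto simp: fokker_planck_solution_def p_def)
    have \<rho>inf': "fokker_planck_equation V M \<sigma> \<epsilon> (\<lambda>t. \<rho>inf)" "prob_density \<rho>inf"
      using \<rho>inf by (auto simp: invariant_density_def)
    note weak = fokker_planck_weak_solution[OF ws[unfolded T_def] assms(1) M p_def, folded T_def]
    have "(\<integral>x. p x * \<bar>\<rho> t x / p x - \<rho>inf x / p x\<bar> \<partial>lborel) \<le> exp (- (1 / (8 * \<kappa>)) * t)"
      by (rule L1_decay[OF weak[OF \<rho>'(1)] _ _ _ _ weak[OF \<rho>inf'(1)] _ _ _ small t])
         (use \<rho>'(2,3) \<rho>inf'(2) p0 p_pos in \<open>auto simp: prob_density_def less_imp_le\<close>)
    moreover have "p x * \<bar>\<rho> t x / p x - \<rho>inf x / p x\<bar> = \<bar>\<rho> t x - \<rho>inf x\<bar>" for x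
      using p_pos[of x] by (simp add: abs_divide flip: diff_divide_distrib)
    ultimately show ?thesis by simp
  qed
  moreover have "0 < \<epsilon>0" "0 < 1 / (8 * \<kappa>)"
    using \<kappa> S m by (simp_all add: \<epsilon>0_def)
  ultimately show ?thesis
    by (intro exI[of _ \<epsilon>0] conjI exI[of _ 1] exI[of _ "1 / (8 * \<kappa>)"] ballI allI impI) auto
qed

end
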